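(* Suppose Assumptions 1, 2 and 3 (stated in the context) hold, let $\underline d':=1/\ell$ and $D_{\min}:=\min_{i\in\mathcal N}D_i$. Then the system $$\dot x=-X\tfrac{\partial}{\partial x}L(x,y)^T,\qquad \dot y=Y\Big[\tfrac{\partial}{\partial y}L(x,y)^T+g(x,y)\Big]^+_\rho$$ converges to a point in the optimal set $E$ for every initial condition whenever, for all $i\in\mathcal N$, $$2\Big(\underline d'-\sqrt{\underline d'^2+\underline d' D_{\min}}\Big)<\delta a_i<2\Big(\underline d'+\sqrt{\underline d'^2+\underline d' D_{\min}}\Big).$$
   Context: Network. $(\mathcal N,\mathcal E)$ is a finite connected directed graph with $ij\in\mathcal E\Rightarrow ji\notin\mathcal E$; $\mathcal N=\mathcal G\cup\mathcal L$ is a partition into generator and load buses. Each line $e=ij$ has susceptance $B_{ij}>0$; $B=\mathrm{diag}(B_e)_{e\in\mathcal E}$. $C\in\mathbb R^{|\mathcal N|\times|\mathcal E|}$ is the incidence matrix: for $e=ij$, $C_{i,e}=1$, $C_{j,e}=-1$, and other entries are $0$. $L_B=CBC^T$. $D_i>0$ for $i\in\mathcal N$, $D=\mathrm{diag}(D_i)$. $P^{in}\in\mathbb R^{|\mathcal N|}$ is given. Areas. $\mathcal K$ is the finite set of control areas, $\mathcal N_k\subseteq\mathcal N$ the buses of area $k$, $\mathcal B_k\subseteq\mathcal E$ the edges with exactly one endpoint in $\mathcal N_k$. $\hat C\in\mathbb R^{|\mathcal K|\times|\mathcal E|}$: for $ij\in\mathcal B_k$, $\hat C_{k,ij}=1$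 if $i\in\mathcal N_k$ and $-1$ if $j\in\mathcal N_k$; $\hat C_{k,ij}=0$ if $ij\notin\mathcal B_k$. $\hat P\in\mathbb R^{|\mathcal K|}$ and the limits $\overline P,\underline P=-\overline P\in\mathbb R^{|\mathcal E|}$ are given. OLC problem: minimize $\sum_{i\in\mathcal N}c_i(d_i)$ over $(d,\omega,\theta)$ subject to $P^{in}-(d+D\omega)=L_B\theta$, $\omega=0$, $\hat CBC^T\theta=\hat P$, $\underline P\le BC^T\theta\le\overline P$. Assumption 1: $c_i$ is $\alpha$-strongly convex and $C^2$ ($c_i''\ge\alpha>0$) in the interior of $\mathcal D_i=[\underline d_i,\overline d_i]\subseteq\mathbb R$ (possibly unbounded), and $c_i(d_i)\to+\infty$ as $d_i\to\partial\mathcal D_i$. Assumption 2: OLC is feasible and has at least one feasible $(d,\omega,\theta)$ with $d\in\prod_i\mathrm{Int}\,\mathcal D_i$. Assumption 3: the functions $c_i'$ are Lipschitz continuous with Lipschitz constant $\ell>0$ (this forces $\mathcal D_i=\mathbb R$). Set $d_i(\cdot):=(c_i')^{-1}(\cdot)$. Reduced Lagrangian. Let $x=(\phi,P)\in\mathbb R^{|\mathcal N|+|\mathcal E|}$, $\sigma=(\lambda,\nu,\pi,\rho^+,\rho^-)$ with $\lambda,\nu\in\mathbb R^{|\mathcal N|}$, $\pi\in\mathbb R^{|\mathcal K|}$, $\rho^\pm\in\mathbb R^{|\mathcal E|}$, $\rho=(\rho^+,\rho^-)$. Let $$\Phi_i(\lambda_i,\nu_i)=c_i(d_i(\lambda_i+\nu_i))-(\lambda_i+\nu_i)d_i(\lambda_i+\nu_i)-\tfrac{D_i}{2}\nu_i^2+(\lambda_i+\nu_i)P_i^{in},$$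 $$L(x,\sigma)=\sum_{i\in\mathcal N}\Phi_i(\lambda_i,\nu_i)-P^TC^T\nu-\pi^T\hat P-\rho^{+T}\overline P+\rho^{-T}\underline P-\phi^T\big(L_B\lambda-CB\hat C^T\pi-CB(\rho^+-\rho^-)\big).$$ With $y=(\lambda,\nu_{\mathcal G},\pi,\rho^+,\rho^-)$, define $L(x,y)=\max_{\nu_{\mathcal L}}L(x,\sigma)$; the (unique) maximizer is denoted $\nu^*_{\mathcal L}(x,y)$. Perturbation. $a_i\in\mathbb R$ are controller parameters and $\delta a_i:=a_i-D_i$. The vector $g(x,y)$ has the same dimension as $y$: its $\lambda_i$-component is $\delta a_i\,\nu_i^*(x,y)$ for $i\in\mathcal L$ and $\delta a_i\,\nu_i$ for $i\in\mathcal G$; its components in the positions of $\nu_{\mathcal G},\pi,\rho^+,\rho^-$ are $0$. Dynamics. $X,Y$ are diagonal matrices of positive gains. The projection $[a]^+_\rho$ acts only on the components corresponding to $\rho$: there $[a_i]^+_{\rho_i}=a_i$ if $a_i>0$ or $\rho_i>0$, and $0$ otherwise; other components are unchanged. The state space is restricted to $\rho^+\ge0,\rho^-\ge0$ (preserved by the dynamics; in particular in $E$ and for initial conditions). Solutions are understood in the Carathéodory sense. Optimal set: $$E=\Big\{(x,y):\ \tfrac{\partial L}{\partial x}(x,y)=0,\ \Big[\tfrac{\partial L}{\partial y}(x,y)^T\Big]^+_{\rho}=0\Big\}.$$ *)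

theory Defs
  imports "HOL-Analysis.Analysis"
begin

text \<open>
  Buses are the elements of a finite type, so the set of buses is \<open>UNIV\<close>. A line \<open>ij\<close> is the pair
  \<open>(i, j)\<close>. The generator buses are \<open>gens\<close> and the load buses are its complement. The sets of lines,
  generators, loads and areas may each be empty; a vector indexed by one of them is a function of
  which only the values on that set are used.
\<close>

record ('n, 'k) network =
  lines :: "('n \<times> 'n) set"
  gens :: "'n set"
  suscept :: "'n \<times> 'n \<Rightarrow> real"
  damp :: "'n \<Rightarrow> real"
  Pin :: "'n \<Rightarrow> real"
  areas :: "'k set"
  area_buses :: "'k \<Rightarrow> 'n set"
  Phat :: "'k \<Rightarrow> real"
  Pmax :: "'n \<times> 'n \<Rightarrow> real"
  cost :: "'n \<Rightarrow> real \<Rightarrow> real"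
  dlow :: "'n \<Rightarrow> ereal"
  dup :: "'n \<Rightarrow> ereal"

text \<open>Connectedness of the directed graph is that of the underlying undirected graph.\<close>

definition valid_network :: "('n::finite, 'k) network \<Rightarrow> bool" where
  "valid_network S \<longleftrightarrow>
     (\<forall>i j. (i, j) \<in> lines S \<longrightarrow> (j, i) \<notin> lines S) \<and>
     (\<forall>i j. (i, j) \<in> (lines S \<union> (lines S)\<inverse>)\<^sup>*) \<and>
     (\<forall>e\<in>lines S. suscept S e > 0) \<and>
     (\<forall>i. damp S i > 0) \<and>
     finite (areas S)"

definition Pmin :: "('n, 'k) network \<Rightarrow> 'n \<times> 'n \<Rightarrow> real" where
  "Pmin S e = - Pmax S e"

definition inc :: "'n \<Rightarrow> 'n \<times> 'n \<Rightarrow> real" where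
  "inc i e = (if i = fst e then 1 else if i = snd e then -1 else 0)"

definition laplacian :: "('n, 'k) network \<Rightarrow> 'n \<Rightarrow> 'n \<Rightarrow> real" where
  "laplacian S i j = (\<Sum>e\<in>lines S. inc i e * suscept S e * inc j e)"

definition boundary_lines :: "('n, 'k) network \<Rightarrow> 'k \<Rightarrow> ('n \<times> 'n) set" where
  "boundary_lines S k =
     {e \<in> lines S. (fst e \<in> area_buses S k) \<noteq> (snd e \<in> area_buses S k)}"

definition area_inc :: "('n, 'k) network \<Rightarrow> 'k \<Rightarrow> 'n \<times> 'n \<Rightarrow> real" where
  "area_inc S k e =
     (if e \<in> boundary_lines S k then (if fst e \<in> area_buses S k then 1 else -1) else 0)"

definition line_flow :: "('n::finite, 'k) network \<Rightarrow> ('n \<Rightarrow> real) \<Rightarrow> 'n \<times> 'n \<Rightarrow> real" where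
  "line_flow S \<theta> e = suscept S e * (\<Sum>i\<in>UNIV. inc i e * \<theta> i)"

definition load_set :: "('n, 'k) network \<Rightarrow> 'n \<Rightarrow> real set" where
  "load_set S i = {d. dlow S i \<le> ereal d \<and> ereal d \<le> dup S i}"

definition OLC_feasible ::
  "('n::finite, 'k) network \<Rightarrow> ('n \<Rightarrow> real) \<Rightarrow> ('n \<Rightarrow> real) \<Rightarrow> ('n \<Rightarrow> real) \<Rightarrow> bool" where
  "OLC_feasible S d \<omega> \<theta> \<longleftrightarrow>
     (\<forall>i. d i \<in> load_set S i) \<and>
     (\<forall>i. Pin S i - (d i + damp S i * \<omega> i) = (\<Sum>j\<in>UNIV. laplacian S i j * \<theta> j)) \<and>
     (\<forall>i. \<omega> i = 0) \<and>
     (\<forall>k\<in>areas S. (\<Sum>e\<in>lines S. area_inc S k e * line_flow S \<theta> e) = Phat S k) \<and>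
     (\<forall>e\<in>lines S. Pmin S e \<le> line_flow S \<theta> e \<and> line_flow S \<theta> e \<le> Pmax S e)"

definition strongly_convex_on :: "real set \<Rightarrow> real \<Rightarrow> (real \<Rightarrow> real) \<Rightarrow> bool" where
  "strongly_convex_on A \<alpha> f \<longleftrightarrow> convex_on A (\<lambda>x. f x - \<alpha> / 2 * x\<^sup>2)"

text \<open>
  The one-sided limits are taken in the extended reals, so the end points may be infinite.
\<close>

definition costs_strongly_convex :: "('n, 'k) network \<Rightarrow> real \<Rightarrow> bool" where
  "costs_strongly_convex S \<alpha> \<longleftrightarrow> \<alpha> > 0 \<and>
     (\<forall>i. strongly_convex_on (interior (load_set S i)) \<alpha> (cost S i) \<and>
          (\<forall>d\<in>interior (load_set S i).
              cost S i field_differentiable at d \<and>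
              deriv (cost S i) field_differentiable at d \<and>
              deriv (deriv (cost S i)) d \<ge> \<alpha>) \<and>
          continuous_on (interior (load_set S i)) (deriv (deriv (cost S i))) \<and>
          filterlim (\<lambda>d. cost S i (real_of_ereal d)) at_top (at_right (dlow S i)) \<and>
          filterlim (\<lambda>d. cost S i (real_of_ereal d)) at_top (at_left (dup S i)))"

definition strictly_feasible :: "('n::finite, 'k) network \<Rightarrow> bool" where
  "strictly_feasible S \<longleftrightarrow>
     (\<exists>d \<omega> \<theta>. OLC_feasible S d \<omega> \<theta> \<and> (\<forall>i. d i \<in> interior (load_set S i)))"

definition marginal_costs_lipschitz :: "('n, 'k) network \<Rightarrow> real \<Rightarrow> bool" where
  "marginal_costs_lipschitz S ell \<longleftrightarrow> ell > 0 \<and>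
     (\<forall>i. ell-lipschitz_on (interior (load_set S i)) (deriv (cost S i)))"

text \<open>
  The primal vector \<open>x = (\<phi>, P)\<close> and the dual vector \<open>y = (\<lambda>, \<nu>\<^sub>G, \<pi>, \<rho>\<^sup>+, \<rho>\<^sup>-)\<close> are real functions
  on tagged index types; \<open>x_index\<close> and \<open>y_index\<close> are the positions that actually occur.
\<close>

datatype 'n xpos = XPhi 'n | XP "'n \<times> 'n"

datatype ('n, 'k) ypos =
  YLam 'n | YNu 'n | YPi 'k | YRhoP "'n \<times> 'n" | YRhoM "'n \<times> 'n"

type_synonym 'n xvec = "'n xpos \<Rightarrow> real"
type_synonym ('n, 'k) yvec = "('n, 'k) ypos \<Rightarrow> real"

definition x_index :: "('n, 'k) network \<Rightarrow> 'n xpos set" where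
  "x_index S = range XPhi \<union> XP ` lines S"

definition y_index :: "('n, 'k) network \<Rightarrow> ('n, 'k) ypos set" where
  "y_index S = range YLam \<union> YNu ` gens S \<union> YPi ` areas S \<union> YRhoP ` lines S \<union> YRhoM ` lines S"

definition demand :: "('n, 'k) network \<Rightarrow> 'n \<Rightarrow> real \<Rightarrow> real" where
  "demand S i = the_inv_into (interior (load_set S i)) (deriv (cost S i))"

definition Phi :: "('n, 'k) network \<Rightarrow> 'n \<Rightarrow> real \<Rightarrow> real \<Rightarrow> real" where
  "Phi S i l v =
     cost S i (demand S i (l + v)) - (l + v) * demand S i (l + v)
     - damp S i / 2 * v\<^sup>2 + (l + v) * Pin S i"

definition lagrangian ::
  "('n::finite, 'k) network \<Rightarrow> ('n \<Rightarrow> real) \<times> ('n \<times> 'n \<Rightarrow> real) \<Rightarrow>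
   ('n \<Rightarrow> real) \<times> ('n \<Rightarrow> real) \<times> ('k \<Rightarrow> real) \<times> ('n \<times> 'n \<Rightarrow> real) \<times> ('n \<times> 'n \<Rightarrow> real) \<Rightarrow> real"
  where
  "lagrangian S = (\<lambda>(\<phi>, P) (l, \<nu>, \<pi>, \<rho>p, \<rho>m).
     (\<Sum>i\<in>UNIV. Phi S i (l i) (\<nu> i))
     - (\<Sum>e\<in>lines S. P e * (\<Sum>i\<in>UNIV. inc i e * \<nu> i))
     - (\<Sum>k\<in>areas S. \<pi> k * Phat S k)
     - (\<Sum>e\<in>lines S. \<rho>p e * Pmax S e)
     + (\<Sum>e\<in>lines S. \<rho>m e * Pmin S e)
     - (\<Sum>i\<in>UNIV. \<phi> i *
          ((\<Sum>j\<in>UNIV. laplacian S i j * l j)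
           - (\<Sum>e\<in>lines S. inc i e * suscept S e * (\<Sum>k\<in>areas S. area_inc S k e * \<pi> k))
           - (\<Sum>e\<in>lines S. inc i e * suscept S e * (\<rho>p e - \<rho>m e)))))"

text \<open>Here \<open>\<nu>\<close> is the full vector over all buses, and the entries \<open>YNu\<close> of \<open>y\<close> are ignored.\<close>

definition lagrangian_at ::
  "('n::finite, 'k) network \<Rightarrow> 'n xvec \<Rightarrow> ('n, 'k) yvec \<Rightarrow> ('n \<Rightarrow> real) \<Rightarrow> real" where
  "lagrangian_at S x y \<nu> =
     lagrangian S (x \<circ> XPhi, x \<circ> XP) (y \<circ> YLam, \<nu>, y \<circ> YPi, y \<circ> YRhoP, y \<circ> YRhoM)"

definition nu_extensions :: "('n, 'k) network \<Rightarrow> ('n, 'k) yvec \<Rightarrow> ('n \<Rightarrow> real) set" where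
  "nu_extensions S y = {\<nu>. \<forall>i\<in>gens S. \<nu> i = y (YNu i)}"

definition reduced_lagrangian ::
  "('n::finite, 'k) network \<Rightarrow> 'n xvec \<Rightarrow> ('n, 'k) yvec \<Rightarrow> real" where
  "reduced_lagrangian S x y = (SUP \<nu>\<in>nu_extensions S y. lagrangian_at S x y \<nu>)"

definition nu_star ::
  "('n::finite, 'k) network \<Rightarrow> 'n xvec \<Rightarrow> ('n, 'k) yvec \<Rightarrow> 'n \<Rightarrow> real" where
  "nu_star S x y = arg_max (lagrangian_at S x y) (\<lambda>\<nu>. \<nu> \<in> nu_extensions S y)"

definition partial :: "(('a \<Rightarrow> real) \<Rightarrow> real) \<Rightarrow> 'a \<Rightarrow> ('a \<Rightarrow> real) \<Rightarrow> real" where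
  "partial f p z = deriv (\<lambda>s. f (z(p := s))) (z p)"

definition dL_dx :: "('n::finite, 'k) network \<Rightarrow> 'n xvec \<Rightarrow> ('n, 'k) yvec \<Rightarrow> 'n xvec" where
  "dL_dx S x y p = partial (\<lambda>x'. reduced_lagrangian S x' y) p x"

definition dL_dy :: "('n::finite, 'k) network \<Rightarrow> 'n xvec \<Rightarrow> ('n, 'k) yvec \<Rightarrow> ('n, 'k) yvec" where
  "dL_dy S x y q = partial (\<lambda>y'. reduced_lagrangian S x y') q y"

definition perturbation ::
  "('n::finite, 'k) network \<Rightarrow> ('n \<Rightarrow> real) \<Rightarrow> 'n xvec \<Rightarrow> ('n, 'k) yvec \<Rightarrow> ('n, 'k) yvec" where
  "perturbation S \<delta>a x y q =
     (case q of
        YLam i \<Rightarrow> \<delta>a i * (if i \<in> gens S then y (YNu i) else nu_star S x y i)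
      | _ \<Rightarrow> 0)"

definition proj_rho :: "('n, 'k) yvec \<Rightarrow> ('n, 'k) yvec \<Rightarrow> ('n, 'k) yvec" where
  "proj_rho y v q =
     (case q of
        YRhoP e \<Rightarrow> if v q > 0 \<or> y q > 0 then v q else 0
      | YRhoM e \<Rightarrow> if v q > 0 \<or> y q > 0 then v q else 0
      | _ \<Rightarrow> v q)"

definition rho_nonneg :: "('n, 'k) network \<Rightarrow> ('n, 'k) yvec \<Rightarrow> bool" where
  "rho_nonneg S y \<longleftrightarrow> (\<forall>e\<in>lines S. y (YRhoP e) \<ge> 0 \<and> y (YRhoM e) \<ge> 0)"

definition optimal_set :: "('n::finite, 'k) network \<Rightarrow> ('n xvec \<times> ('n, 'k) yvec) set" where
  "optimal_set S =
     {(x, y). rho_nonneg S y \<and>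
        (\<forall>p\<in>x_index S. dL_dx S x y p = 0) \<and>
        (\<forall>q\<in>y_index S. proj_rho y (dL_dy S x y) q = 0)}"

definition abs_cont_on :: "real \<Rightarrow> real \<Rightarrow> (real \<Rightarrow> real) \<Rightarrow> bool" where
  "abs_cont_on a b f \<longleftrightarrow>
     (\<forall>\<epsilon>>0. \<exists>\<delta>>0. \<forall>(n::nat) u v.
        (\<forall>k<n. a \<le> u k \<and> u k \<le> v k \<and> v k \<le> b) \<and>
        disjoint_family_on (\<lambda>k. {u k<..<v k}) {..<n} \<and>
        (\<Sum>k<n. v k - u k) < \<delta>
        \<longrightarrow> (\<Sum>k<n. \<bar>f (v k) - f (u k)\<bar>) < \<epsilon>)"

text \<open>
  Caratheodory solution on \<open>{0..}\<close>: locally absolutely continuous, and the differential equation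
  holds at almost every time. \<open>X\<close> and \<open>Y\<close> are the diagonals of the gain matrices.
\<close>

definition caratheodory_solution ::
  "('n::finite, 'k) network \<Rightarrow> ('n \<Rightarrow> real) \<Rightarrow> 'n xvec \<Rightarrow> ('n, 'k) yvec \<Rightarrow>
   (real \<Rightarrow> 'n xvec) \<Rightarrow> (real \<Rightarrow> ('n, 'k) yvec) \<Rightarrow> bool" where
  "caratheodory_solution S \<delta>a X Y x y \<longleftrightarrow>
     (\<forall>p\<in>x_index S.
        (\<forall>T>0. abs_cont_on 0 T (\<lambda>t. x t p)) \<and>
        (AE t in lebesgue. t > 0 \<longrightarrow>
           ((\<lambda>s. x s p) has_real_derivative - X p * dL_dx S (x t) (y t) p) (at t))) \<and>
     (\<forall>q\<in>y_index S.
        (\<forall>T>0. abs_cont_on 0 T (\<lambda>t. y t q)) \<and>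
        (AE t in lebesgue. t > 0 \<longrightarrow>
           ((\<lambda>s. y s q) has_real_derivative
              Y q * proj_rho (y t)
                      (\<lambda>r. dL_dy S (x t) (y t) r + perturbation S \<delta>a (x t) (y t) r) q) (at t)))"

definition converges_into ::
  "('n, 'k) network \<Rightarrow> ('n xvec \<times> ('n, 'k) yvec) set \<Rightarrow>
   (real \<Rightarrow> 'n xvec) \<Rightarrow> (real \<Rightarrow> ('n, 'k) yvec) \<Rightarrow> bool" where
  "converges_into S E x y \<longleftrightarrow>
     (\<exists>(xe, ye) \<in> E.
        (\<forall>p\<in>x_index S. ((\<lambda>t. x t p) \<longlongrightarrow> xe p) at_top) \<and>
        (\<forall>q\<in>y_index S. ((\<lambda>t. y t q) \<longlongrightarrow> ye q) at_top))"

end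

theory Submission
  imports Defs
begin

text \<open>
  The dynamics are a projected gradient flow for a saddle function, with the perturbation \<open>g\<close>
  added. The whole argument rests on one fact: with \<open>g\<close> included, the vector field is still
  dissipative, the negative of a monotone map. In the inner product of two field differences with two state differences every term
  that couples buses cancels. What remains at a bus is a quadratic form in the change \<open>l\<close> of its
  price and the change \<open>n\<close> of its frequency. With \<open>u = l + n\<close> and a demand slope \<open>r \<ge> 1 / ell\<close> it is
  \<open>- r * u\<^sup>2 + \<delta>a * u * n - (damp + \<delta>a) * n\<^sup>2\<close>, and the interval assumed for \<open>\<delta>a\<close> is exactly the one
  in which this form is negative definite for the least slope \<open>1 / ell\<close> and the least damping
  (\<open>field_dissipation\<close>, \<open>bus_dissipation\<close>). Projection onto \<open>\<rho> \<ge> 0\<close> keeps the field dissipative, so the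
  flow never increases the distance of two solutions, measured with the inverse gains as weights.

  Existence uses the reflection map. A projected component is its unprojected drift plus the least
  nondecreasing push that keeps it nonnegative, and this push depends on the drift in a Lipschitz
  way. Picard iteration for the reflected integral equation therefore converges, and its fixed
  point satisfies the projected equation outside a countable set of times
  (\<open>reflect_derivative\<close>, \<open>projected_solution_exists\<close>).

  Convergence needs an equilibrium to compare with. One is built from a minimiser of the load
  control problem and its multipliers, which exist by Farkas' lemma because all constraints are
  affine (\<open>optimal_multipliers\<close>). The distance to it decreases, so a solution has a limit point. The
  solution started there keeps a constant distance, hence dissipates nothing, and the network
  equations then force it to be at rest (\<open>constant_energy_equilibrium\<close>). So the limit point is an
  equilibrium, the distance to it decreases as well, and the whole solution converges to it
  (\<open>convergence\<close>). At an equilibrium all frequencies are zero. There \<open>g\<close> vanishes, and the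
  equilibrium lies in the optimal set (\<open>equilibrium_optimal\<close>).
\<close>

section \<open>Absolutely continuous functions\<close>

definition small_intervals ::
  "real \<Rightarrow> real \<Rightarrow> real \<Rightarrow> nat \<Rightarrow> (nat \<Rightarrow> real) \<Rightarrow> (nat \<Rightarrow> real) \<Rightarrow> bool" where
  "small_intervals a b d n u v \<longleftrightarrow> (\<forall>k<n. a \<le> u k \<and> u k \<le> v k \<and> v k \<le> b) \<and>
     disjoint_family_on (\<lambda>k. {u k<..<v k}) {..<n} \<and> (\<Sum>k<n. v k - u k) < d"

lemma abs_cont_on_iff:
  "abs_cont_on a b f \<longleftrightarrow> (\<forall>e>0. \<exists>d>0. \<forall>n u v.
     small_intervals a b d n u v \<longrightarrow> (\<Sum>k<n. \<bar>f (v k) - f (u k)\<bar>) < e)"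
  by (simp add: abs_cont_on_def small_intervals_def)

lemma abs_cont_on_dominated:
  assumes "abs_cont_on a b f"
    and "0 \<le> M"
    and dom: "\<And>s t. \<lbrakk>a \<le> s; s \<le> b; a \<le> t; t \<le> b\<rbrakk> \<Longrightarrow> \<bar>g t - g s\<bar> \<le> M * \<bar>f t - f s\<bar>"
  shows "abs_cont_on a b g"
  unfolding abs_cont_on_iff
proof (intro allI impI)
  fix e :: real assume "e > 0"
  then have "e / (M + 1) > 0" using \<open>0 \<le> M\<close> by simp
  then obtain d where "d > 0" and d: "\<And>n u v. small_intervals a b d n u v
        \<Longrightarrow> (\<Sum>k<n. \<bar>f (v k) - f (u k)\<bar>) < e / (M + 1)"
    using assms(1) unfolding abs_cont_on_iff by meson
  show "\<exists>d>0. \<forall>n u v. small_intervals a b d n u v \<longrightarrow> (\<Sum>k<n. \<bar>g (v k) - g (u k)\<bar>) < e"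
  proof (intro exI conjI allI impI)
    fix n :: nat and u v :: "nat \<Rightarrow> real"
    assume A: "small_intervals a b d n u v"
    have "(\<Sum>k<n. \<bar>g (v k) - g (u k)\<bar>) \<le> (\<Sum>k<n. M * \<bar>f (v k) - f (u k)\<bar>)"
      using A by (intro sum_mono dom) (force simp: small_intervals_def)+
    also have "\<dots> = M * (\<Sum>k<n. \<bar>f (v k) - f (u k)\<bar>)"
      by (simp add: sum_distrib_left)
    also have "\<dots> \<le> M * (e / (M + 1))"
      using d[OF A] \<open>0 \<le> M\<close> by (intro mult_left_mono) auto
    also have "\<dots> < e"
      using \<open>0 \<le> M\<close> \<open>e > 0\<close> by (simp add: field_simps)
    finally show "(\<Sum>k<n. \<bar>g (v k) - g (u k)\<bar>) < e" .
  qed (use \<open>d > 0\<close> in auto)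
qed

lemma abs_cont_on_id: "abs_cont_on a b (\<lambda>t. t)"
  unfolding abs_cont_on_iff
proof (intro allI impI)
  fix e :: real assume e: "e > 0"
  show "\<exists>d>0. \<forall>n u v. small_intervals a b d n u v \<longrightarrow> (\<Sum>k<n. \<bar>v k - u k\<bar>) < e"
    by (rule exI[of _ e]) (auto simp: e small_intervals_def)
qed

lemma abs_cont_on_lipschitz:
  assumes "0 \<le> M" "\<And>s t. \<lbrakk>a \<le> s; s \<le> t; t \<le> b\<rbrakk> \<Longrightarrow> \<bar>g t - g s\<bar> \<le> M * (t - s)"
  shows "abs_cont_on a b g"
proof (rule abs_cont_on_dominated[OF abs_cont_on_id \<open>0 \<le> M\<close>])
  fix s t assume st: "a \<le> s" "s \<le> b" "a \<le> t" "t \<le> b"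
  show "\<bar>g t - g s\<bar> \<le> M * \<bar>t - s\<bar>"
    using assms(2)[of s t] assms(2)[of t s] st by (cases "s \<le> t") (auto simp: abs_minus_commute)
qed

lemma abs_cont_on_subset:
  assumes "abs_cont_on a b f" "a \<le> c" "d \<le> b"
  shows "abs_cont_on c d f"
  using assms unfolding abs_cont_on_iff small_intervals_def by (meson order_trans)

lemma abs_cont_on_const: "abs_cont_on a b (\<lambda>t. c)"
  by (rule abs_cont_on_lipschitz[of 0]) auto

lemma abs_cont_on_add:
  assumes "abs_cont_on a b f" "abs_cont_on a b g"
  shows "abs_cont_on a b (\<lambda>t. f t + g t)"
  unfolding abs_cont_on_iff
proof (intro allI impI)
  fix e :: real assume e: "e > 0"
  let ?P = "small_intervals a b"
  obtain d1 where d1: "d1 > 0" "\<And>n u v. ?P d1 n u v \<Longrightarrow> (\<Sum>k<n. \<bar>f (v k) - f (u k)\<bar>) < e/2"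
    using assms(1) half_gt_zero[OF e] unfolding abs_cont_on_iff by meson
  obtain d2 where d2: "d2 > 0" "\<And>n u v. ?P d2 n u v \<Longrightarrow> (\<Sum>k<n. \<bar>g (v k) - g (u k)\<bar>) < e/2"
    using assms(2) half_gt_zero[OF e] unfolding abs_cont_on_iff by meson
  have "(\<Sum>k<n. \<bar>(f (v k) + g (v k)) - (f (u k) + g (u k))\<bar>) < e" if "?P (min d1 d2) n u v" for n u v
  proof -
    have "?P d1 n u v" "?P d2 n u v" using that unfolding small_intervals_def by auto
    then have "(\<Sum>k<n. \<bar>f (v k) - f (u k)\<bar>) + (\<Sum>k<n. \<bar>g (v k) - g (u k)\<bar>) < e"
      using d1(2)[of n u v] d2(2)[of n u v] by simp
    moreover have "(\<Sum>k<n. \<bar>(f (v k) + g (v k)) - (f (u k) + g (u k))\<bar>)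
        \<le> (\<Sum>k<n. \<bar>f (v k) - f (u k)\<bar> + \<bar>g (v k) - g (u k)\<bar>)"
      by (rule sum_mono) linarith
    ultimately show ?thesis by (simp add: sum.distrib)
  qed
  then show "\<exists>d>0. \<forall>n u v. small_intervals a b d n u v \<longrightarrow> (\<Sum>k<n. \<bar>(f (v k) + g (v k)) - (f (u k) + g (u k))\<bar>) < e"
    using d1(1) d2(1) by (intro exI[of _ "min d1 d2"]) auto
qed

lemma abs_cont_on_sum:
  assumes "finite J" "\<And>j. j \<in> J \<Longrightarrow> abs_cont_on a b (f j)"
  shows "abs_cont_on a b (\<lambda>t. \<Sum>j\<in>J. f j t)"
  using assms by (induction J) (simp_all add: abs_cont_on_const abs_cont_on_add)

lemma abs_cont_on_continuous:
  assumes "abs_cont_on a b f"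
  shows "continuous_on {a..b} f"
  unfolding continuous_on_iff
proof (intro ballI allI impI)
  fix x e :: real assume x: "x \<in> {a..b}" and e: "e > 0"
  obtain d where "d > 0" and d: "\<And>n u v. small_intervals a b d n u v
        \<Longrightarrow> (\<Sum>k<n. \<bar>f (v k) - f (u k)\<bar>) < e"
    using assms e unfolding abs_cont_on_iff by meson
  have "\<bar>f t - f x\<bar> < e" if "t \<in> {a..b}" "\<bar>t - x\<bar> < d" for t
    using d[of "Suc 0" "\<lambda>_. min x t" "\<lambda>_. max x t"] x that
    by (cases "x \<le> t") (auto simp: small_intervals_def disjoint_family_on_def abs_minus_commute)
  then show "\<exists>d>0. \<forall>x'\<in>{a..b}. dist x' x < d \<longrightarrow> dist (f x') (f x) < e"
    using \<open>d > 0\<close> by (auto simp: dist_real_def)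
qed

lemma abs_cont_on_compose:
  assumes f: "abs_cont_on a b f"
    and lip: "\<And>K. 0 \<le> K \<Longrightarrow> \<exists>M\<ge>0. \<forall>p q. \<bar>p\<bar> \<le> K \<and> \<bar>q\<bar> \<le> K \<longrightarrow> \<bar>h p - h q\<bar> \<le> M * \<bar>p - q\<bar>"
  shows "abs_cont_on a b (\<lambda>t. h (f t))"
proof -
  have "compact (f ` {a..b})"
    by (intro compact_continuous_image abs_cont_on_continuous f) auto
  then obtain K where K: "\<And>t. t \<in> {a..b} \<Longrightarrow> \<bar>f t\<bar> \<le> K"
    by (metis bounded_real compact_imp_bounded imageI)
  obtain M where "M \<ge> 0" "\<forall>p q. \<bar>p\<bar> \<le> max K 0 \<and> \<bar>q\<bar> \<le> max K 0 \<longrightarrow> \<bar>h p - h q\<bar> \<le> M * \<bar>p - q\<bar>"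
    using lip[of "max K 0"] by auto
  then show ?thesis
    using K by (intro abs_cont_on_dominated[OF f, of M]) (auto simp: le_max_iff_disj)
qed

text \<open>
  Cousin's lemma replaces the Lebesgue differentiation theorem here. A partition subordinate to a
  suitable gauge has two kinds of tags. At a tag with a nonpositive derivative the increment of
  \<open>f\<close> is at most \<open>e\<close> times the length of the interval. The intervals with other tags lie in an open
  set of small measure, and there absolute continuity bounds the increments together.
\<close>

lemma abs_cont_on_nonincreasing:
  assumes ac: "abs_cont_on a b f" and "a \<le> b"
    and der: "AE t in lebesgue. a < t \<and> t < b \<longrightarrow> (\<exists>D\<le>0. (f has_real_derivative D) (at t))"
  shows "f b \<le> f a"
proof -
  define N where "N = {t\<in>{a..b}. \<not> (\<exists>D\<le>0. (f has_real_derivative D) (at t))}"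
  have "N - {a, b} \<subseteq> {t. \<not> (a < t \<and> t < b \<longrightarrow> (\<exists>D\<le>0. (f has_real_derivative D) (at t)))}"
    by (auto simp: N_def)
  moreover obtain N1 where "N1 \<in> null_sets lebesgue"
    "{t. \<not> (a < t \<and> t < b \<longrightarrow> (\<exists>D\<le>0. (f has_real_derivative D) (at t)))} \<subseteq> N1"
    using der unfolding eventually_ae_filter by auto
  ultimately have "negligible (N - {a, b})"
    by (meson negligible_iff_null_sets negligible_subset order_trans)
  then have negN: "negligible N"
    using negligible_Un[of "N - {a, b}" "{a, b}"] negligible_subset[of "(N - {a, b}) \<union> {a, b}" N] by auto
  have small: "f b - f a \<le> e * (b - a + 1)" if e: "e > 0" for e
  proof -
    obtain d where "d > 0" and d: "\<And>n u v. small_intervals a b d n u v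
        \<Longrightarrow> (\<Sum>k<n. \<bar>f (v k) - f (u k)\<bar>) < e"
      using ac e unfolding abs_cont_on_iff by meson
    have Nnull: "N \<in> null_sets lebesgue" using negN negligible_iff_null_sets by blast
    then obtain U where U: "open U" "N \<subseteq> U" "U - N \<in> lmeasurable" "emeasure lebesgue (U - N) < ennreal d"
      using sets_lebesgue_outer_open[of N d] \<open>d > 0\<close> by auto
    have Um: "U \<in> lmeasurable"
      using U Nnull by (metis Un_Diff_cancel2 fmeasurable.Un fmeasurableI_null_sets sup.absorb1)
    have "emeasure lebesgue U = emeasure lebesgue (U - N)"
      using emeasure_Diff_null_set[OF Nnull, of U] Um by auto
    then have "ennreal (measure lebesgue U) < ennreal d"
      using U(4) Um by (simp add: emeasure_eq_measure2)
    then have mU: "measure lebesgue U < d"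
      by (simp add: ennreal_less_iff)
    (* The gauge: inside U at an exceptional tag, small enough for the difference quotient
       elsewhere. *)
    have "\<exists>r>0. (t \<in> N \<longrightarrow> ball t r \<subseteq> U) \<and>
        (t \<in> {a..b} - N \<longrightarrow> (\<forall>u v. u \<le> t \<and> t \<le> v \<and> {u..v} \<subseteq> ball t r \<longrightarrow> f v - f u \<le> e * (v - u)))" for t
    proof (cases "t \<in> N")
      case True
      then show ?thesis using U by (meson DiffD2 openE subsetD)
    next
      case False
      show ?thesis
      proof (cases "t \<in> {a..b}")
        case True
        with False obtain D where D: "D \<le> 0" "(f has_real_derivative D) (at t)"
          by (auto simp: N_def)
        then have "((\<lambda>s. (f s - f t) / (s - t)) \<longlongrightarrow> D) (at t)"
          by (simp add: has_field_derivative_iff)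
        then have "\<forall>\<^sub>F s in at t. (f s - f t) / (s - t) < e"
          using order_tendstoD(2) D(1) e by (metis less_eq_real_def order_le_less_trans)
        then obtain r where "r > 0" and r: "\<And>s. s \<noteq> t \<Longrightarrow> dist s t < r \<Longrightarrow> (f s - f t) / (s - t) < e"
          by (auto simp: eventually_at)
        have "f v - f u \<le> e * (v - u)" if uv: "u \<le> t" "t \<le> v" "{u..v} \<subseteq> ball t r" for u v
        proof -
          have "u \<in> {u..v}" "v \<in> {u..v}" using uv by auto
          with uv(3) have "dist u t < r" "dist v t < r" by (auto simp: dist_commute)
          then have "f v - f t \<le> e * (v - t)" "f t - f u \<le> e * (t - u)"
            using r[of v] r[of u] uv by (cases "v = t"; cases "u = t"; auto simp: field_simps)+
          then show ?thesis by (simp add: algebra_simps)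
        qed
        then show ?thesis using \<open>r > 0\<close> False by auto
      qed (use False in \<open>auto intro: exI[of _ 1]\<close>)
    qed
    then obtain r where r: "\<And>t. r t > 0" "\<And>t. t \<in> N \<Longrightarrow> ball t (r t) \<subseteq> U"
      "\<And>t u v. t \<in> {a..b} - N \<Longrightarrow> u \<le> t \<Longrightarrow> t \<le> v \<Longrightarrow> {u..v} \<subseteq> ball t (r t) \<Longrightarrow> f v - f u \<le> e * (v - u)"
      by metis
    have "gauge (\<lambda>t. ball t (r t))" using r(1) by (auto simp: gauge_def)
    then obtain p where p: "p tagged_division_of {a..b}" "(\<lambda>t. ball t (r t)) fine p"
      using fine_division_exists_real by metis
    then have "finite p" by auto
    have pk: "\<exists>u v. K = {u..v} \<and> a \<le> u \<and> u \<le> x \<and> x \<le> v \<and> v \<le> b \<and> K \<subseteq> ball x (r x)"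
      if xK: "(x, K) \<in> p" for x K
    proof -
      obtain u v where "K = cbox u v" using tagged_division_ofD(4)[OF p(1) xK] by auto
      moreover have "x \<in> K" "K \<subseteq> {a..b}" using tagged_division_ofD(2,3)[OF p(1) xK] by auto
      moreover have "K \<subseteq> ball x (r x)" using p(2) xK by (auto simp: fine_def)
      ultimately show ?thesis by (intro exI[of _ u] exI[of _ v]) auto
    qed
    define q where "q = {(x,K)\<in>p. x \<in> N}"
    have "q \<subseteq> p" "finite q" using \<open>finite p\<close> by (auto simp: q_def intro: finite_subset)
    have sum_good: "(\<Sum>(x,K)\<in>p-q. f (Sup K) - f (Inf K)) \<le> e * (b - a)"
    proof -
      have "(\<Sum>(x,K)\<in>p-q. f (Sup K) - f (Inf K)) \<le> (\<Sum>(x,K)\<in>p-q. e * (Sup K - Inf K))"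
      proof (rule sum_mono, clarify)
        fix x K assume xK: "(x, K) \<in> p" "(x, K) \<notin> q"
        then obtain u v where uv: "K = {u..v}" "a \<le> u" "u \<le> x" "x \<le> v" "v \<le> b" "K \<subseteq> ball x (r x)"
          using pk by blast
        moreover have "x \<in> {a..b} - N" using xK uv by (auto simp: q_def)
        ultimately show "f (Sup K) - f (Inf K) \<le> e * (Sup K - Inf K)"
          using r(3)[of x u v] by simp
      qed
      also have "\<dots> \<le> (\<Sum>(x,K)\<in>p. e * (Sup K - Inf K))"
      proof (rule sum_mono2[OF \<open>finite p\<close>])
        fix z assume "z \<in> p - (p - q)"
        then obtain x K where z: "z = (x, K)" "(x, K) \<in> p" by (cases z) auto
        then obtain u v where "K = {u..v}" "u \<le> x" "x \<le> v" using pk[OF z(2)] by blast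
        then show "0 \<le> (case z of (x, K) \<Rightarrow> e * (Sup K - Inf K))" using z e by simp
      qed auto
      also have "\<dots> = e * (\<Sum>(x,K)\<in>p. Sup K - Inf K)"
        by (simp add: sum_distrib_left case_prod_unfold)
      also have "(\<Sum>(x,K)\<in>p. Sup K - Inf K) = b - a"
        using additive_tagged_division_1[OF \<open>a \<le> b\<close> p(1), of "\<lambda>x. x"] by simp
      finally show ?thesis .
    qed
    have sum_bad: "(\<Sum>(x,K)\<in>q. f (Sup K) - f (Inf K)) \<le> e"
    proof -
      obtain h where h: "bij_betw h {..<card q} q"
        using ex_bij_betw_nat_finite[OF \<open>finite q\<close>] by (auto simp: lessThan_atLeast0)
      define u where "u k = Inf (snd (h k))" for k
      define v where "v k = Sup (snd (h k))" for k
      have hk: "h k \<in> q" if "k < card q" for k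
        using h that by (auto simp: bij_betw_def)
      have uv: "snd (h k) = {u k..v k} \<and> a \<le> u k \<and> u k \<le> v k \<and> v k \<le> b \<and> {u k..v k} \<subseteq> U" if k: "k < card q" for k
      proof -
        obtain x K where xK: "h k = (x, K)" "(x, K) \<in> p" "x \<in> N"
          using hk[OF k] by (auto simp: q_def)
        then obtain u' v' where "K = {u'..v'}" "a \<le> u'" "u' \<le> x" "x \<le> v'" "v' \<le> b" "K \<subseteq> ball x (r x)"
          using pk by blast
        then show ?thesis using xK r(2)[of x] by (simp add: u_def v_def subset_trans)
      qed
      have disj: "disjoint_family_on (\<lambda>k. {u k<..<v k}) {..<card q}"
        unfolding disjoint_family_on_def
      proof (intro ballI impI)
        fix m n assume mn: "m \<in> {..<card q}" "n \<in> {..<card q}" "m \<noteq> n"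
        then have "h m \<noteq> h n" using h by (auto simp: bij_betw_def inj_on_def)
        moreover have "h m \<in> p" "h n \<in> p" using hk mn \<open>q \<subseteq> p\<close> by auto
        ultimately have "interior (snd (h m)) \<inter> interior (snd (h n)) = {}"
          using tagged_division_ofD(5)[OF p(1)] by (metis prod.collapse)
        then show "{u m<..<v m} \<inter> {u n<..<v n} = {}"
          using uv mn by (simp add: interior_atLeastAtMost_real)
      qed
      have "(\<Sum>k<card q. v k - u k) = (\<Sum>k<card q. measure lebesgue {u k<..<v k})"
        using uv by (intro sum.cong) auto
      also have "\<dots> = measure lebesgue (\<Union>k<card q. {u k<..<v k})"
        using disj by (intro measure_finite_Union[symmetric]) (use uv in force)+
      also have "\<dots> \<le> measure lebesgue U"
        using uv Um by (intro measure_mono_fmeasurable) (auto intro!: sets.finite_UN, fastforce)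
      finally have "(\<Sum>k<card q. v k - u k) < d" using mU by simp
      then have "(\<Sum>k<card q. \<bar>f (v k) - f (u k)\<bar>) < e"
        using disj uv by (intro d) (auto simp: small_intervals_def)
      moreover have "(\<Sum>(x,K)\<in>q. f (Sup K) - f (Inf K)) = (\<Sum>k<card q. f (v k) - f (u k))"
        using sum.reindex_bij_betw[OF h, of "\<lambda>z. f (Sup (snd z)) - f (Inf (snd z))"]
        by (simp add: case_prod_unfold u_def v_def)
      moreover have "\<dots> \<le> (\<Sum>k<card q. \<bar>f (v k) - f (u k)\<bar>)" by (rule sum_mono) simp
      ultimately show ?thesis by linarith
    qed
    have "f b - f a = (\<Sum>(x,K)\<in>p. f (Sup K) - f (Inf K))"
      using additive_tagged_division_1[OF \<open>a \<le> b\<close> p(1), of f] by simp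
    also have "\<dots> = (\<Sum>(x,K)\<in>p-q. f (Sup K) - f (Inf K)) + (\<Sum>(x,K)\<in>q. f (Sup K) - f (Inf K))"
      using sum.subset_diff[OF \<open>q \<subseteq> p\<close> \<open>finite p\<close>] by auto
    finally show ?thesis using sum_good sum_bad by (simp add: algebra_simps)
  qed
  show ?thesis
  proof (rule ccontr)
    assume "\<not> f b \<le> f a"
    define c where "c = b - a + 1"
    have "c > 0" using \<open>a \<le> b\<close> by (simp add: c_def)
    with \<open>\<not> f b \<le> f a\<close> have "(f b - f a) / (2 * c) > 0" by simp
    from small[OF this] have "f b - f a \<le> (f b - f a) / 2"
      using \<open>c > 0\<close> by (simp flip: c_def)
    with \<open>\<not> f b \<le> f a\<close> show False by simp
  qed
qed

lemma AE_lebesgue_shift: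
  fixes P :: "real \<Rightarrow> bool"
  assumes "AE t in lebesgue. P t"
  shows "AE t in lebesgue. P (t + s)"
proof -
  obtain N where N: "N \<in> null_sets lebesgue" "{t. \<not> P t} \<subseteq> N"
    using assms unfolding eventually_ae_filter by auto
  then have "(+) (- s) ` N \<in> null_sets lebesgue"
    using negligible_translation[of N "- s"] by (simp only: negligible_iff_null_sets)
  moreover have "{t. \<not> P (t + s)} \<subseteq> (+) (- s) ` N"
    using N(2) by (force simp: image_iff)
  ultimately show ?thesis by (auto intro: AE_I')
qed

lemma AE_lebesgue_continuous_zero:
  fixes f :: "real \<Rightarrow> real"
  assumes ae: "AE t in lebesgue. t > 0 \<longrightarrow> f t = 0" and f: "continuous_on {0..} f" and "0 \<le> t"
  shows "f t = 0"
proof (rule ccontr)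
  assume nz: "f t \<noteq> 0"
  then have "\<bar>f t\<bar> > 0" by simp
  then obtain d where "d > 0" and d: "\<And>s. 0 \<le> s \<Longrightarrow> \<bar>s - t\<bar> < d \<Longrightarrow> \<bar>f s - f t\<bar> < \<bar>f t\<bar>"
    using f \<open>0 \<le> t\<close> unfolding continuous_on_iff dist_real_def by (metis atLeast_iff)
  obtain N where N: "N \<in> null_sets lebesgue" "{t. \<not> (t > 0 \<longrightarrow> f t = 0)} \<subseteq> N"
    using ae unfolding eventually_ae_filter by auto
  have "{t<..<t+d} \<subseteq> N"
  proof
    fix s assume s: "s \<in> {t<..<t+d}"
    then have "\<bar>f s - f t\<bar> < \<bar>f t\<bar>" using d[of s] \<open>0 \<le> t\<close> by auto
    then have "f s \<noteq> 0" by auto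
    then show "s \<in> N" using N(2) s \<open>0 \<le> t\<close> by auto
  qed
  then have "negligible {t<..<t+d}"
    using N(1) negligible_iff_null_sets negligible_subset by blast
  then show False using \<open>d > 0\<close> negligible_interval(2)[of t "t + d"] by (simp add: box_real)
qed

lemma abs_cont_on_shift:
  assumes "abs_cont_on (a + s) (b + s) f"
  shows "abs_cont_on a b (\<lambda>t. f (t + s))"
  unfolding abs_cont_on_iff
proof (intro allI impI)
  fix e :: real assume "e > 0"
  then obtain d where "d > 0" and d: "\<And>n u v. small_intervals (a + s) (b + s) d n u v
        \<Longrightarrow> (\<Sum>k<n. \<bar>f (v k) - f (u k)\<bar>) < e"
    using assms unfolding abs_cont_on_iff by meson
  show "\<exists>d>0. \<forall>n u v. small_intervals a b d n u v \<longrightarrow> (\<Sum>k<n. \<bar>f (v k + s) - f (u k + s)\<bar>) < e"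
  proof (intro exI conjI allI impI)
    fix n :: nat and u v :: "nat \<Rightarrow> real"
    assume A: "small_intervals a b d n u v"
    have "disjoint_family_on (\<lambda>k. {u k + s<..<v k + s}) {..<n}"
      unfolding disjoint_family_on_def
    proof (intro ballI impI)
      fix k l assume kl: "k \<in> {..<n}" "l \<in> {..<n}" "k \<noteq> l"
      then have dis: "{u k<..<v k} \<inter> {u l<..<v l} = {}"
        using A by (auto simp: small_intervals_def disjoint_family_on_def)
      have "x - s \<in> {u k<..<v k} \<inter> {u l<..<v l}" if "x \<in> {u k + s<..<v k + s} \<inter> {u l + s<..<v l + s}" for x
        using that by auto
      then show "{u k + s<..<v k + s} \<inter> {u l + s<..<v l + s} = {}" using dis by blast
    qed
    then show "(\<Sum>k<n. \<bar>f (v k + s) - f (u k + s)\<bar>) < e"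
      using A by (intro d) (auto simp: small_intervals_def)
  qed (use \<open>d > 0\<close> in auto)
qed

lemma constant_derivative:
  fixes f :: "real \<Rightarrow> real"
  assumes "\<And>s. 0 \<le> s \<Longrightarrow> f s = c" and "t > 0" and "(f has_real_derivative D) (at t)"
  shows "D = 0"
proof -
  have "\<forall>\<^sub>F s in nhds t. c = f s"
    using eventually_nhds_in_open[of "{0<..}" t] assms(1,2) by (auto elim!: eventually_mono)
  from iffD1[OF DERIV_cong_ev[OF refl this refl] DERIV_const]
  show ?thesis using assms(3) DERIV_unique by blast
qed

section \<open>Reflection at zero\<close>

text \<open>
  Skorokhod's reflection in one dimension: \<open>regulator w\<close> is the least nondecreasing function
  \<open>m \<ge> 0\<close> with \<open>w + m \<ge> 0\<close>. The function \<open>clip\<close> is the projection \<open>[v]\<^sup>+\<close> of a velocity \<open>v\<close> at the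
  position \<open>r\<close>.
\<close>

definition regulator :: "(real \<Rightarrow> real) \<Rightarrow> real \<Rightarrow> real" where
  "regulator w t = (SUP s\<in>{0..t}. max 0 (- w s))"

definition reflect :: "(real \<Rightarrow> real) \<Rightarrow> real \<Rightarrow> real" where
  "reflect w t = w t + regulator w t"

definition clip :: "real \<Rightarrow> real \<Rightarrow> real" where
  "clip r v = (if v > 0 \<or> r > 0 then v else 0)"

context
  fixes w :: "real \<Rightarrow> real"
  assumes cont: "continuous_on {0..} w"
begin

lemma regulator_bdd: "bdd_above ((\<lambda>s. max 0 (- w s)) ` {0..t})"
proof -
  have "compact ((\<lambda>s. max 0 (- w s)) ` {0..t})"
    by (intro compact_continuous_image continuous_intros continuous_on_subset[OF cont]) auto
  then show ?thesis by (intro bounded_imp_bdd_above compact_imp_bounded)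
qed

lemma regulator_upper: "\<lbrakk>0 \<le> s; s \<le> t\<rbrakk> \<Longrightarrow> max 0 (- w s) \<le> regulator w t"
  unfolding regulator_def by (intro cSUP_upper regulator_bdd) auto

lemma regulator_nonneg: "0 \<le> t \<Longrightarrow> 0 \<le> regulator w t"
  using regulator_upper[of 0 t] by simp

lemma regulator_least:
  assumes "0 \<le> t" "\<And>s. \<lbrakk>0 \<le> s; s \<le> t\<rbrakk> \<Longrightarrow> max 0 (- w s) \<le> B"
  shows "regulator w t \<le> B"
  unfolding regulator_def using assms by (intro cSUP_least) auto

lemma reflect_nonneg: "0 \<le> t \<Longrightarrow> 0 \<le> reflect w t"
  using regulator_upper[of t t] by (simp add: reflect_def)

lemma regulator_mono:
  assumes "0 \<le> s" "s \<le> t"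
  shows "regulator w s \<le> regulator w t"
  using assms by (intro regulator_least regulator_upper) auto

text \<open>The running maximum of \<open>- w\<close> grows at most by the oscillation of \<open>w\<close>. Continuity, Lipschitz
  bounds and a vanishing derivative of the regulator all come from this estimate.\<close>

lemma regulator_increment:
  assumes "0 \<le> s" "s \<le> t" "0 \<le> e" "\<And>r. \<lbrakk>s \<le> r; r \<le> t\<rbrakk> \<Longrightarrow> w s - w r \<le> e"
  shows "\<bar>regulator w t - regulator w s\<bar> \<le> e"
proof -
  have "regulator w t \<le> regulator w s + e"
  proof (rule regulator_least)
    fix r assume r: "0 \<le> r" "r \<le> t"
    show "max 0 (- w r) \<le> regulator w s + e"
    proof (cases "r \<le> s")
      case True
      then show ?thesis using regulator_upper[of r s] r assms(3) by linarith
    next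
      case False
      then show ?thesis using regulator_upper[of s s] regulator_nonneg[of s] assms(4)[of r] r assms by linarith
    qed
  qed (use assms in auto)
  then show ?thesis using regulator_mono[OF assms(1,2)] by linarith
qed

text \<open>As long as \<open>reflect w\<close> is positive, the running maximum of \<open>- w\<close> is not attained at the
  present time, and the regulator is locally constant.\<close>

lemma regulator_locally_constant:
  assumes "t > 0" "reflect w t > 0"
  shows "\<exists>d>0. \<forall>s. \<bar>s - t\<bar> < d \<longrightarrow> regulator w s = regulator w t"
proof -
  define h where "h = reflect w t / 2"
  have h: "h > 0" "regulator w t + w t = 2 * h" using assms by (auto simp: h_def reflect_def)
  have "continuous (at t within {0..}) w"
    using cont assms by (auto simp: continuous_on_eq_continuous_within)
  then obtain d0 where d0: "d0 > 0" "\<And>s. 0 \<le> s \<Longrightarrow> \<bar>s - t\<bar> < d0 \<Longrightarrow> \<bar>w s - w t\<bar> < h"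
    using h(1) by (auto simp: continuous_within_eps_delta dist_real_def)
  define d where "d = min d0 t"
  have d: "d > 0" "\<And>s. \<bar>s - t\<bar> < d \<Longrightarrow> 0 < s \<and> \<bar>w s - w t\<bar> < h"
    using d0 assms by (auto simp: d_def)
  have "regulator w s = regulator w t" if s: "\<bar>s - t\<bar> < d" for s
  proof (cases "s \<le> t")
    case False
    have "regulator w s \<le> regulator w t"
    proof (rule regulator_least)
      fix r assume r: "0 \<le> r" "r \<le> s"
      show "max 0 (- w r) \<le> regulator w t"
      proof (cases "r \<le> t")
        case True then show ?thesis using regulator_upper r by blast
      next
        case False
        then show ?thesis using d(2)[of r] s r h regulator_nonneg[of t] assms(1) by auto
      qed
    qed (use d(2)[OF s] in auto)
    then show ?thesis using regulator_mono[of t s] False assms by auto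
  next
    case True
    have "0 \<le> s" using d(2)[OF s] by auto
    have "regulator w t \<le> max (regulator w s) (max 0 (regulator w t - h))"
    proof (rule regulator_least)
      fix r assume r: "0 \<le> r" "r \<le> t"
      show "max 0 (- w r) \<le> max (regulator w s) (max 0 (regulator w t - h))"
      proof (cases "r \<le> s")
        case True then show ?thesis using regulator_upper r by (meson le_max_iff_disj)
      next
        case False
        then show ?thesis using d(2)[of r] s r h by (auto simp: max_def)
      qed
    qed (use assms in auto)
    then show ?thesis using regulator_mono[of s t] True \<open>0 \<le> s\<close> h regulator_nonneg[of s] by linarith
  qed
  then show ?thesis using d(1) by blast
qed

text \<open>If \<open>w\<close> attains its minimum over a time interval at the end, and the regulator balances \<open>w\<close> at
  the start, then \<open>- w\<close> attains its running maximum at the end.\<close>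

lemma reflect_stays_zero:
  assumes "0 \<le> s" "s \<le> t" "reflect w s = 0"
    and dec: "\<And>r. \<lbrakk>s \<le> r; r \<le> t\<rbrakk> \<Longrightarrow> w t \<le> w r"
  shows "reflect w t = 0"
proof -
  have "regulator w t \<le> - w t"
  proof (rule regulator_least)
    fix r assume r: "0 \<le> r" "r \<le> t"
    show "max 0 (- w r) \<le> - w t"
    proof (cases "r \<le> s")
      case True
      then have "max 0 (- w r) \<le> regulator w s" using regulator_upper r by blast
      then show ?thesis using assms(1-3) dec[of s] unfolding reflect_def by linarith
    next
      case False
      then show ?thesis
        using regulator_nonneg[of s] r assms(1-3) dec[of s] dec[of r] unfolding reflect_def by linarith
    qed
  qed (use assms in auto)
  then show ?thesis using reflect_nonneg[of t] assms by (simp add: reflect_def)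
qed

lemma reflect_continuous: "continuous_on {0..} (reflect w)"
proof -
  have "continuous_on {0..} (regulator w)"
    unfolding continuous_on_iff
  proof (intro ballI allI impI)
    fix t e :: real assume t: "t \<in> {0..}" and e: "e > 0"
    have "e / 3 > 0" using e by simp
    then obtain d where d: "d > 0" "\<And>s. 0 \<le> s \<Longrightarrow> \<bar>s - t\<bar> < d \<Longrightarrow> \<bar>w s - w t\<bar> < e / 3"
      using cont t unfolding continuous_on_iff dist_real_def by (metis atLeast_iff)
    have "\<bar>regulator w s - regulator w t\<bar> < e" if s: "0 \<le> s" "\<bar>s - t\<bar> < d" for s
    proof (cases "s \<le> t")
      case True
      have "\<bar>regulator w t - regulator w s\<bar> \<le> 2 * e / 3"
      proof (rule regulator_increment)
        fix r assume "s \<le> r" "r \<le> t"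
        then have "\<bar>w s - w t\<bar> < e / 3" "\<bar>w r - w t\<bar> < e / 3" using d(2) s True by auto
        then show "w s - w r \<le> 2 * e / 3" by linarith
      qed (use s True e in auto)
      then show ?thesis using e by linarith
    next
      case False
      have "\<bar>regulator w s - regulator w t\<bar> \<le> 2 * e / 3"
      proof (rule regulator_increment)
        fix r assume "t \<le> r" "r \<le> s"
        then have "\<bar>w r - w t\<bar> < e / 3" using d(2) s t by auto
        then show "w t - w r \<le> 2 * e / 3" using e by linarith
      qed (use s t False e in auto)
      then show ?thesis using e by linarith
    qed
    then show "\<exists>d>0. \<forall>x'\<in>{0..}. dist x' t < d \<longrightarrow> dist (regulator w x') (regulator w t) < e"
      using d(1) by (auto simp: dist_real_def)
  qed
  then show ?thesis unfolding reflect_def by (intro continuous_intros cont)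
qed

end

text \<open>This bound lets the Picard iteration contract in spite of the projection.\<close>

lemma regulator_diff:
  assumes w: "continuous_on {0..} w" and w': "continuous_on {0..} w'" and "0 \<le> t"
    and le: "\<And>s. \<lbrakk>0 \<le> s; s \<le> t\<rbrakk> \<Longrightarrow> \<bar>w s - w' s\<bar> \<le> e"
  shows "\<bar>regulator w t - regulator w' t\<bar> \<le> e"
proof -
  have "0 \<le> e" using le[of 0] \<open>0 \<le> t\<close> by auto
  have "regulator w t \<le> regulator w' t + e"
  proof (rule regulator_least[OF w \<open>0 \<le> t\<close>])
    fix s assume "0 \<le> s" "s \<le> t"
    then show "max 0 (- w s) \<le> regulator w' t + e"
      using regulator_upper[OF w', of s t] le[of s] \<open>0 \<le> e\<close> by linarith
  qed
  moreover have "regulator w' t \<le> regulator w t + e"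
  proof (rule regulator_least[OF w' \<open>0 \<le> t\<close>])
    fix s assume "0 \<le> s" "s \<le> t"
    then show "max 0 (- w' s) \<le> regulator w t + e"
      using regulator_upper[OF w, of s t] le[of s] \<open>0 \<le> e\<close> by linarith
  qed
  ultimately show ?thesis by linarith
qed

lemma countable_right_isolated:
  fixes A :: "real set"
  assumes "\<And>t. t \<in> A \<Longrightarrow> \<exists>d>0. A \<inter> {t<..<t+d} = {}"
  shows "countable A"
proof -
  have "\<forall>t\<in>A. \<exists>q\<in>\<rat>. t < q \<and> A \<inter> {t<..q} = {}"
  proof
    fix t assume "t \<in> A"
    then obtain d where "d > 0" "A \<inter> {t<..<t+d} = {}" using assms by blast
    moreover obtain q where "q \<in> \<rat>" "t < q" "q < t + d"
      using Rats_dense_in_real[of t "t + d"] \<open>d > 0\<close> by auto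
    ultimately show "\<exists>q\<in>\<rat>. t < q \<and> A \<inter> {t<..q} = {}" by fastforce
  qed
  then obtain q where q: "\<And>t. t \<in> A \<Longrightarrow> q t \<in> \<rat> \<and> t < q t \<and> A \<inter> {t<..q t} = {}"
    by metis
  have "inj_on q A"
  proof (rule linorder_inj_onI)
    fix s t assume st: "s < t" "s \<in> A" "t \<in> A"
    then have "t \<notin> {s<..q s}" "t < q t" using q by blast+
    then show "q s \<noteq> q t" using st by auto
  qed auto
  moreover have "countable (q ` A)"
    by (rule countable_subset[OF _ countable_rat]) (use q in auto)
  ultimately show ?thesis by (metis countable_image_inj_on)
qed

text \<open>
  Where the reflected path vanishes and its drift does not, it leaves zero at once or stays there
  for some time. Such times are isolated from the right, so there are only countably many. Where
  path and drift vanish together, the regulator grows by at most the oscillation of \<open>w\<close>, hence has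
  derivative zero.
\<close>

lemma reflect_derivative:
  assumes der: "\<And>t. t > 0 \<Longrightarrow> (w has_real_derivative a t) (at t)"
    and w: "continuous_on {0..} w" and a: "continuous_on {0..} a"
  shows "countable {t. t > 0 \<and> \<not> (reflect w has_real_derivative clip (reflect w t) (a t)) (at t)}"
    (is "countable ?E")
proof (rule countable_right_isolated)
  fix t assume "t \<in> ?E"
  then have t: "t > 0" and nd: "\<not> (reflect w has_real_derivative clip (reflect w t) (a t)) (at t)"
    by auto
  have zero: "reflect w t = 0"
  proof (rule ccontr)
    assume "reflect w t \<noteq> 0"
    then have pos: "reflect w t > 0" using reflect_nonneg[OF w, of t] t by auto
    then obtain d where d: "d > 0" "\<And>s. \<bar>s - t\<bar> < d \<Longrightarrow> regulator w s = regulator w t"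
      using regulator_locally_constant[OF w t] by blast
    have dw: "((\<lambda>s. w s + regulator w t) has_real_derivative a t) (at t)"
      using der[OF t] by (auto intro!: derivative_eq_intros)
    have "\<forall>\<^sub>F s in nhds t. w s + regulator w t = reflect w s"
      unfolding eventually_nhds_metric dist_real_def reflect_def using d by metis
    from iffD1[OF DERIV_cong_ev[OF refl this refl] dw]
    have "(reflect w has_real_derivative a t) (at t)" .
    then show False using nd pos by (simp add: clip_def)
  qed
  have at: "a t \<noteq> 0"
  proof
    assume a0: "a t = 0"
    have "(regulator w has_real_derivative 0) (at t)"
      unfolding has_field_derivative_iff
    proof (rule LIM_I)
      fix e :: real assume "e > 0"
      have "((\<lambda>s. (w s - w t) / (s - t)) \<longlongrightarrow> 0) (at t)"
        using der[OF t] a0 by (simp add: has_field_derivative_iff)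
      from LIM_D[OF this, of "e / 3"] \<open>e > 0\<close> obtain d0 where "d0 > 0"
        and d0: "\<And>s. s \<noteq> t \<Longrightarrow> \<bar>s - t\<bar> < d0 \<Longrightarrow> \<bar>(w s - w t) / (s - t)\<bar> < e / 3"
        by auto
      have osc: "\<bar>w s - w t\<bar> \<le> e / 3 * \<bar>s - t\<bar>" if "\<bar>s - t\<bar> < d0" for s
        using d0[of s] that by (cases "s = t") (simp_all add: abs_divide divide_less_eq)
      have le: "\<bar>regulator w s - regulator w t\<bar> \<le> 2 * (e / 3 * \<bar>s - t\<bar>)"
        if s: "\<bar>s - t\<bar> < min d0 t" for s
      proof (cases "s \<le> t")
        case True
        have "\<bar>regulator w t - regulator w s\<bar> \<le> 2 * (e / 3 * \<bar>s - t\<bar>)"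
        proof (rule regulator_increment[OF w])
          fix r assume r: "s \<le> r" "r \<le> t"
          have "e / 3 * \<bar>r - t\<bar> \<le> e / 3 * \<bar>s - t\<bar>"
            using r \<open>e > 0\<close> by (intro mult_left_mono) auto
          then show "w s - w r \<le> 2 * (e / 3 * \<bar>s - t\<bar>)"
            using osc[of s] osc[of r] s r by linarith
        qed (use s True \<open>e > 0\<close> in auto)
        then show ?thesis by linarith
      next
        case False
        show ?thesis
        proof (rule regulator_increment[OF w])
          fix r assume r: "t \<le> r" "r \<le> s"
          have "e / 3 * \<bar>r - t\<bar> \<le> e / 3 * \<bar>s - t\<bar>" "0 \<le> e / 3 * \<bar>s - t\<bar>"
            using r \<open>e > 0\<close> by (auto intro: mult_left_mono)
          then show "w t - w r \<le> 2 * (e / 3 * \<bar>s - t\<bar>)"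
            using osc[of r] s r by linarith
        qed (use s t False \<open>e > 0\<close> in auto)
      qed
      have "\<bar>(regulator w s - regulator w t) / (s - t)\<bar> < e" if "s \<noteq> t" "\<bar>s - t\<bar> < min d0 t" for s
        using le[of s] that
        by (simp add: abs_divide divide_less_eq) (use \<open>e > 0\<close> in \<open>smt (verit) mult_pos_pos zero_less_abs_iff\<close>)
      then show "\<exists>d>0. \<forall>s. s \<noteq> t \<and> norm (s - t) < d \<longrightarrow>
          norm ((regulator w s - regulator w t) / (s - t) - 0) < e"
        using \<open>d0 > 0\<close> t by (intro exI[of _ "min d0 t"]) auto
    qed
    then have "((\<lambda>s. w s + regulator w s) has_real_derivative 0) (at t)"
      using der[OF t] a0 by (auto intro!: derivative_eq_intros)
    then show False using nd a0 by (simp add: clip_def reflect_def[abs_def])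
  qed
  have "continuous (at t within {0..}) a"
    using a t by (auto simp: continuous_on_eq_continuous_within)
  then obtain d where "d > 0" and d: "\<And>s. 0 \<le> s \<Longrightarrow> \<bar>s - t\<bar> < d \<Longrightarrow> \<bar>a s - a t\<bar> < \<bar>a t\<bar>"
    using at by (auto simp: continuous_within_eps_delta dist_real_def dest!: spec[of _ "\<bar>a t\<bar>"])
  have "s \<notin> ?E" if s: "t < s" "s < t + d" for s
  proof (cases "a t > 0")
    case True
    have "w t < w s"
    proof (rule DERIV_pos_imp_increasing[OF s(1)])
      fix r assume r: "t \<le> r" "r \<le> s"
      then have "\<bar>a r - a t\<bar> < \<bar>a t\<bar>" using d[of r] t s by auto
      then have "a r > 0" using True by linarith
      then show "\<exists>y. (w has_real_derivative y) (at r) \<and> 0 < y" using der[of r] r t by auto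
    qed
    then have "reflect w s > 0"
      using zero regulator_mono[OF w, of t s] t s by (simp add: reflect_def)
    then obtain d' where d': "d' > 0" "\<And>r. \<bar>r - s\<bar> < d' \<Longrightarrow> regulator w r = regulator w s"
      using regulator_locally_constant[OF w, of s] s t by auto
    have dw: "((\<lambda>r. w r + regulator w s) has_real_derivative a s) (at s)"
      using der[of s] t s by (auto intro!: derivative_eq_intros)
    have "\<forall>\<^sub>F r in nhds s. w r + regulator w s = reflect w r"
      unfolding eventually_nhds_metric dist_real_def reflect_def using d' by metis
    from iffD1[OF DERIV_cong_ev[OF refl this refl] dw]
    have "(reflect w has_real_derivative a s) (at s)" .
    then show ?thesis using \<open>reflect w s > 0\<close> by (simp add: clip_def)
  next
    case False
    with at have neg: "a t < 0" by auto
    have "reflect w r = 0" if r: "t \<le> r" "r < t + d" for r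
    proof (rule reflect_stays_zero[OF w _ r(1) zero])
      fix q assume q: "t \<le> q" "q \<le> r"
      show "w r \<le> w q"
      proof (rule DERIV_nonpos_imp_nonincreasing[OF q(2)])
        fix p assume p: "q \<le> p" "p \<le> r"
        then have "\<bar>a p - a t\<bar> < \<bar>a t\<bar>" using d[of p] t q r by auto
        then have "a p \<le> 0" using neg by linarith
        then show "\<exists>y. (w has_real_derivative y) (at p) \<and> y \<le> 0" using der[of p] p q t by auto
      qed
    qed (use t in auto)
    then have ev: "\<forall>\<^sub>F r in nhds s. 0 = reflect w r"
      unfolding eventually_nhds_metric dist_real_def using s
      by (intro exI[of _ "min (s - t) (t + d - s)"]) auto
    have "(reflect w has_real_derivative 0) (at s)"
      by (rule iffD1[OF DERIV_cong_ev[OF refl ev refl] DERIV_const])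
    moreover have "clip (reflect w s) (a s) = 0"
      using d[of s] s t neg ev[THEN eventually_nhds_x_imp_x]
      by (auto simp: clip_def abs_less_iff)
    ultimately show ?thesis by simp
  qed
  then show "\<exists>d>0. ?E \<inter> {t<..<t+d} = {}"
    using \<open>d > 0\<close> by (intro exI[of _ d]) auto
qed

section \<open>Projected Lipschitz systems\<close>

lemma continuous_on_atLeast_0:
  fixes f :: "real \<Rightarrow> real"
  assumes "\<And>T. T > 0 \<Longrightarrow> continuous_on {0..T} f"
  shows "continuous_on {0..} f"
  unfolding continuous_on_eq_continuous_within
proof
  fix t :: real assume "t \<in> {0..}"
  then have "continuous (at t within {0..t+1}) f"
    using assms[of "t + 1"] by (auto simp: continuous_on_eq_continuous_within)
  moreover have "at t within {0..} = at t within {0..t+1}"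
    by (rule at_within_nhd[of _ "{..<t+1}"]) auto
  ultimately show "continuous (at t within {0..}) f"
    by (simp add: continuous_within)
qed

lemma geometric_limit:
  fixes a :: "nat \<Rightarrow> real"
  assumes "\<And>n. \<bar>a (Suc n) - a n\<bar> \<le> B * (1/2)^n"
  shows "\<exists>l. \<forall>n. \<bar>a n - l\<bar> \<le> 2 * B * (1/2)^n"
proof -
  have B: "0 \<le> B" using assms[of 0] by simp
  have step: "\<bar>a (n + k) - a n\<bar> \<le> 2 * B * (1/2)^n * (1 - (1/2)^k)" for n k
  proof (induction k)
    case (Suc k)
    have "\<bar>a (n + Suc k) - a n\<bar> \<le> \<bar>a (Suc (n + k)) - a (n + k)\<bar> + \<bar>a (n + k) - a n\<bar>"
      by simp
    also have "\<dots> \<le> B * (1/2)^(n + k) + 2 * B * (1/2)^n * (1 - (1/2)^k)"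
      using assms[of "n + k"] Suc by linarith
    also have "\<dots> = 2 * B * (1/2)^n * (1 - (1/2)^Suc k)"
      by (simp add: power_add algebra_simps)
    finally show ?case .
  qed simp
  have le: "\<bar>a (n + k) - a n\<bar> \<le> 2 * B * (1/2)^n" for n k
  proof -
    have "2 * B * (1/2)^n * (1 - (1/2)^k) \<le> 2 * B * (1/2)^n * 1"
      using B by (intro mult_left_mono) auto
    then show ?thesis using step[of n k] by simp
  qed
  have "(\<lambda>n. 2 * B * (1/2)^n) \<longlonglongrightarrow> 2 * B * 0"
    by (intro tendsto_intros LIMSEQ_power_zero) auto
  then have lim: "(\<lambda>n. 2 * B * (1/2)^n) \<longlonglongrightarrow> 0" by simp
  have "Cauchy a"
    unfolding Cauchy_altdef2
  proof (intro allI impI)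
    fix e :: real assume "e > 0"
    then obtain N where N: "2 * B * (1/2)^N < e"
      using order_tendstoD(2)[OF lim, of e] by (meson eventually_sequentially order_refl)
    have "dist (a n) (a N) < e" if "n \<ge> N" for n
      using le[of N "n - N"] N that by (simp add: dist_real_def)
    then show "\<exists>N. \<forall>n\<ge>N. dist (a n) (a N) < e" by blast
  qed
  then obtain l where l: "a \<longlonglongrightarrow> l" using Cauchy_convergent convergent_def by blast
  have "\<bar>a n - l\<bar> \<le> 2 * B * (1/2)^n" for n
  proof -
    have "(\<lambda>k. a (k + n)) \<longlonglongrightarrow> l" using l by (rule LIMSEQ_ignore_initial_segment)
    then have "(\<lambda>k. \<bar>a (k + n) - a n\<bar>) \<longlonglongrightarrow> \<bar>l - a n\<bar>" by (intro tendsto_intros)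
    then have "\<bar>l - a n\<bar> \<le> 2 * B * (1/2)^n"
      using le[of n] by (intro LIMSEQ_le_const2) (auto simp: add.commute)
    then show ?thesis by (simp add: abs_minus_commute)
  qed
  then show ?thesis by blast
qed

locale lipschitz_field =
  fixes J R :: "'a set" and G :: "('a \<Rightarrow> real) \<Rightarrow> 'a \<Rightarrow> real" and K :: real
  assumes finite_J: "finite J"
    and lipschitz: "\<And>z z' j. j \<in> J \<Longrightarrow> \<bar>G z j - G z' j\<bar> \<le> K * (\<Sum>i\<in>J. \<bar>z i - z' i\<bar>)"
    and K_pos: "K > 0"
begin

lemma field_continuous:
  fixes u :: "real \<Rightarrow> 'a \<Rightarrow> real"
  assumes "\<And>i. i \<in> J \<Longrightarrow> continuous_on {0..} (\<lambda>t. u t i)" and "j \<in> J"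
  shows "continuous_on {0..} (\<lambda>t. G (u t) j)"
  unfolding continuous_on
proof
  fix t :: real assume t: "t \<in> {0..}"
  have "((\<lambda>s. K * (\<Sum>i\<in>J. \<bar>u s i - u t i\<bar>)) \<longlongrightarrow> K * (\<Sum>i\<in>J. \<bar>u t i - u t i\<bar>)) (at t within {0..})"
    using assms t by (intro tendsto_intros) (auto simp: continuous_on)
  then have "((\<lambda>s. K * (\<Sum>i\<in>J. \<bar>u s i - u t i\<bar>)) \<longlongrightarrow> 0) (at t within {0..})" by simp
  then have "((\<lambda>s. G (u s) j - G (u t) j) \<longlongrightarrow> 0) (at t within {0..})"
    by (rule Lim_null_comparison[rotated]) (use lipschitz[OF assms(2)] in auto)
  then show "((\<lambda>s. G (u s) j) \<longlongrightarrow> G (u t) j) (at t within {0..})"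
    by (rule LIM_zero_cancel)
qed

text \<open>The fixed points of \<open>picard z0\<close> are the solutions of the projected equation in integral form.\<close>

definition drift :: "('a \<Rightarrow> real) \<Rightarrow> (real \<Rightarrow> 'a \<Rightarrow> real) \<Rightarrow> 'a \<Rightarrow> real \<Rightarrow> real" where
  "drift z0 u j t = z0 j + integral {0..t} (\<lambda>s. G (u s) j)"

definition picard :: "('a \<Rightarrow> real) \<Rightarrow> (real \<Rightarrow> 'a \<Rightarrow> real) \<Rightarrow> real \<Rightarrow> 'a \<Rightarrow> real" where
  "picard z0 u t j = (if j \<in> R then reflect (drift z0 u j) t else drift z0 u j t)"

context
  fixes u :: "real \<Rightarrow> 'a \<Rightarrow> real"
  assumes u: "\<And>i. i \<in> J \<Longrightarrow> continuous_on {0..} (\<lambda>t. u t i)"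
begin

lemma drift_continuous: "j \<in> J \<Longrightarrow> continuous_on {0..} (drift z0 u j)"
  unfolding drift_def
  by (intro continuous_on_atLeast_0 continuous_intros indefinite_integral_continuous_1
      integrable_continuous_interval continuous_on_subset[OF field_continuous[OF u]]) auto

lemma drift_derivative:
  assumes "j \<in> J" "t > 0"
  shows "(drift z0 u j has_real_derivative G (u t) j) (at t)"
proof -
  have "((\<lambda>t. integral {0..t} (\<lambda>s. G (u s) j)) has_real_derivative G (u t) j) (at t within {0..t+1})"
    using assms
    by (intro integral_has_real_derivative continuous_on_subset[OF field_continuous[OF u]]) auto
  moreover have "at t within {0..t+1} = at t"
    using assms by (intro at_within_interior) auto
  ultimately show ?thesis unfolding drift_def by (auto intro!: derivative_eq_intros)
qed

lemma picard_continuous: "j \<in> J \<Longrightarrow> continuous_on {0..} (\<lambda>t. picard z0 u t j)"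
  using reflect_continuous[OF drift_continuous] drift_continuous
  unfolding picard_def by (cases "j \<in> R") simp_all

end

lemma drift_contraction:
  assumes u: "\<And>i. i \<in> J \<Longrightarrow> continuous_on {0..} (\<lambda>t. u t i)"
    and v: "\<And>i. i \<in> J \<Longrightarrow> continuous_on {0..} (\<lambda>t. v t i)"
    and c: "c > 0" and j: "j \<in> J" and t: "0 \<le> t"
    and M: "\<And>s. 0 \<le> s \<Longrightarrow> (\<Sum>i\<in>J. \<bar>u s i - v s i\<bar>) \<le> M * exp (c * s)"
  shows "\<bar>drift z0 u j t - drift z0 v j t\<bar> \<le> K * M / c * exp (c * t)"
proof -
  have "0 \<le> M" using order_trans[OF _ M[of 0], of 0] by (simp add: sum_nonneg)
  have int: "(\<lambda>s. G (u s) j) integrable_on {0..t}" "(\<lambda>s. G (v s) j) integrable_on {0..t}"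
    by (intro integrable_continuous_interval continuous_on_subset[OF field_continuous] u v j; auto)+
  have ftc: "((\<lambda>s. K * M * exp (c * s)) has_integral (K * M / c * exp (c * t) - K * M / c * exp (c * 0))) {0..t}"
    using c t
    by (intro fundamental_theorem_of_calculus)
      (auto intro!: derivative_eq_intros simp flip: has_real_derivative_iff_has_vector_derivative)
  have "\<bar>drift z0 u j t - drift z0 v j t\<bar> = \<bar>integral {0..t} (\<lambda>s. G (u s) j - G (v s) j)\<bar>"
    using int by (simp add: drift_def integral_diff)
  also have "\<dots> \<le> integral {0..t} (\<lambda>s. K * M * exp (c * s))"
  proof -
    have "norm (integral {0..t} (\<lambda>s. G (u s) j - G (v s) j)) \<le> integral {0..t} (\<lambda>s. K * M * exp (c * s))"
    proof (rule integral_norm_bound_integral)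
      fix s assume s: "s \<in> {0..t}"
      have "\<bar>G (u s) j - G (v s) j\<bar> \<le> K * (\<Sum>i\<in>J. \<bar>u s i - v s i\<bar>)" by (rule lipschitz[OF j])
      also have "\<dots> \<le> K * (M * exp (c * s))" using M[of s] s K_pos by (intro mult_left_mono) auto
      finally show "norm (G (u s) j - G (v s) j) \<le> K * M * exp (c * s)" by simp
    qed (use int ftc in \<open>auto intro: integrable_diff\<close>)
    then show ?thesis by simp
  qed
  also have "\<dots> = K * M / c * exp (c * t) - K * M / c" by (subst integral_unique[OF ftc]) simp
  also have "\<dots> \<le> K * M / c * exp (c * t)" using K_pos \<open>0 \<le> M\<close> c by simp
  finally show ?thesis .
qed

lemma picard_contraction:
  assumes u: "\<And>i. i \<in> J \<Longrightarrow> continuous_on {0..} (\<lambda>t. u t i)"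
    and v: "\<And>i. i \<in> J \<Longrightarrow> continuous_on {0..} (\<lambda>t. v t i)"
    and c: "c > 0" and t: "0 \<le> t"
    and M: "\<And>s. 0 \<le> s \<Longrightarrow> (\<Sum>i\<in>J. \<bar>u s i - v s i\<bar>) \<le> M * exp (c * s)"
  shows "(\<Sum>i\<in>J. \<bar>picard z0 u t i - picard z0 v t i\<bar>) \<le> 2 * card J * K / c * M * exp (c * t)"
proof -
  have M0: "0 \<le> M" using order_trans[OF _ M[of 0], of 0] by (simp add: sum_nonneg)
  define B where "B = K * M / c * exp (c * t)"
  have B: "0 \<le> B" using M0 K_pos c by (simp add: B_def)
  have "\<bar>picard z0 u t j - picard z0 v t j\<bar> \<le> 2 * B" if j: "j \<in> J" for j
  proof -
    have dr: "\<bar>drift z0 u j s - drift z0 v j s\<bar> \<le> B" if "0 \<le> s" "s \<le> t" for s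
    proof -
      have "\<bar>drift z0 u j s - drift z0 v j s\<bar> \<le> K * M / c * exp (c * s)"
        by (rule drift_contraction[OF u v c j _ M]) (use that in auto)
      also have "\<dots> \<le> B" unfolding B_def using M0 K_pos c that by (intro mult_left_mono) auto
      finally show ?thesis .
    qed
    have reg: "\<bar>regulator (drift z0 u j) t - regulator (drift z0 v j) t\<bar> \<le> B"
      by (rule regulator_diff[OF drift_continuous[OF u j] drift_continuous[OF v j] t dr]) auto
    have "\<bar>drift z0 u j t - drift z0 v j t\<bar> \<le> B" using dr t by blast
    moreover have "\<bar>if j \<in> R then regulator (drift z0 u j) t - regulator (drift z0 v j) t else 0\<bar> \<le> B"
      using reg B by simp
    moreover have "picard z0 u t j - picard z0 v t j = drift z0 u j t - drift z0 v j t
        + (if j \<in> R then regulator (drift z0 u j) t - regulator (drift z0 v j) t else 0)"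
      by (simp add: picard_def reflect_def)
    ultimately show ?thesis by linarith
  qed
  then have "(\<Sum>i\<in>J. \<bar>picard z0 u t i - picard z0 v t i\<bar>) \<le> of_nat (card J) * (2 * B)"
    by (rule sum_bounded_above)
  then show ?thesis by (simp add: B_def mult_ac)
qed

text \<open>
  The \<open>n\<close>-th increment of the Picard iteration is measured against \<open>exp (c * t)\<close>, with \<open>c\<close> so
  large that each step halves the constant. This gives convergence on all of \<open>{0..}\<close> at once.
\<close>

lemma picard_fixed_point:
  assumes z0: "\<And>j. j \<in> J \<inter> R \<Longrightarrow> 0 \<le> z0 j"
  shows "\<exists>z. z 0 = z0 \<and> (\<forall>j\<in>J. continuous_on {0..} (\<lambda>t. z t j)) \<and>
    (\<forall>t\<ge>0. \<forall>j\<in>J. z t j = picard z0 z t j)"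
proof -
  (* The contraction factor is 2 * card J * K / c. *)
  define c where "c = 4 * card J * K + 1"
  have c: "c > 0" "2 * card J * K / c \<le> 1/2"
  proof -
    have "0 \<le> card J * K" using K_pos by simp
    then show "c > 0" unfolding c_def by linarith
    then show "2 * card J * K / c \<le> 1/2" by (simp add: pos_divide_le_eq) (simp add: c_def)
  qed
  define p where "p = rec_nat (\<lambda>t. z0) (\<lambda>_. picard z0)"
  have p_simps: "p 0 = (\<lambda>t. z0)" "p (Suc n) = picard z0 (p n)" for n by (simp_all add: p_def)
  have p_cont: "continuous_on {0..} (\<lambda>t. p n t j)" if "j \<in> J" for n j
    using that by (induction n arbitrary: j) (auto simp: p_simps intro: picard_continuous)
  have at0: "picard z0 u 0 j = z0 j" if "j \<in> J" for u j
    using z0[of j] that by (auto simp: picard_def reflect_def regulator_def drift_def)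
  have p_0: "p n 0 j = z0 j" if "j \<in> J" for n j
    using that by (cases n) (auto simp: p_simps at0)
  define M where "M = (\<Sum>j\<in>J. 2 * \<bar>G z0 j\<bar> / c)"
  have M0: "0 \<le> M" unfolding M_def using c by (intro sum_nonneg) auto
  have first: "(\<Sum>j\<in>J. \<bar>p (Suc 0) t j - p 0 t j\<bar>) \<le> M * exp (c * t)" if t: "0 \<le> t" for t
    unfolding M_def sum_distrib_right
  proof (rule sum_mono)
    fix j assume j: "j \<in> J"
    have dr: "drift z0 (\<lambda>t. z0) j s = z0 j + s * G z0 j" if "0 \<le> s" for s
      using that by (simp add: drift_def)
    have dist: "\<bar>drift z0 (\<lambda>t. z0) j s - z0 j\<bar> \<le> t * \<bar>G z0 j\<bar>" if "0 \<le> s" "s \<le> t" for s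
      using that by (simp add: dr abs_mult mult_right_mono)
    have reg: "\<bar>regulator (drift z0 (\<lambda>t. z0) j) t - regulator (\<lambda>_. z0 j) t\<bar> \<le> t * \<bar>G z0 j\<bar>"
      by (intro regulator_diff drift_continuous continuous_intros dist t) (use j in auto)
    have "regulator (\<lambda>_. z0 j) t = 0" if "j \<in> R"
      using z0[of j] that j t by (simp add: regulator_def)
    then have "\<bar>if j \<in> R then regulator (drift z0 (\<lambda>t. z0) j) t else 0\<bar> \<le> t * \<bar>G z0 j\<bar>"
      using reg t by auto
    moreover have "\<bar>drift z0 (\<lambda>t. z0) j t - z0 j\<bar> \<le> t * \<bar>G z0 j\<bar>" using dist t by blast
    moreover have "p (Suc 0) t j - p 0 t j = drift z0 (\<lambda>t. z0) j t - z0 j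
        + (if j \<in> R then regulator (drift z0 (\<lambda>t. z0) j) t else 0)"
      by (simp add: p_simps picard_def reflect_def)
    ultimately have "\<bar>p (Suc 0) t j - p 0 t j\<bar> \<le> 2 * (t * \<bar>G z0 j\<bar>)" by linarith
    also have "c * t \<le> exp (c * t)" using exp_ge_add_one_self[of "c * t"] by linarith
    then have "t \<le> exp (c * t) / c" using c by (simp add: pos_le_divide_eq mult.commute)
    then have "2 * (t * \<bar>G z0 j\<bar>) \<le> 2 * (exp (c * t) / c * \<bar>G z0 j\<bar>)"
      by (intro mult_left_mono mult_right_mono) auto
    finally show "\<bar>p (Suc 0) t j - p 0 t j\<bar> \<le> 2 * \<bar>G z0 j\<bar> / c * exp (c * t)" by (simp add: mult_ac)
  qed
  have incr: "(\<Sum>j\<in>J. \<bar>p (Suc n) t j - p n t j\<bar>) \<le> M * (1/2)^n * exp (c * t)" if "0 \<le> t" for n t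
    using that
  proof (induction n arbitrary: t)
    case (Suc n)
    have "(\<Sum>j\<in>J. \<bar>p (Suc (Suc n)) t j - p (Suc n) t j\<bar>)
        \<le> 2 * card J * K / c * (M * (1/2)^n) * exp (c * t)"
      unfolding p_simps(2)[of "Suc n"] p_simps(2)[of n]
      by (rule picard_contraction[OF _ _ c(1) Suc.prems])
        (use p_cont Suc.IH picard_continuous[OF p_cont] in \<open>auto simp: p_simps(2)\<close>)
    also have "\<dots> \<le> 1/2 * (M * (1/2)^n) * exp (c * t)"
      using c(2) M0 by (intro mult_right_mono) auto
    finally show ?case by simp
  qed (use first in simp)
  have incr1: "\<bar>p (Suc n) t j - p n t j\<bar> \<le> M * exp (c * t) * (1/2)^n" if "0 \<le> t" "j \<in> J" for n t j
  proof -
    have "\<bar>p (Suc n) t j - p n t j\<bar> \<le> (\<Sum>j\<in>J. \<bar>p (Suc n) t j - p n t j\<bar>)"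
      using that finite_J by (intro member_le_sum) auto
    then show ?thesis using incr[OF that(1), of n] by (simp add: mult_ac)
  qed
  have ex: "\<exists>l. j \<in> J \<and> 0 \<le> t \<longrightarrow> (\<forall>n. \<bar>p n t j - l\<bar> \<le> 2 * (M * exp (c * t)) * (1/2)^n)" for t j
    using geometric_limit[of "\<lambda>n. p n t j" "M * exp (c * t)"] incr1 by blast
  define l where "l t j = (SOME l. j \<in> J \<and> 0 \<le> t \<longrightarrow> (\<forall>n. \<bar>p n t j - l\<bar> \<le> 2 * (M * exp (c * t)) * (1/2)^n))" for t j
  have l: "\<bar>p n t j - l t j\<bar> \<le> 2 * (M * exp (c * t)) * (1/2)^n" if "j \<in> J" "0 \<le> t" for t j n
    using someI_ex[OF ex[of j t]] that unfolding l_def by blast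
  have half0: "(\<lambda>n. C * (1/2::real)^n) \<longlonglongrightarrow> 0" for C
    using tendsto_mult_right_zero[OF LIMSEQ_power_zero[of "1/2::real"]] by simp
  have l_lim: "(\<lambda>n. p n t j) \<longlonglongrightarrow> l t j" if "j \<in> J" "0 \<le> t" for t j
  proof (rule LIM_zero_cancel)
    show "(\<lambda>n. p n t j - l t j) \<longlonglongrightarrow> 0"
      by (rule Lim_null_comparison[OF _ half0[of "2 * (M * exp (c * t))"]]) (use l that in auto)
  qed
  define z where "z t j = (if j \<in> J \<and> t \<noteq> 0 then l t j else z0 j)" for t j
  have z_l: "z t j = l t j" if "j \<in> J" "0 \<le> t" for t j
    using LIMSEQ_unique[OF l_lim[OF that(1) order_refl], of "z0 j"] that by (auto simp: z_def p_0)
  have z_cont: "continuous_on {0..} (\<lambda>t. z t j)" if j: "j \<in> J" for j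
  proof (rule continuous_on_atLeast_0)
    fix T :: real assume T: "T > 0"
    have "uniform_limit {0..T} (\<lambda>n t. p n t j) (\<lambda>t. z t j) sequentially"
    proof (rule uniform_limitI)
      fix e :: real assume "e > 0"
      then have "\<forall>\<^sub>F n in sequentially. 2 * (M * exp (c * T)) * (1/2)^n < e"
        using order_tendstoD(2)[OF half0] by blast
      then show "\<forall>\<^sub>F n in sequentially. \<forall>t\<in>{0..T}. dist (p n t j) (z t j) < e"
      proof eventually_elim
        case (elim n)
        show ?case
        proof
          fix t assume t: "t \<in> {0..T}"
          have "\<bar>p n t j - z t j\<bar> \<le> 2 * (M * exp (c * t)) * (1/2)^n"
            using l[OF j, of t n] z_l[OF j, of t] t by simp
          also have "\<dots> \<le> 2 * (M * exp (c * T)) * (1/2)^n"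
            using t c M0 by (intro mult_right_mono mult_left_mono) auto
          finally show "dist (p n t j) (z t j) < e" using elim by (simp add: dist_real_def)
        qed
      qed
    qed
    then show "continuous_on {0..T} (\<lambda>t. z t j)"
      by (rule uniform_limit_theorem[rotated])
        (auto intro!: always_eventually continuous_on_subset[OF p_cont[OF j]])
  qed
  have fixed: "z t j = picard z0 z t j" if t: "0 \<le> t" and j: "j \<in> J" for t j
  proof -
    define C where "C = 2 * M * card J"
    have diff: "(\<Sum>i\<in>J. \<bar>p n s i - z s i\<bar>) \<le> C * (1/2)^n * exp (c * s)" if s: "0 \<le> s" for n s
    proof -
      have "(\<Sum>i\<in>J. \<bar>p n s i - z s i\<bar>) \<le> of_nat (card J) * (2 * (M * exp (c * s)) * (1/2)^n)"
        using l z_l s by (intro sum_bounded_above) auto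
      then show ?thesis by (simp add: C_def mult_ac)
    qed
    have "\<bar>z t j - picard z0 z t j\<bar> \<le> 2 * C * exp (c * t) * (1/2)^n" for n
    proof -
      have "\<bar>p (Suc n) t j - z t j\<bar> \<le> (\<Sum>i\<in>J. \<bar>p (Suc n) t i - z t i\<bar>)"
        using j finite_J by (intro member_le_sum) auto
      also have "\<dots> \<le> C * (1/2)^n * exp (c * t)"
      proof -
        have "C * (1/2)^Suc n * exp (c * t) \<le> C * (1/2)^n * exp (c * t)"
          using M0 by (intro mult_right_mono mult_left_mono) (auto simp: C_def)
        then show ?thesis using diff[OF t, of "Suc n"] by linarith
      qed
      finally have 1: "\<bar>p (Suc n) t j - z t j\<bar> \<le> C * (1/2)^n * exp (c * t)" .
      have "\<bar>p (Suc n) t j - picard z0 z t j\<bar> \<le> (\<Sum>i\<in>J. \<bar>picard z0 (p n) t i - picard z0 z t i\<bar>)"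
        unfolding p_simps using j finite_J by (intro member_le_sum) auto
      also have "\<dots> \<le> 2 * card J * K / c * (C * (1/2)^n) * exp (c * t)"
        by (rule picard_contraction[OF _ _ c(1) t]) (use p_cont z_cont diff in auto)
      also have "\<dots> \<le> 1 * (C * (1/2)^n) * exp (c * t)"
        using c(2) M0 by (intro mult_right_mono) (auto simp: C_def)
      finally show ?thesis using 1 by (simp add: mult_ac)
    qed
    then have "\<bar>z t j - picard z0 z t j\<bar> \<le> 0"
      by (intro LIMSEQ_le_const[OF half0[of "2 * C * exp (c * t)"]]) auto
    then show ?thesis by simp
  qed
  show ?thesis
    by (rule exI[of _ z]) (use z_cont fixed in \<open>auto simp: z_def\<close>)
qed

text \<open>On a bounded time interval the drift of a fixed point is Lipschitz, and reflection at most
  doubles the constant. This gives absolute continuity.\<close>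

theorem projected_solution_exists:
  assumes z0: "\<And>j. j \<in> J \<inter> R \<Longrightarrow> 0 \<le> z0 j"
  obtains z where "z 0 = z0"
    "\<And>j T. j \<in> J \<Longrightarrow> abs_cont_on 0 T (\<lambda>t. z t j)"
    "\<And>j. j \<in> J \<Longrightarrow> AE t in lebesgue. t > 0 \<longrightarrow> ((\<lambda>s. z s j) has_real_derivative
        (if j \<in> R then clip (z t j) (G (z t) j) else G (z t) j)) (at t)"
proof -
  obtain z where z: "z 0 = z0" "\<And>j. j \<in> J \<Longrightarrow> continuous_on {0..} (\<lambda>t. z t j)"
    "\<And>t j. 0 \<le> t \<Longrightarrow> j \<in> J \<Longrightarrow> z t j = picard z0 z t j"
    using picard_fixed_point[of z0] z0 by blast
  have ac: "abs_cont_on 0 T (\<lambda>t. z t j)" if j: "j \<in> J" for j T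
  proof -
    have "compact ((\<lambda>t. G (z t) j) ` {0..T})"
      by (intro compact_continuous_image continuous_on_subset[OF field_continuous[OF z(2) j]]) auto
    then obtain B where B: "\<And>t. t \<in> {0..T} \<Longrightarrow> \<bar>G (z t) j\<bar> \<le> B"
      by (metis bounded_real compact_imp_bounded imageI)
    have lip: "\<bar>drift z0 z j t - drift z0 z j s\<bar> \<le> \<bar>B\<bar> * (t - s)" if st: "0 \<le> s" "s \<le> t" "t \<le> T" for s t
    proof (cases "s = t")
      case False
      have "continuous_on {s..t} (drift z0 z j)"
        by (rule continuous_on_subset[OF drift_continuous[OF z(2) j]]) (use st in auto)
      moreover have "drift z0 z j differentiable (at r)" if "s < r" "r < t" for r
        unfolding real_differentiable_def
        using drift_derivative[OF z(2) j, where t=r] st that by (intro exI) simp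
      ultimately obtain l r where r: "s < r" "r < t" "(drift z0 z j has_real_derivative l) (at r)"
        "drift z0 z j t - drift z0 z j s = (t - s) * l"
        using MVT[of s t "drift z0 z j"] False st(2) by (metis order_neq_le_trans)
      have "(drift z0 z j has_real_derivative G (z r) j) (at r)"
        using drift_derivative[OF z(2) j] r(1) st(1) by simp
      with r(3) have "l = G (z r) j" by (rule DERIV_unique)
      then have "\<bar>l\<bar> \<le> \<bar>B\<bar>" using B[of r] r st by auto
      then show ?thesis using r st by (simp add: abs_mult mult.commute mult_right_mono)
    qed simp
    have reg: "\<bar>regulator (drift z0 z j) t - regulator (drift z0 z j) s\<bar> \<le> \<bar>B\<bar> * (t - s)"
      if st: "0 \<le> s" "s \<le> t" "t \<le> T" for s t
    proof (rule regulator_increment[OF drift_continuous[OF z(2) j]])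
      fix r assume r: "s \<le> r" "r \<le> t"
      have "\<bar>B\<bar> * (r - s) \<le> \<bar>B\<bar> * (t - s)" using r by (intro mult_left_mono) auto
      then show "drift z0 z j s - drift z0 z j r \<le> \<bar>B\<bar> * (t - s)"
        using lip[of s r] r st by linarith
    qed (use st in auto)
    show ?thesis
    proof (rule abs_cont_on_lipschitz[of "2 * \<bar>B\<bar>"])
      fix s t assume st: "0 \<le> s" "s \<le> t" "t \<le> T"
      have "0 \<le> \<bar>B\<bar> * (t - s)" using st by simp
      then show "\<bar>z t j - z s j\<bar> \<le> 2 * \<bar>B\<bar> * (t - s)"
        using z(3)[of s j] z(3)[of t j] lip[OF st] reg[OF st] st j
        unfolding picard_def reflect_def by (auto split: if_splits)
    qed simp
  qed
  have de: "AE t in lebesgue. t > 0 \<longrightarrow> ((\<lambda>s. z s j) has_real_derivative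
        (if j \<in> R then clip (z t j) (G (z t) j) else G (z t) j)) (at t)" if j: "j \<in> J" for j
  proof -
    let ?w = "drift z0 z j"
    have ev: "\<forall>\<^sub>F s in nhds t. picard z0 z s j = z s j" if "t > 0" for t
      using eventually_nhds_in_open[of "{0<..}" t] that z(3)[OF _ j]
      by (auto elim!: eventually_mono)
    show ?thesis
    proof (cases "j \<in> R")
      case False
      have "((\<lambda>s. z s j) has_real_derivative G (z t) j) (at t)" if t: "t > 0" for t
        using iffD1[OF DERIV_cong_ev[OF refl ev[OF t] refl]] drift_derivative[OF z(2) j t] False
        by (simp add: picard_def)
      then show ?thesis using False by auto
    next
      case True
      define E where "E = {t. t > 0 \<and> \<not> (reflect ?w has_real_derivative clip (reflect ?w t) (G (z t) j)) (at t)}"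
      have "countable E"
        unfolding E_def
        by (rule reflect_derivative[OF drift_derivative[OF z(2) j] drift_continuous[OF z(2) j]
              field_continuous[OF z(2) j]])
      then have "E \<in> null_sets lebesgue"
        using countable_imp_null_set_lborel null_sets_completionI by blast
      moreover have "((\<lambda>s. z s j) has_real_derivative clip (z t j) (G (z t) j)) (at t)"
        if t: "t > 0" "t \<notin> E" for t
      proof -
        have "(reflect ?w has_real_derivative clip (reflect ?w t) (G (z t) j)) (at t)"
          using t by (simp add: E_def)
        moreover have "reflect ?w t = z t j" using z(3)[of t j] t j True by (simp add: picard_def)
        ultimately show ?thesis
          using iffD1[OF DERIV_cong_ev[OF refl ev[OF t(1)] refl]] True by (simp add: picard_def)
      qed
      ultimately show ?thesis
        using True by (auto intro!: AE_I'[of E])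
    qed
  qed
  show thesis by (rule that[of z]) (use z(1) ac de in auto)
qed

end

section \<open>Monotone projected flows\<close>

lemma clip_scale: "c > 0 \<Longrightarrow> clip r (c * v) = c * clip r v"
  by (simp add: clip_def zero_less_mult_iff)

text \<open>The defect \<open>clip r v - v\<close> is nonnegative and complementary to \<open>r\<close>, so
  clipping keeps a dissipative field dissipative on the orthant.\<close>

lemma clip_monotone:
  assumes "0 \<le> r" "0 \<le> r'"
  shows "(r - r') * (clip r v - clip r' v') \<le> (r - r') * (v - v')"
proof -
  define d d' where "d = clip r v - v" and "d' = clip r' v' - v'"
  have "0 \<le> d" "r * d = 0" "0 \<le> d'" "r' * d' = 0"
    using assms by (auto simp: d_def d'_def clip_def)
  moreover have "(r - r') * (d - d') = r * d - r * d' - r' * d + r' * d'"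
    by (simp add: algebra_simps)
  moreover have "0 \<le> r * d'" "0 \<le> r' * d" using assms calculation by auto
  ultimately have "(r - r') * (d - d') \<le> 0" by linarith
  then show ?thesis by (simp add: d_def d'_def algebra_simps)
qed

lemma clip_stationary:
  assumes "0 \<le> r" "0 \<le> r'" "clip r' a = 0" "(r - r') * clip r a = 0"
  shows "clip r a = 0"
  using assms by (auto simp: clip_def split: if_splits)

lemma bounded_family_subseq:
  fixes f :: "nat \<Rightarrow> 'a \<Rightarrow> real"
  assumes "finite J" "\<And>n j. j \<in> J \<Longrightarrow> \<bar>f n j\<bar> \<le> B j"
  shows "\<exists>r l. strict_mono r \<and> (\<forall>j\<in>J. (\<lambda>n. f (r n) j) \<longlonglongrightarrow> l j)"
  using assms
proof (induction J)
  case empty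
  then show ?case by (auto intro: strict_mono_id)
next
  case (insert i J)
  then obtain r l where r: "strict_mono r" "\<And>j. j \<in> J \<Longrightarrow> (\<lambda>n. f (r n) j) \<longlonglongrightarrow> l j"
    by (metis insertCI)
  have "bounded (range (\<lambda>n. f (r n) i))"
    unfolding bounded_real using insert.prems by auto
  then obtain m q where q: "strict_mono q" "((\<lambda>n. f (r n) i) \<circ> q) \<longlonglongrightarrow> m"
    using bounded_imp_convergent_subsequence by blast
  have "(\<lambda>n. f ((r \<circ> q) n) j) \<longlonglongrightarrow> (l(i := m)) j" if "j \<in> insert i J" for j
    using LIMSEQ_subseq_LIMSEQ[OF r(2) q(1), of j] q(2) that by (auto simp: o_def)
  moreover have "strict_mono (r \<circ> q)" using r(1) q(1) by (simp add: strict_mono_o)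
  ultimately show ?case by blast
qed

locale projected_flow =
  fixes J R :: "'a set" and F :: "('a \<Rightarrow> real) \<Rightarrow> 'a \<Rightarrow> real" and w :: "'a \<Rightarrow> real" and K :: real
  assumes finite_J: "finite J"
    and lipschitz: "\<And>z z' j. j \<in> J \<Longrightarrow> \<bar>F z j - F z' j\<bar> \<le> K * (\<Sum>i\<in>J. \<bar>z i - z' i\<bar>)"
    and K_pos: "K > 0"
    and gain_pos: "\<And>j. j \<in> J \<Longrightarrow> w j > 0"
    and monotone: "\<And>z z'. \<lbrakk>\<And>j. j \<in> J \<inter> R \<Longrightarrow> 0 \<le> z j; \<And>j. j \<in> J \<inter> R \<Longrightarrow> 0 \<le> z' j\<rbrakk> \<Longrightarrow>
        (\<Sum>j\<in>J. (z j - z' j) * (F z j - F z' j)) \<le> 0"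
begin

definition velocity :: "('a \<Rightarrow> real) \<Rightarrow> 'a \<Rightarrow> real" where
  "velocity z j = (if j \<in> R then clip (z j) (F z j) else F z j)"

definition solution :: "(real \<Rightarrow> 'a \<Rightarrow> real) \<Rightarrow> bool" where
  "solution z \<longleftrightarrow> (\<forall>j\<in>J. (\<forall>T>0. abs_cont_on 0 T (\<lambda>t. z t j)) \<and>
     (AE t in lebesgue. t > 0 \<longrightarrow> ((\<lambda>s. z s j) has_real_derivative w j * velocity (z t) j) (at t)))"

definition feasible :: "('a \<Rightarrow> real) \<Rightarrow> bool" where
  "feasible z \<longleftrightarrow> (\<forall>j\<in>J \<inter> R. 0 \<le> z j)"

definition equilibrium :: "('a \<Rightarrow> real) \<Rightarrow> bool" where
  "equilibrium z \<longleftrightarrow> feasible z \<and> (\<forall>j\<in>J. velocity z j = 0)"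

definition energy :: "('a \<Rightarrow> real) \<Rightarrow> ('a \<Rightarrow> real) \<Rightarrow> real" where
  "energy z z' = (\<Sum>j\<in>J. (z j - z' j)\<^sup>2 / (2 * w j))"

lemma solution_exists:
  assumes "feasible z0"
  obtains z where "solution z" "z 0 = z0"
proof -
  interpret L: lipschitz_field J R "\<lambda>z j. w j * F z j" "(sum w J + 1) * K"
  proof
    have s: "0 \<le> sum w J" using gain_pos by (intro sum_nonneg) (simp add: less_imp_le)
    then show "0 < (sum w J + 1) * K" using K_pos by simp
    fix z z' j assume j: "j \<in> J"
    have "w j \<le> sum w J" using j finite_J gain_pos by (intro member_le_sum) (auto simp: less_imp_le)
    then have "w j * \<bar>F z j - F z' j\<bar> \<le> (sum w J + 1) * (K * (\<Sum>i\<in>J. \<bar>z i - z' i\<bar>))"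
      using lipschitz[OF j, of z z'] s by (intro mult_mono) auto
    then show "\<bar>w j * F z j - w j * F z' j\<bar> \<le> (sum w J + 1) * K * (\<Sum>i\<in>J. \<bar>z i - z' i\<bar>)"
      using gain_pos[OF j] by (simp add: abs_mult mult.assoc flip: right_diff_distrib)
  qed (rule finite_J)
  have "0 \<le> z0 j" if "j \<in> J \<inter> R" for j using assms that by (auto simp: feasible_def)
  then obtain z where z: "z 0 = z0"
    "\<And>j T. j \<in> J \<Longrightarrow> abs_cont_on 0 T (\<lambda>t. z t j)"
    "\<And>j. j \<in> J \<Longrightarrow> AE t in lebesgue. t > 0 \<longrightarrow> ((\<lambda>s. z s j) has_real_derivative
        (if j \<in> R then clip (z t j) (w j * F (z t) j) else w j * F (z t) j)) (at t)"
    using L.projected_solution_exists[of z0] by blast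
  have "(if j \<in> R then clip (z t j) (w j * F (z t) j) else w j * F (z t) j) = w j * velocity (z t) j"
    if "j \<in> J" for t j
    using gain_pos[OF that] by (simp add: velocity_def clip_scale)
  with z have "solution z" by (simp add: solution_def)
  with z(1) show thesis using that by blast
qed

lemma solution_abs_cont: "\<lbrakk>solution z; j \<in> J; 0 \<le> T\<rbrakk> \<Longrightarrow> abs_cont_on 0 T (\<lambda>t. z t j)"
  by (rule abs_cont_on_subset[of 0 "T + 1"]) (auto simp: solution_def)

lemma solution_continuous: "\<lbrakk>solution z; j \<in> J\<rbrakk> \<Longrightarrow> continuous_on {0..} (\<lambda>t. z t j)"
  by (intro continuous_on_atLeast_0 abs_cont_on_continuous solution_abs_cont) auto

lemma solution_AE:
  assumes "solution z"
  shows "AE t in lebesgue. t > 0 \<longrightarrow>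
    (\<forall>j\<in>J. ((\<lambda>s. z s j) has_real_derivative w j * velocity (z t) j) (at t))"
proof -
  have "AE t in lebesgue. \<forall>j\<in>J. t > 0 \<longrightarrow>
      ((\<lambda>s. z s j) has_real_derivative w j * velocity (z t) j) (at t)"
    using assms by (intro AE_finite_allI finite_J) (auto simp: solution_def)
  then show ?thesis by (rule AE_mp) auto
qed

text \<open>Where a component in \<open>R\<close> is negative, it cannot decrease.\<close>

lemma solution_feasible:
  assumes z: "solution z" and f: "feasible (z 0)" and "0 \<le> t"
  shows "feasible (z t)"
  unfolding feasible_def
proof
  fix j assume j: "j \<in> J \<inter> R"
  (* A continuously differentiable function that vanishes exactly on the nonnegative numbers. *)
  define h where "h r = (min r 0)\<^sup>2" for r :: real
  have h_der: "(h has_real_derivative 2 * min r 0) (at r)" for r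
  proof -
    consider "r > 0" | "r < 0" | "r = 0" by linarith
    then show ?thesis
    proof cases
      case 1
      have "\<forall>\<^sub>F s in nhds r. 0 = h s"
        using eventually_nhds_in_open[of "{0<..}" r] 1 by (auto simp: h_def elim!: eventually_mono)
      from iffD1[OF DERIV_cong_ev[OF refl this refl] DERIV_const] show ?thesis using 1 by simp
    next
      case 2
      have "\<forall>\<^sub>F s in nhds r. s\<^sup>2 = h s"
        using eventually_nhds_in_open[of "{..<0}" r] 2 by (auto simp: h_def elim!: eventually_mono)
      moreover have "((\<lambda>s. s\<^sup>2) has_real_derivative 2 * r) (at r)" by (auto intro!: derivative_eq_intros)
      ultimately have "(h has_real_derivative 2 * r) (at r)"
        using DERIV_cong_ev[of r r "\<lambda>s. s\<^sup>2" h "2 * r" "2 * r"] by simp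
      then show ?thesis using 2 by simp
    next
      case 3
      have "((\<lambda>s. h s / s) \<longlongrightarrow> 0) (at 0)"
      proof (rule Lim_null_comparison[of _ "\<lambda>s. \<bar>s\<bar>"])
        show "\<forall>\<^sub>F s in at 0. norm (h s / s) \<le> \<bar>s\<bar>"
          by (rule always_eventually) (auto simp: h_def min_def power2_eq_square)
        show "((\<lambda>s::real. \<bar>s\<bar>) \<longlongrightarrow> 0) (at 0)" by (rule tendsto_rabs_zero) (rule tendsto_ident_at)
      qed
      then show ?thesis using 3 by (simp add: has_field_derivative_iff h_def)
    qed
  qed
  have lip: "\<bar>h p - h q\<bar> \<le> 2 * K * \<bar>p - q\<bar>" if "\<bar>p\<bar> \<le> K" "\<bar>q\<bar> \<le> K" for p q K
  proof -
    have "h p - h q = (min p 0 + min q 0) * (min p 0 - min q 0)"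
      by (simp add: h_def power2_eq_square algebra_simps)
    then have "\<bar>h p - h q\<bar> = \<bar>min p 0 + min q 0\<bar> * \<bar>min p 0 - min q 0\<bar>" by (simp add: abs_mult)
    also have "\<dots> \<le> (2 * K) * \<bar>p - q\<bar>" using that by (intro mult_mono) linarith+
    finally show ?thesis .
  qed
  have ac: "abs_cont_on 0 t (\<lambda>s. h (z s j))"
  proof (rule abs_cont_on_compose[of _ _ "\<lambda>s. z s j"])
    show "\<exists>M\<ge>0. \<forall>p q. \<bar>p\<bar> \<le> K \<and> \<bar>q\<bar> \<le> K \<longrightarrow> \<bar>h p - h q\<bar> \<le> M * \<bar>p - q\<bar>" if "0 \<le> K" for K
      using lip that by (intro exI[of _ "2 * K"]) auto
  qed (use solution_abs_cont z j \<open>0 \<le> t\<close> in auto)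
  have "h (z t j) \<le> h (z 0 j)"
  proof (rule abs_cont_on_nonincreasing[OF ac \<open>0 \<le> t\<close>], rule AE_mp[OF solution_AE[OF z]], rule AE_I2, intro impI)
    fix s assume a: "0 < s \<longrightarrow> (\<forall>j\<in>J. ((\<lambda>s. z s j) has_real_derivative w j * velocity (z s) j) (at s))" "0 < s \<and> s < t"
    then have "((\<lambda>s. h (z s j)) has_real_derivative 2 * min (z s j) 0 * (w j * velocity (z s) j)) (at s)"
      using j by (intro DERIV_chain2[OF h_der]) auto
    moreover have "2 * min (z s j) 0 * (w j * velocity (z s) j) \<le> 0"
      using j gain_pos[of j]
      by (auto simp: velocity_def clip_def min_def mult_le_0_iff zero_le_mult_iff not_less)
    ultimately show "\<exists>D\<le>0. ((\<lambda>s. h (z s j)) has_real_derivative D) (at s)" by blast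
  qed
  moreover have "h (z 0 j) = 0" using f j by (fastforce simp: h_def feasible_def min_def intro: antisym)
  ultimately show "0 \<le> z t j" by (auto simp: h_def min_def split: if_splits)
qed

lemma solution_shift:
  assumes z: "solution z" and "0 \<le> s"
  shows "solution (\<lambda>t. z (t + s))"
  unfolding solution_def
proof (intro ballI conjI allI impI)
  fix j assume j: "j \<in> J"
  show "abs_cont_on 0 T (\<lambda>t. z (t + s) j)" if "T > 0" for T
  proof (rule abs_cont_on_shift[of 0 s T "\<lambda>t. z t j"])
    show "abs_cont_on (0 + s) (T + s) (\<lambda>t. z t j)"
      using solution_abs_cont[OF z j, of "T + s"] that \<open>0 \<le> s\<close> by (auto intro: abs_cont_on_subset)
  qed
  have "AE t in lebesgue. t > 0 \<longrightarrow> ((\<lambda>s. z s j) has_real_derivative w j * velocity (z t) j) (at t)"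
    using z j by (simp add: solution_def)
  then have "AE t in lebesgue. t + s > 0 \<longrightarrow>
      ((\<lambda>s. z s j) has_real_derivative w j * velocity (z (t + s)) j) (at (t + s))"
    by (rule AE_lebesgue_shift)
  then show "AE t in lebesgue. t > 0 \<longrightarrow>
      ((\<lambda>t. z (t + s) j) has_real_derivative w j * velocity (z (t + s)) j) (at t)"
    by (rule AE_mp) (use \<open>0 \<le> s\<close> in \<open>auto simp: DERIV_shift\<close>)
qed

lemma velocity_monotone:
  assumes "feasible z" "feasible z'"
  shows "(\<Sum>j\<in>J. (z j - z' j) * (velocity z j - velocity z' j)) \<le> (\<Sum>j\<in>J. (z j - z' j) * (F z j - F z' j))"
  using assms by (intro sum_mono) (auto simp: velocity_def feasible_def clip_monotone)

lemma energy_derivative: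
  assumes "solution z" "solution z'"
  shows "AE t in lebesgue. t > 0 \<longrightarrow> ((\<lambda>s. energy (z s) (z' s)) has_real_derivative
    (\<Sum>j\<in>J. (z t j - z' t j) * (velocity (z t) j - velocity (z' t) j))) (at t)"
  using solution_AE[OF assms(1)] solution_AE[OF assms(2)]
proof eventually_elim
  case (elim t)
  show ?case
  proof
    assume "t > 0"
    with elim have d: "\<And>j. j \<in> J \<Longrightarrow> ((\<lambda>s. z s j) has_real_derivative w j * velocity (z t) j) (at t)"
      "\<And>j. j \<in> J \<Longrightarrow> ((\<lambda>s. z' s j) has_real_derivative w j * velocity (z' t) j) (at t)" by auto
    have "((\<lambda>s. (z s j - z' s j)\<^sup>2 / (2 * w j)) has_real_derivative
        (z t j - z' t j) * (velocity (z t) j - velocity (z' t) j)) (at t)" if j: "j \<in> J" for j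
      using gain_pos[OF j]
      by (auto intro!: derivative_eq_intros d[OF j] simp: field_simps power2_eq_square)
    then show "((\<lambda>s. energy (z s) (z' s)) has_real_derivative
        (\<Sum>j\<in>J. (z t j - z' t j) * (velocity (z t) j - velocity (z' t) j))) (at t)"
      unfolding energy_def by (intro DERIV_sum)
  qed
qed

lemma energy_nonincreasing:
  assumes z: "solution z" "feasible (z 0)" and z': "solution z'" "feasible (z' 0)"
    and "0 \<le> s" "s \<le> t"
  shows "energy (z t) (z' t) \<le> energy (z s) (z' s)"
proof (rule abs_cont_on_nonincreasing[OF _ \<open>s \<le> t\<close>])
  have "abs_cont_on 0 t (\<lambda>s. (z s j - z' s j)\<^sup>2 / (2 * w j))" if j: "j \<in> J" for j
  proof (rule abs_cont_on_compose[where h = "\<lambda>r. r\<^sup>2 / (2 * w j)"])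
    have "abs_cont_on 0 t (\<lambda>s. - z' s j)"
      using assms by (intro abs_cont_on_dominated[OF solution_abs_cont[OF z'(1) j, of t], of 1]) auto
    then have "abs_cont_on 0 t (\<lambda>s. z s j + - z' s j)"
      using assms by (intro abs_cont_on_add[OF solution_abs_cont[OF z(1) j]]) auto
    then show "abs_cont_on 0 t (\<lambda>s. z s j - z' s j)" by simp
    show "\<exists>M\<ge>0. \<forall>p q. \<bar>p\<bar> \<le> B \<and> \<bar>q\<bar> \<le> B \<longrightarrow> \<bar>p\<^sup>2 / (2 * w j) - q\<^sup>2 / (2 * w j)\<bar> \<le> M * \<bar>p - q\<bar>"
      if B: "0 \<le> B" for B
    proof (intro exI[of _ "2 * B / (2 * w j)"] conjI allI impI)
      fix p q :: real assume pq: "\<bar>p\<bar> \<le> B \<and> \<bar>q\<bar> \<le> B"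
      have "p\<^sup>2 / (2 * w j) - q\<^sup>2 / (2 * w j) = (p + q) * (p - q) / (2 * w j)"
        by (simp add: power2_eq_square diff_divide_distrib[symmetric] algebra_simps)
      also have "\<bar>\<dots>\<bar> = \<bar>p + q\<bar> * \<bar>p - q\<bar> / (2 * w j)"
        using gain_pos[OF j] by (simp add: abs_mult)
      also have "\<dots> \<le> 2 * B * \<bar>p - q\<bar> / (2 * w j)"
        using gain_pos[OF j] pq by (intro divide_right_mono mult_right_mono) auto
      finally show "\<bar>p\<^sup>2 / (2 * w j) - q\<^sup>2 / (2 * w j)\<bar> \<le> 2 * B / (2 * w j) * \<bar>p - q\<bar>" by simp
    qed (use gain_pos[OF j] B in auto)
  qed
  then show "abs_cont_on s t (\<lambda>t. energy (z t) (z' t))"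
    unfolding energy_def using assms
    by (intro abs_cont_on_sum finite_J) (auto intro: abs_cont_on_subset)
  show "AE r in lebesgue. s < r \<and> r < t \<longrightarrow>
      (\<exists>D\<le>0. ((\<lambda>t. energy (z t) (z' t)) has_real_derivative D) (at r))"
    using energy_derivative[OF z(1) z'(1)]
  proof eventually_elim
    case (elim r)
    show ?case
    proof
      assume r: "s < r \<and> r < t"
      have f: "feasible (z r)" "feasible (z' r)"
        using z z' assms r by (auto intro: solution_feasible)
      have "(\<Sum>j\<in>J. (z r j - z' r j) * (F (z r) j - F (z' r) j)) \<le> 0"
        using f by (intro monotone) (auto simp: feasible_def)
      from order_trans[OF velocity_monotone[OF f] this] elim r assms
      show "\<exists>D\<le>0. ((\<lambda>t. energy (z t) (z' t)) has_real_derivative D) (at r)"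
        by auto
    qed
  qed
qed

lemma equilibrium_solution: "equilibrium ze \<Longrightarrow> solution (\<lambda>t. ze)"
  by (auto simp: equilibrium_def solution_def abs_cont_on_const)

lemma energy_component:
  assumes "j \<in> J"
  shows "(z j - z' j)\<^sup>2 \<le> 2 * w j * energy z z'"
proof -
  have "(z j - z' j)\<^sup>2 / (2 * w j) \<le> energy z z'"
    unfolding energy_def using assms finite_J gain_pos
    by (intro member_le_sum) (auto simp: less_imp_le)
  then show ?thesis using gain_pos[OF assms] by (simp add: field_simps)
qed

lemma energy_tendsto_0:
  assumes "((\<lambda>n. energy (f n) l) \<longlongrightarrow> 0) A" "j \<in> J"
  shows "((\<lambda>n. f n j) \<longlongrightarrow> l j) A"
proof -
  have "((\<lambda>n. 2 * w j * energy (f n) l) \<longlongrightarrow> 2 * w j * 0) A"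
    by (intro tendsto_intros assms)
  then have lim: "((\<lambda>n. 2 * w j * energy (f n) l) \<longlongrightarrow> 0) A" by simp
  have "((\<lambda>n. (f n j - l j)\<^sup>2) \<longlongrightarrow> 0) A"
    by (rule Lim_null_comparison[OF _ lim]) (use energy_component[OF assms(2)] in auto)
  then have "((\<lambda>n. sqrt ((f n j - l j)\<^sup>2)) \<longlongrightarrow> sqrt 0) A" by (rule tendsto_real_sqrt)
  then have "((\<lambda>n. f n j - l j) \<longlongrightarrow> 0) A" by (simp add: tendsto_rabs_zero_iff)
  then show ?thesis by (rule LIM_zero_cancel)
qed

lemma energy_tendsto:
  assumes "\<And>j. j \<in> J \<Longrightarrow> ((\<lambda>n. f n j) \<longlongrightarrow> l j) A"
  shows "((\<lambda>n. energy (f n) z) \<longlongrightarrow> energy l z) A"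
  unfolding energy_def using gain_pos by (intro tendsto_intros assms) (auto simp: less_imp_neq[symmetric])

lemma constant_energy:
  assumes v: "solution v" and zs: "equilibrium zs"
    and const: "\<And>t. 0 \<le> t \<Longrightarrow> energy (v t) zs = energy (v 0) zs"
  shows "AE t in lebesgue. t > 0 \<longrightarrow> (\<Sum>j\<in>J. (v t j - zs j) * velocity (v t) j) = 0"
  using energy_derivative[OF v equilibrium_solution[OF zs]]
proof eventually_elim
  case (elim t)
  show ?case
  proof
    assume t: "t > 0"
    have "(\<Sum>j\<in>J. (v t j - zs j) * (velocity (v t) j - velocity zs j)) = 0"
      by (rule constant_derivative[OF const t]) (use elim t in auto)
    then show "(\<Sum>j\<in>J. (v t j - zs j) * velocity (v t) j) = 0"
      using zs by (simp add: equilibrium_def)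
  qed
qed

lemma constant_component:
  assumes v: "solution v" and i: "i \<in> J" and const: "\<And>t. 0 \<le> t \<Longrightarrow> v t i = c"
  shows "AE t in lebesgue. t > 0 \<longrightarrow> velocity (v t) i = 0"
  using solution_AE[OF v]
proof eventually_elim
  case (elim t)
  show ?case
  proof
    assume t: "t > 0"
    have "w i * velocity (v t) i = 0"
      by (rule constant_derivative[of "\<lambda>t. v t i" c, OF const t]) (use elim t i in auto)
    then show "velocity (v t) i = 0" using gain_pos[OF i] by simp
  qed
qed

lemma constant_difference:
  assumes v: "solution v" and ij: "i \<in> J" "j \<in> J" and const: "\<And>t. 0 \<le> t \<Longrightarrow> v t i - v t j = c"
  shows "AE t in lebesgue. t > 0 \<longrightarrow> w i * velocity (v t) i = w j * velocity (v t) j"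
  using solution_AE[OF v]
proof eventually_elim
  case (elim t)
  show ?case
  proof
    assume t: "t > 0"
    have "w i * velocity (v t) i - w j * velocity (v t) j = 0"
      by (rule constant_derivative[of "\<lambda>t. v t i - v t j" c, OF const t])
        (use elim t ij in \<open>auto intro!: DERIV_diff\<close>)
    then show "w i * velocity (v t) i = w j * velocity (v t) j" by simp
  qed
qed

text \<open>The projected field is discontinuous, so that its vanishing at almost all times does not pass
  to the limit \<open>0\<close>. But a solution with zero velocity is constant.\<close>

lemma stationary_equilibrium:
  assumes v: "solution v" "feasible (v 0)"
    and zero: "AE t in lebesgue. t > 0 \<longrightarrow> (\<forall>j\<in>J. velocity (v t) j = 0)"
  shows "equilibrium (v 0)"
proof -
  have const: "v t j = v 0 j" if t: "0 \<le> t" and j: "j \<in> J" for t j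
  proof (rule antisym)
    have der: "AE s in lebesgue. s > 0 \<longrightarrow> ((\<lambda>s. v s j) has_real_derivative 0) (at s)"
      using solution_AE[OF v(1)] zero by eventually_elim (use j in fastforce)
    have ac: "abs_cont_on 0 t (\<lambda>s. v s j)" by (rule solution_abs_cont[OF v(1) j t])
    show "v t j \<le> v 0 j"
      by (rule abs_cont_on_nonincreasing[OF ac t]) (use der in eventually_elim, auto)
    have ac': "abs_cont_on 0 t (\<lambda>s. - v s j)"
      by (rule abs_cont_on_dominated[OF ac, of 1]) auto
    have "- v t j \<le> - v 0 j"
      by (rule abs_cont_on_nonincreasing[OF ac' t])
        (use der in eventually_elim, auto intro!: exI[of _ 0] derivative_eq_intros)
    then show "v 0 j \<le> v t j" by simp
  qed
  obtain t where t: "t > 0" "\<forall>j\<in>J. velocity (v t) j = 0"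
  proof -
    have False if "\<nexists>t. t > 0 \<and> (\<forall>j\<in>J. velocity (v t) j = 0)"
    proof -
      have "AE t::real in lebesgue. t > 0 \<longrightarrow> (1::real) = 0"
        by (rule AE_mp[OF zero], rule AE_I2) (use that in blast)
      then show False using AE_lebesgue_continuous_zero[of "\<lambda>_. 1" 0] by simp
    qed
    then show thesis using that by blast
  qed
  have "velocity (v 0) j = velocity (v t) j" if j: "j \<in> J" for j
  proof -
    have eq: "v t i = v 0 i" if "i \<in> J" for i using const t(1) that by (meson less_imp_le)
    then have "(\<Sum>i\<in>J. \<bar>v 0 i - v t i\<bar>) = 0" by simp
    then have "F (v 0) j = F (v t) j" using lipschitz[OF j, of "v 0" "v t"] by simp
    then show ?thesis using eq[OF j] by (simp add: velocity_def)
  qed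
  then show ?thesis using t v by (simp add: equilibrium_def)
qed

text \<open>
  The flow is nonexpansive in the energy distance. A limit point \<open>l\<close> of a trajectory therefore starts
  a solution that the time shifts of the trajectory approximate, and along which the distance to
  every equilibrium is constant. Once \<open>l\<close> is known to be an equilibrium, the distance
  to \<open>l\<close> itself decreases, so the whole trajectory converges.
\<close>

theorem convergence:
  assumes eq: "equilibrium zs"
    and invariance: "\<And>v. \<lbrakk>solution v; feasible (v 0); \<And>t. 0 \<le> t \<Longrightarrow> energy (v t) zs = energy (v 0) zs\<rbrakk>
        \<Longrightarrow> equilibrium (v 0)"
    and z: "solution z" "feasible (z 0)"
  obtains l where "equilibrium l" "\<And>j. j \<in> J \<Longrightarrow> ((\<lambda>t. z t j) \<longlongrightarrow> l j) at_top"
proof -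
  have dec: "energy (z t) l \<le> energy (z s) l" if "equilibrium l" "0 \<le> s" "s \<le> t" for l s t
    using energy_nonincreasing[OF z equilibrium_solution, of l s t] that by (simp add: equilibrium_def)
  have bound: "\<bar>z (real n) j\<bar> \<le> \<bar>zs j\<bar> + (2 * w j * energy (z 0) zs + 1)" if j: "j \<in> J" for n j
  proof -
    have "(z (real n) j - zs j)\<^sup>2 \<le> 2 * w j * energy (z (real n)) zs"
      by (rule energy_component[OF j])
    also have "\<dots> \<le> 2 * w j * energy (z 0) zs"
      using dec[OF eq, of 0 "real n"] gain_pos[OF j] by simp
    finally have sq: "(z (real n) j - zs j)\<^sup>2 \<le> 2 * w j * energy (z 0) zs" .
    define y where "y = \<bar>z (real n) j - zs j\<bar>"
    have "y\<^sup>2 \<le> 2 * w j * energy (z 0) zs" "0 \<le> y\<^sup>2" using sq by (simp_all add: y_def)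
    moreover have "2 * y \<le> y\<^sup>2 + 1" using zero_le_power2[of "y - 1"] by (simp add: power2_diff)
    ultimately have "y \<le> 2 * w j * energy (z 0) zs + 1" by linarith
    then have "\<bar>z (real n) j - zs j\<bar> \<le> 2 * w j * energy (z 0) zs + 1" by (simp add: y_def)
    then show ?thesis by linarith
  qed
  obtain r l where r: "strict_mono r" "\<And>j. j \<in> J \<Longrightarrow> (\<lambda>n. z (real (r n)) j) \<longlonglongrightarrow> l j"
    using bounded_family_subseq[OF finite_J, of "\<lambda>n. z (real n)", OF bound] by blast
  have lf: "feasible l"
    unfolding feasible_def
  proof
    fix j assume j: "j \<in> J \<inter> R"
    show "0 \<le> l j"
      by (rule LIMSEQ_le_const[OF r(2)]) (use j solution_feasible[OF z] in \<open>auto simp: feasible_def\<close>)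
  qed
  have r_top: "filterlim (\<lambda>n. real (r n)) at_top sequentially"
    using filterlim_compose[OF filterlim_real_sequentially filterlim_subseq[OF r(1)]] .
  have to_l: "(\<lambda>n. energy (z (real (r n))) x) \<longlonglongrightarrow> energy l x" for x
    by (intro energy_tendsto r(2))
  obtain v where v: "solution v" "v 0 = l" using solution_exists[OF lf] .
  have const: "energy (v s) zs = energy (v 0) zs" if s: "0 \<le> s" for s
  proof -
    have "energy (v s) zs \<le> energy (v 0) zs"
      using energy_nonincreasing[OF v(1) _ equilibrium_solution[OF eq], of 0 s] v lf eq s
      by (simp add: equilibrium_def)
    moreover have "energy (v 0) zs \<le> energy (v s) zs"
    proof -
      have zero: "(\<lambda>n. energy (z (real (r n))) l) \<longlonglongrightarrow> 0"
        using to_l[of l] by (simp add: energy_def)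
      have "(\<lambda>n. energy (z (s + real (r n))) (v s)) \<longlonglongrightarrow> 0"
      proof (rule Lim_null_comparison[OF _ zero], rule always_eventually, rule allI)
        fix n
        have "energy (z (s + real (r n))) (v s) \<le> energy (z (0 + real (r n))) (v 0)"
          by (rule energy_nonincreasing[OF solution_shift[OF z(1)] _ v(1)])
            (use v lf s solution_feasible[OF z] in auto)
        moreover have "0 \<le> energy (z (s + real (r n))) (v s)"
          unfolding energy_def using gain_pos by (intro sum_nonneg) (auto simp: less_imp_le)
        ultimately show "norm (energy (z (s + real (r n))) (v s)) \<le> energy (z (real (r n))) l"
          using v by simp
      qed
      from energy_tendsto_0[where f = "\<lambda>n. z (s + real (r n))", OF this]
      have "(\<lambda>n. energy (z (s + real (r n))) zs) \<longlonglongrightarrow> energy (v s) zs"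
        by (rule energy_tendsto)
      moreover have "energy l zs \<le> energy (z (s + real (r n))) zs" for n
      proof (rule tendsto_upperbound[OF to_l])
        show "\<forall>\<^sub>F m in sequentially. energy (z (real (r m))) zs \<le> energy (z (s + real (r n))) zs"
          using filterlim_at_top[THEN iffD1, OF r_top, rule_format, of "s + real (r n)"]
          by eventually_elim (use s in \<open>auto intro!: dec[OF eq]\<close>)
      qed simp
      ultimately have "energy l zs \<le> energy (v s) zs"
        by (intro LIMSEQ_le_const) auto
      then show ?thesis using v by simp
    qed
    ultimately show ?thesis by simp
  qed
  have le: "equilibrium l" using invariance[OF v(1) _ const] v lf by simp
  have lim: "((\<lambda>t. energy (z t) l) \<longlongrightarrow> 0) at_top"
  proof (rule tendstoI)
    fix e :: real assume "e > 0"
    have "(\<lambda>n. energy (z (real (r n))) l) \<longlonglongrightarrow> 0" using to_l[of l] by (simp add: energy_def)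
    from order_tendstoD(2)[OF this \<open>e > 0\<close>] obtain n where n: "energy (z (real (r n))) l < e"
      by (meson eventually_sequentially order_refl)
    show "\<forall>\<^sub>F t in at_top. dist (energy (z t) l) 0 < e"
      using eventually_ge_at_top[of "real (r n)"]
    proof eventually_elim
      case (elim t)
      have "energy (z t) l \<le> energy (z (real (r n))) l" using elim by (intro dec[OF le]) auto
      moreover have "0 \<le> energy (z t) l"
        unfolding energy_def using gain_pos by (intro sum_nonneg) (auto simp: less_imp_le)
      ultimately show ?case using n by simp
    qed
  qed
  show thesis
  proof (rule that[OF le])
    fix j assume "j \<in> J"
    with lim show "((\<lambda>t. z t j) \<longlongrightarrow> l j) at_top" by (rule energy_tendsto_0)
  qed
qed

end

section \<open>Flows on the network and optimality conditions\<close>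

definition angle_drop :: "('n::finite \<Rightarrow> real) \<Rightarrow> 'n \<times> 'n \<Rightarrow> real" where
  "angle_drop \<theta> e = (\<Sum>i\<in>UNIV. inc i e * \<theta> i)"

definition outflow :: "('n, 'k) network \<Rightarrow> ('n \<times> 'n \<Rightarrow> real) \<Rightarrow> 'n \<Rightarrow> real" where
  "outflow S P i = (\<Sum>e\<in>lines S. inc i e * P e)"

definition area_export :: "('n, 'k) network \<Rightarrow> ('n \<times> 'n \<Rightarrow> real) \<Rightarrow> 'k \<Rightarrow> real" where
  "area_export S P k = (\<Sum>e\<in>lines S. area_inc S k e * P e)"

text \<open>The multipliers of the area and line constraints enter the equation for the angles like the
  flow \<open>B (C\<^sub>a\<^sup>T \<pi> + \<rho>\<^sup>+ - \<rho>\<^sup>-)\<close>, with \<open>C\<^sub>a\<close> the incidence matrix of the areas.\<close>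

definition price_flow ::
  "('n, 'k) network \<Rightarrow> ('k \<Rightarrow> real) \<Rightarrow> ('n \<times> 'n \<Rightarrow> real) \<Rightarrow> ('n \<times> 'n \<Rightarrow> real) \<Rightarrow> 'n \<times> 'n \<Rightarrow> real"
  where "price_flow S \<pi> rp rm e = suscept S e * ((\<Sum>k\<in>areas S. area_inc S k e * \<pi> k) + (rp e - rm e))"

definition complementary ::
  "('n::finite, 'k) network \<Rightarrow> ('n \<Rightarrow> real) \<Rightarrow> ('n \<times> 'n \<Rightarrow> real) \<Rightarrow> ('n \<times> 'n \<Rightarrow> real) \<Rightarrow> bool" where
  "complementary S \<theta> rp rm \<longleftrightarrow> (\<forall>e\<in>lines S. 0 \<le> rp e \<and> 0 \<le> rm e \<and>
     rp e * (line_flow S \<theta> e - Pmax S e) = 0 \<and> rm e * (Pmin S e - line_flow S \<theta> e) = 0)"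

lemma finite_lines: "finite (lines (S :: ('n::finite, 'k) network))"
  by simp

lemma line_flow_eq: "line_flow S \<theta> e = suscept S e * angle_drop \<theta> e"
  by (simp add: line_flow_def angle_drop_def)

lemma angle_drop_linear:
  "angle_drop (\<lambda>i. \<theta> i + \<eta> i) e = angle_drop \<theta> e + angle_drop \<eta> e"
  "angle_drop (\<lambda>i. \<theta> i - \<eta> i) e = angle_drop \<theta> e - angle_drop \<eta> e"
  "angle_drop (\<lambda>i. t * \<theta> i) e = t * angle_drop \<theta> e"
  by (simp_all add: angle_drop_def distrib_left right_diff_distrib sum.distrib sum_subtractf
      sum_distrib_left mult_ac)

lemma outflow_linear:
  "outflow S (\<lambda>e. P e + Q e) i = outflow S P i + outflow S Q i"
  "outflow S (\<lambda>e. P e - Q e) i = outflow S P i - outflow S Q i"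
  "outflow S (\<lambda>e. t * P e) i = t * outflow S P i"
  by (simp_all add: outflow_def distrib_left right_diff_distrib sum.distrib sum_subtractf
      sum_distrib_left mult_ac)

lemma angle_drop_apply: "fst e \<noteq> snd e \<Longrightarrow> angle_drop \<theta> e = \<theta> (fst e) - \<theta> (snd e)"
proof -
  assume e: "fst e \<noteq> snd e"
  have "angle_drop \<theta> e = (\<Sum>i\<in>UNIV. (if i = fst e then \<theta> i else 0) - (if i = snd e then \<theta> i else 0))"
    unfolding angle_drop_def inc_def using e by (intro sum.cong) auto
  then show ?thesis by (simp add: sum_subtractf)
qed

lemma sum_outflow: "(\<Sum>i\<in>UNIV. \<nu> i * outflow S P i) = (\<Sum>e\<in>lines S. P e * angle_drop \<nu> e)"
  unfolding outflow_def angle_drop_def sum_distrib_left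
  by (subst sum.swap) (simp add: mult_ac)

lemma laplacian_outflow:
  "(\<Sum>j\<in>UNIV. laplacian S i j * \<theta> j) = outflow S (line_flow S \<theta>) i"
  unfolding laplacian_def outflow_def line_flow_def sum_distrib_right sum_distrib_left
  by (subst sum.swap) (simp add: mult_ac)

lemma valid_no_loop: "valid_network S \<Longrightarrow> e \<in> lines S \<Longrightarrow> fst e \<noteq> snd e"
  unfolding valid_network_def by (metis prod.collapse)

lemma suscept_pos: "valid_network S \<Longrightarrow> e \<in> lines S \<Longrightarrow> suscept S e > 0"
  by (simp add: valid_network_def)

lemma angle_drop_const: "valid_network S \<Longrightarrow> e \<in> lines S \<Longrightarrow> angle_drop (\<lambda>i. c) e = 0"
  using angle_drop_apply[of e "\<lambda>_. c"] valid_no_loop[of S e] by simp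

text \<open>Along a path the bounds for the single lines add up.\<close>

lemma connected_bound:
  assumes S: "valid_network S"
  shows "\<exists>M. \<forall>\<theta>. (\<forall>e\<in>lines S. \<bar>angle_drop \<theta> e\<bar> \<le> c e) \<longrightarrow> \<bar>\<theta> i - \<theta> j\<bar> \<le> M"
proof -
  have "(i, j) \<in> (lines S \<union> (lines S)\<inverse>)\<^sup>*" using S by (simp add: valid_network_def)
  then show ?thesis
  proof (induction rule: rtrancl_induct)
    case base
    show ?case by (rule exI[of _ 0]) simp
  next
    case (step k l)
    then obtain M where M: "\<And>\<theta>. (\<forall>e\<in>lines S. \<bar>angle_drop \<theta> e\<bar> \<le> c e) \<Longrightarrow> \<bar>\<theta> i - \<theta> k\<bar> \<le> M" by auto
    have "\<bar>\<theta> i - \<theta> l\<bar> \<le> M + \<bar>c (k, l)\<bar> + \<bar>c (l, k)\<bar>" if \<theta>: "\<forall>e\<in>lines S. \<bar>angle_drop \<theta> e\<bar> \<le> c e" for \<theta>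
    proof -
      have "\<bar>\<theta> k - \<theta> l\<bar> \<le> \<bar>c (k, l)\<bar> + \<bar>c (l, k)\<bar>"
      proof (cases "(k, l) \<in> lines S")
        case True
        then have "\<bar>angle_drop \<theta> (k, l)\<bar> \<le> c (k, l)" using \<theta> by blast
        then show ?thesis
          using angle_drop_apply[of "(k, l)" \<theta>] valid_no_loop[OF S True] by simp
      next
        case False
        with step have l: "(l, k) \<in> lines S" by auto
        then have "\<bar>angle_drop \<theta> (l, k)\<bar> \<le> c (l, k)" using \<theta> by blast
        then show ?thesis
          using angle_drop_apply[of "(l, k)" \<theta>] valid_no_loop[OF S l] by simp
      qed
      then show ?thesis using M[OF \<theta>] by linarith
    qed
    then show ?case by blast
  qed
qed

text \<open>If all drops vanish, one bound holds for every multiple of \<open>\<theta>\<close>.\<close>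

lemma connected_constant:
  assumes "valid_network S" "\<And>e. e \<in> lines S \<Longrightarrow> angle_drop \<theta> e = 0"
  shows "\<theta> i = \<theta> j"
proof -
  obtain M where M: "\<And>\<theta>. (\<forall>e\<in>lines S. \<bar>angle_drop \<theta> e\<bar> \<le> 0) \<Longrightarrow> \<bar>\<theta> i - \<theta> j\<bar> \<le> M"
    using connected_bound[OF assms(1), of "\<lambda>_. 0" i j] by blast
  show ?thesis
  proof (rule ccontr)
    assume ne: "\<theta> i \<noteq> \<theta> j"
    define t where "t = (\<bar>M\<bar> + 1) / \<bar>\<theta> i - \<theta> j\<bar>"
    have "\<bar>t * \<theta> i - t * \<theta> j\<bar> \<le> M"
      by (rule M) (use assms(2) in \<open>simp add: angle_drop_linear\<close>)
    moreover have "\<bar>t * \<theta> i - t * \<theta> j\<bar> = \<bar>M\<bar> + 1"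
      using ne by (simp add: abs_mult flip: right_diff_distrib) (simp add: t_def)
    ultimately show False by linarith
  qed
qed

lemma sum_outflow_zero:
  assumes "valid_network S"
  shows "(\<Sum>i\<in>UNIV. outflow S P i) = 0"
  using sum_outflow[of "\<lambda>_. 1" S P] angle_drop_const[OF assms, of _ 1] by simp

lemma outflow_zero_imp_drop_zero:
  assumes S: "valid_network S" and zero: "\<And>i. outflow S (line_flow S f) i = 0" and e: "e \<in> lines S"
  shows "angle_drop f e = 0"
proof -
  have "(\<Sum>e\<in>lines S. suscept S e * (angle_drop f e)\<^sup>2) = (\<Sum>i\<in>UNIV. f i * outflow S (line_flow S f) i)"
    by (simp add: sum_outflow line_flow_eq power2_eq_square mult_ac)
  also have "\<dots> = 0" by (simp add: zero)
  finally have "(\<Sum>e\<in>lines S. suscept S e * (angle_drop f e)\<^sup>2) = 0" .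
  moreover have "0 \<le> suscept S e * (angle_drop f e)\<^sup>2" if "e \<in> lines S" for e
    using suscept_pos[OF S that] by simp
  ultimately have "suscept S e * (angle_drop f e)\<^sup>2 = 0"
    using sum_nonneg_eq_0_iff[of "lines S" "\<lambda>e. suscept S e * (angle_drop f e)\<^sup>2"] e by simp
  then show ?thesis using suscept_pos[OF S e] by simp
qed

text \<open>A finitely generated cone is closed, so a vector outside it is separated from it.\<close>

lemma farkas:
  fixes T :: "'a::euclidean_space set"
  assumes "finite T" and q: "\<And>h. (\<And>t. t \<in> T \<Longrightarrow> t \<bullet> h \<le> 0) \<Longrightarrow> q \<bullet> h \<le> 0"
  shows "q \<in> convex_cone hull T"
proof (rule ccontr)
  assume "q \<notin> convex_cone hull T"
  then obtain a b where ab: "a \<bullet> q < b" "\<And>x. x \<in> convex_cone hull T \<Longrightarrow> a \<bullet> x > b"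
    using separating_hyperplane_closed_point[OF convex_convex_cone_hull closed_convex_cone_hull[OF assms(1)]]
    by metis
  have b: "b < 0" using ab(2)[OF convex_cone_hull_contains_0] by simp
  have "t \<bullet> (- a) \<le> 0" if t: "t \<in> T" for t
  proof (rule ccontr)
    assume "\<not> ?thesis"
    then have neg: "a \<bullet> t < 0" by (simp add: inner_commute)
    have "(b / (a \<bullet> t)) *\<^sub>R t \<in> convex_cone hull T"
      using t b neg by (intro convex_cone_hull_mul hull_inc) (auto intro: divide_nonpos_neg)
    from ab(2)[OF this] show False using neg by simp
  qed
  from q[OF this] have "q \<bullet> (- a) \<le> 0" by blast
  then show False using ab(1) b by (simp add: inner_commute)
qed

text \<open>
  With \<open>d\<close> eliminated, the problem minimises a function of the angles over a polyhedron that is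
  compact once one angle is fixed, because the line limits bound all angle differences. At a
  minimiser no feasible direction decreases the cost, and Farkas' lemma for the active constraints
  gives the multipliers.
\<close>

theorem optimal_multipliers:
  fixes S :: "('n::finite, 'k) network"
  assumes S: "valid_network S" and feas: "OLC_feasible S d0 \<omega>0 \<theta>0"
    and der: "\<And>i d. (cost S i has_real_derivative c' i d) (at d)"
  shows "\<exists>\<theta> \<pi> rp rm.
     (\<forall>k\<in>areas S. area_export S (line_flow S \<theta>) k = Phat S k) \<and>
     (\<forall>e\<in>lines S. Pmin S e \<le> line_flow S \<theta> e \<and> line_flow S \<theta> e \<le> Pmax S e) \<and>
     complementary S \<theta> rp rm \<and>
     (\<forall>i. outflow S (line_flow S (\<lambda>j. c' j (Pin S j - outflow S (line_flow S \<theta>) j))) i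
        = outflow S (price_flow S \<pi> rp rm) i)"
proof -
  define adm where "adm \<theta> \<longleftrightarrow>
     (\<forall>k\<in>areas S. area_export S (line_flow S \<theta>) k = Phat S k) \<and>
     (\<forall>e\<in>lines S. Pmin S e \<le> line_flow S \<theta> e \<and> line_flow S \<theta> e \<le> Pmax S e)" for \<theta>
  define f where "f \<theta> = (\<Sum>i\<in>UNIV. cost S i (Pin S i - outflow S (line_flow S \<theta>) i))" for \<theta>
  obtain i0 :: 'n where True by simp
  have nth_lambda: "vec_nth (\<chi> i. g i) = g" for g :: "'n \<Rightarrow> real" by (simp add: fun_eq_iff)
  have flow_shift: "line_flow S (\<lambda>i. \<theta> i - c) e = line_flow S \<theta> e" if "e \<in> lines S" for \<theta> c e
    using angle_drop_const[OF S that, of c] by (simp add: line_flow_eq angle_drop_linear)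
  have f_shift: "f (\<lambda>i. \<theta> i - c) = f \<theta>" for \<theta> c
    unfolding f_def outflow_def by (simp add: flow_shift cong: sum.cong)
  have adm_shift: "adm (\<lambda>i. \<theta> i - c) = adm \<theta>" for \<theta> c
    unfolding adm_def area_export_def by (simp add: flow_shift cong: sum.cong)
  have flow_cont: "continuous_on A (\<lambda>\<theta>. line_flow S (vec_nth \<theta>) e)" for A :: "(real^'n) set" and e
    unfolding line_flow_def by (intro continuous_intros)
  define A where "A = {\<theta> :: real^'n. adm (vec_nth \<theta>) \<and> \<theta> $ i0 = 0}"
  have "closed A"
  proof -
    have A_eq: "A = (\<Inter>k\<in>areas S. {\<theta>. area_export S (line_flow S (vec_nth \<theta>)) k = Phat S k}) \<inter>
        (\<Inter>e\<in>lines S. {\<theta>. Pmin S e \<le> line_flow S (vec_nth \<theta>) e} \<inter> {\<theta>. line_flow S (vec_nth \<theta>) e \<le> Pmax S e})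
        \<inter> {\<theta>. \<theta> $ i0 = 0}"
      unfolding A_def adm_def by auto
    show ?thesis
      unfolding A_eq area_export_def
      by (intro closed_Int closed_INT ballI closed_Collect_eq closed_Collect_le continuous_intros flow_cont)
  qed
  moreover have "bounded A"
  proof -
    obtain M where M: "\<And>i \<theta>. (\<forall>e\<in>lines S. \<bar>angle_drop \<theta> e\<bar> \<le> Pmax S e / suscept S e) \<Longrightarrow> \<bar>\<theta> i - \<theta> i0\<bar> \<le> M i"
      using connected_bound[OF S, of "\<lambda>e. Pmax S e / suscept S e" _ i0] by metis
    show ?thesis
      unfolding bounded_iff
    proof (intro exI ballI)
      fix \<theta> assume \<theta>: "\<theta> \<in> A"
      have "\<bar>angle_drop (vec_nth \<theta>) e\<bar> \<le> Pmax S e / suscept S e" if e: "e \<in> lines S" for e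
      proof -
        have "- Pmax S e \<le> suscept S e * angle_drop (vec_nth \<theta>) e" "suscept S e * angle_drop (vec_nth \<theta>) e \<le> Pmax S e"
          using \<theta> e by (auto simp: A_def adm_def Pmin_def line_flow_eq)
        then show ?thesis using suscept_pos[OF S e] by (simp add: abs_le_iff field_simps)
      qed
      then have "\<bar>\<theta> $ i\<bar> \<le> M i" for i
        using M[of "vec_nth \<theta>" i] \<theta> by (auto simp: A_def)
      then show "norm \<theta> \<le> (\<Sum>i\<in>UNIV. M i)"
        by (intro order_trans[OF norm_le_l1_cart] sum_mono)
    qed
  qed
  ultimately have "compact A" by (simp add: compact_eq_bounded_closed)
  have "adm \<theta>0" using feas by (simp add: adm_def OLC_feasible_def area_export_def)
  then have "(\<chi> i. \<theta>0 i - \<theta>0 i0) \<in> A" by (simp add: A_def adm_shift nth_lambda)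
  then have "A \<noteq> {}" by auto
  have "continuous_on A (\<lambda>\<theta>. f (vec_nth \<theta>))"
  proof -
    have cost: "continuous_on UNIV (cost S i)" for i
      using der DERIV_isCont by (intro continuous_at_imp_continuous_on) blast
    have "continuous_on A (\<lambda>\<theta>. Pin S i - outflow S (line_flow S (vec_nth \<theta>)) i)" for i
      unfolding outflow_def by (intro continuous_intros flow_cont)
    then show ?thesis
      unfolding f_def by (intro continuous_on_sum continuous_on_compose2[OF cost]) auto
  qed
  then obtain \<theta>m where \<theta>m: "\<theta>m \<in> A" "\<And>\<theta>. \<theta> \<in> A \<Longrightarrow> f (vec_nth \<theta>m) \<le> f (vec_nth \<theta>)"
    using continuous_attains_inf[OF \<open>compact A\<close> \<open>A \<noteq> {}\<close>] by metis
  define \<theta> where "\<theta> = vec_nth \<theta>m"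
  have adm: "adm \<theta>" using \<theta>m by (simp add: \<theta>_def A_def)
  have min: "f \<theta> \<le> f \<eta>" if "adm \<eta>" for \<eta>
    using \<theta>m(2)[of "\<chi> i. \<eta> i - \<eta> i0"] that by (simp add: \<theta>_def A_def adm_shift f_shift nth_lambda)
  define D where "D j = Pin S j - outflow S (line_flow S \<theta>) j" for j
  define q where "q = (\<chi> i. outflow S (line_flow S (\<lambda>j. c' j (D j))) i)"
  define va :: "'k \<Rightarrow> real^'n" where "va k = (\<chi> i. outflow S (\<lambda>e. suscept S e * area_inc S k e) i)" for k
  define vb :: "'n \<times> 'n \<Rightarrow> real^'n" where "vb e = (\<chi> i. inc i e * suscept S e)" for e
  define T where "T = va ` areas S \<union> (\<lambda>k. - va k) ` areas S \<union>
      vb ` {e\<in>lines S. line_flow S \<theta> e = Pmax S e} \<union> (\<lambda>e. - vb e) ` {e\<in>lines S. line_flow S \<theta> e = Pmin S e}"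
  have "finite T" using S unfolding T_def valid_network_def by auto
  have va: "va k \<bullet> h = area_export S (line_flow S (vec_nth h)) k" for k h
    using sum_outflow[of "vec_nth h" S "\<lambda>e. suscept S e * area_inc S k e"]
    by (simp add: inner_vec_def va_def area_export_def line_flow_eq mult_ac)
  have vb: "vb e \<bullet> h = line_flow S (vec_nth h) e" for e h
    by (simp add: inner_vec_def vb_def line_flow_def sum_distrib_left mult_ac)
  have flow_add: "line_flow S (\<lambda>i. \<theta> i + t * h i) = (\<lambda>e. line_flow S \<theta> e + t * line_flow S h e)" for t h
    by (simp add: fun_eq_iff line_flow_eq angle_drop_linear algebra_simps)
  have f_der: "((\<lambda>t. f (\<lambda>i. \<theta> i + t * h $ i)) has_real_derivative - (q \<bullet> h)) (at 0)" for h :: "real^'n"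
  proof -
    have eq: "f (\<lambda>i. \<theta> i + t * h $ i) = (\<Sum>i\<in>UNIV. cost S i (D i - t * outflow S (line_flow S (vec_nth h)) i))" for t
      by (simp add: f_def D_def flow_add outflow_linear algebra_simps)
    have sym: "(\<Sum>i\<in>UNIV. c' i (D i) * outflow S (line_flow S (vec_nth h)) i) = q \<bullet> h"
      using sum_outflow[of "\<lambda>i. c' i (D i)" S "line_flow S (vec_nth h)"]
        sum_outflow[of "vec_nth h" S "line_flow S (\<lambda>i. c' i (D i))"]
      by (simp add: inner_vec_def q_def line_flow_eq mult_ac)
    have "((\<lambda>t. \<Sum>i\<in>UNIV. cost S i (D i - t * outflow S (line_flow S (vec_nth h)) i)) has_real_derivative
        (\<Sum>i\<in>UNIV. c' i (D i - 0 * outflow S (line_flow S (vec_nth h)) i) * (- outflow S (line_flow S (vec_nth h)) i))) (at 0)"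
      by (intro DERIV_sum DERIV_chain2[OF der]) (auto intro!: derivative_eq_intros)
    then show ?thesis by (simp add: eq sum_negf sym)
  qed
  have "q \<in> convex_cone hull T"
  proof (rule farkas[OF \<open>finite T\<close>], rule ccontr)
    fix h assume h: "\<And>t. t \<in> T \<Longrightarrow> t \<bullet> h \<le> 0" and "\<not> q \<bullet> h \<le> 0"
    have ha: "area_export S (line_flow S (vec_nth h)) k = 0" if "k \<in> areas S" for k
      using h[of "va k"] h[of "- va k"] that by (auto simp: T_def va)
    have hp: "line_flow S (vec_nth h) e \<le> 0" if "e \<in> lines S" "line_flow S \<theta> e = Pmax S e" for e
      using h[of "vb e"] that by (auto simp: T_def vb)
    have hm: "0 \<le> line_flow S (vec_nth h) e" if "e \<in> lines S" "line_flow S \<theta> e = Pmin S e" for e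
      using h[of "- vb e"] that by (auto simp: T_def vb)
    have lim: "((\<lambda>t. line_flow S \<theta> e + t * line_flow S (vec_nth h) e) \<longlongrightarrow> line_flow S \<theta> e + 0 * line_flow S (vec_nth h) e) (at_right 0)" for e
      by (intro tendsto_intros)
    have "\<forall>\<^sub>F t in at_right 0. Pmin S e \<le> line_flow S \<theta> e + t * line_flow S (vec_nth h) e \<and>
        line_flow S \<theta> e + t * line_flow S (vec_nth h) e \<le> Pmax S e" if e: "e \<in> lines S" for e
    proof (rule eventually_conj)
      have pos: "\<forall>\<^sub>F t in at_right 0. t > (0::real)" by (rule eventually_at_right_less)
      show "\<forall>\<^sub>F t in at_right 0. Pmin S e \<le> line_flow S \<theta> e + t * line_flow S (vec_nth h) e"
      proof (cases "line_flow S \<theta> e = Pmin S e")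
        case True
        from pos show ?thesis by eventually_elim (use True hm[OF e True] in auto)
      next
        case False
        then have "Pmin S e < line_flow S \<theta> e + 0 * line_flow S (vec_nth h) e"
          using adm e by (force simp: adm_def)
        from order_tendstoD(1)[OF lim this] show ?thesis by eventually_elim simp
      qed
      show "\<forall>\<^sub>F t in at_right 0. line_flow S \<theta> e + t * line_flow S (vec_nth h) e \<le> Pmax S e"
      proof (cases "line_flow S \<theta> e = Pmax S e")
        case True
        from pos show ?thesis
          by eventually_elim (use True hp[OF e True] in \<open>auto simp: mult_nonneg_nonpos\<close>)
      next
        case False
        then have "line_flow S \<theta> e + 0 * line_flow S (vec_nth h) e < Pmax S e"
          using adm e by (force simp: adm_def)
        from order_tendstoD(2)[OF lim this] show ?thesis by eventually_elim simp
      qed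
    qed
    then have "\<forall>\<^sub>F t in at_right 0. \<forall>e\<in>lines S. Pmin S e \<le> line_flow S \<theta> e + t * line_flow S (vec_nth h) e \<and>
        line_flow S \<theta> e + t * line_flow S (vec_nth h) e \<le> Pmax S e"
      by (intro eventually_ball_finite ballI) auto
    then have "\<forall>\<^sub>F t in at_right 0. adm (\<lambda>i. \<theta> i + t * h $ i)"
    proof eventually_elim
      case (elim t)
      have "area_export S (line_flow S (\<lambda>i. \<theta> i + t * h $ i)) k = Phat S k" if "k \<in> areas S" for k
      proof -
        have "area_export S (line_flow S (\<lambda>i. \<theta> i + t * h $ i)) k
            = area_export S (line_flow S \<theta>) k + t * area_export S (line_flow S (vec_nth h)) k"
          by (simp add: area_export_def flow_add distrib_left sum.distrib sum_distrib_left mult_ac)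
        then show ?thesis using ha[OF that] adm that by (simp add: adm_def)
      qed
      then show ?case using elim by (simp add: adm_def flow_add)
    qed
    then obtain b where b: "b > 0" "\<And>t. 0 < t \<Longrightarrow> t < b \<Longrightarrow> adm (\<lambda>i. \<theta> i + t * h $ i)"
      by (auto simp: eventually_at_right_field)
    have "- (q \<bullet> h) < 0" using \<open>\<not> q \<bullet> h \<le> 0\<close> by simp
    from DERIV_neg_dec_right[OF f_der this] obtain d where d: "d > 0"
      "\<And>t. 0 < t \<Longrightarrow> t < d \<Longrightarrow> f (\<lambda>i. \<theta> i + t * h $ i) < f \<theta>"
      by auto
    define t where "t = min b d / 2"
    have "0 < t" "t < b" "t < d" using b(1) d(1) by (auto simp: t_def)
    then show False using min[OF b(2)] d(2) by (meson not_le)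
  qed
  moreover define C where "C = {v :: real^'n. \<exists>\<pi> rp rm. v = (\<chi> i. outflow S (price_flow S \<pi> rp rm) i) \<and>
      complementary S \<theta> rp rm}"
  have "convex_cone C"
    unfolding convex_cone_iff
  proof (intro conjI ballI allI impI)
    show "0 \<in> C"
      unfolding C_def
      by (auto intro!: exI[of _ "\<lambda>_. 0"] simp: price_flow_def outflow_def vec_eq_iff complementary_def)
    show "x + y \<in> C" if xy: "x \<in> C" "y \<in> C" for x y
    proof -
      obtain \<pi> rp rm where 1: "x = (\<chi> i. outflow S (price_flow S \<pi> rp rm) i)"
        "complementary S \<theta> rp rm"
        using xy(1) unfolding C_def by blast
      obtain \<pi>' rp' rm' where 2: "y = (\<chi> i. outflow S (price_flow S \<pi>' rp' rm') i)"
        "complementary S \<theta> rp' rm'"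
        using xy(2) unfolding C_def by blast
      have "price_flow S (\<lambda>k. \<pi> k + \<pi>' k) (\<lambda>e. rp e + rp' e) (\<lambda>e. rm e + rm' e) =
          (\<lambda>e. price_flow S \<pi> rp rm e + price_flow S \<pi>' rp' rm' e)"
        by (simp add: price_flow_def fun_eq_iff algebra_simps sum.distrib)
      then have "x + y = (\<chi> i. outflow S (price_flow S (\<lambda>k. \<pi> k + \<pi>' k) (\<lambda>e. rp e + rp' e) (\<lambda>e. rm e + rm' e)) i)"
        by (simp add: 1(1) 2(1) vec_eq_iff outflow_linear)
      moreover have "complementary S \<theta> (\<lambda>e. rp e + rp' e) (\<lambda>e. rm e + rm' e)"
        unfolding complementary_def
        by (rule ballI)
          (use bspec[OF 1(2)[unfolded complementary_def]] bspec[OF 2(2)[unfolded complementary_def]]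
            in \<open>simp only: distrib_right add_nonneg_nonneg add_0 simp_thms\<close>)
      ultimately show ?thesis unfolding C_def by blast
    qed
    show "c *\<^sub>R x \<in> C" if x: "x \<in> C" "0 \<le> c" for x c
    proof -
      obtain \<pi> rp rm where 1: "x = (\<chi> i. outflow S (price_flow S \<pi> rp rm) i)"
        "complementary S \<theta> rp rm"
        using x(1) unfolding C_def by blast
      have "price_flow S (\<lambda>k. c * \<pi> k) (\<lambda>e. c * rp e) (\<lambda>e. c * rm e) = (\<lambda>e. c * price_flow S \<pi> rp rm e)"
        by (simp add: price_flow_def fun_eq_iff algebra_simps sum_distrib_left)
      then have "c *\<^sub>R x = (\<chi> i. outflow S (price_flow S (\<lambda>k. c * \<pi> k) (\<lambda>e. c * rp e) (\<lambda>e. c * rm e)) i)"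
        by (simp add: 1(1) vec_eq_iff outflow_linear)
      moreover have "complementary S \<theta> (\<lambda>e. c * rp e) (\<lambda>e. c * rm e)"
        using 1(2) x(2) by (auto simp: complementary_def)
      ultimately show ?thesis unfolding C_def by blast
    qed
  qed
  moreover have "T \<subseteq> C"
  proof -
    have fin: "finite (areas S)" using S by (simp add: valid_network_def)
    have single: "(\<Sum>k'\<in>areas S. area_inc S k' e * (if k' = k then s else 0)) = s * area_inc S k e"
      if "k \<in> areas S" for k s e
      using that fin by (subst sum.remove[of _ k]) (auto intro!: sum.neutral)
    have "s *\<^sub>R va k \<in> C" if "k \<in> areas S" for k s
      unfolding C_def mem_Collect_eq
      by (rule exI[of _ "\<lambda>k'. if k' = k then s else 0"], rule exI[of _ "\<lambda>_. 0"], rule exI[of _ "\<lambda>_. 0"])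
        (use that in \<open>simp add: single price_flow_def va_def vec_eq_iff outflow_def complementary_def sum_distrib_left mult_ac\<close>)
    from this[of _ 1] this[of _ "-1"] have "va k \<in> C" "- va k \<in> C" if "k \<in> areas S" for k
      using that by auto
    moreover have one: "outflow S (\<lambda>e'. suscept S e' * (if e' = e then s else 0)) i = s * (inc i e * suscept S e)"
      if "e \<in> lines S" for e i s
      unfolding outflow_def using that
      by (subst sum.remove[of _ e]) (auto intro!: sum.neutral)
    have "vb e \<in> C" if e: "e \<in> lines S" "line_flow S \<theta> e = Pmax S e" for e
    proof -
      have "price_flow S (\<lambda>_. 0) (\<lambda>e'. if e' = e then 1 else 0) (\<lambda>_. 0) =
          (\<lambda>e'. suscept S e' * (if e' = e then 1 else 0))"
        by (auto simp: price_flow_def)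
      then have eq: "vb e = (\<chi> i. outflow S (price_flow S (\<lambda>_. 0) (\<lambda>e'. if e' = e then 1 else 0) (\<lambda>_. 0)) i)"
        using one[OF e(1), of 1] by (simp add: vb_def vec_eq_iff)
      show ?thesis unfolding C_def mem_Collect_eq
        by (rule exI[of _ "\<lambda>_. 0"], rule exI[of _ "\<lambda>e'. if e' = e then 1 else 0"], rule exI[of _ "\<lambda>_. 0"])
          (use e(2) eq in \<open>auto simp: complementary_def\<close>)
    qed
    moreover have "- vb e \<in> C" if e: "e \<in> lines S" "line_flow S \<theta> e = Pmin S e" for e
    proof -
      have "price_flow S (\<lambda>_. 0) (\<lambda>_. 0) (\<lambda>e'. if e' = e then 1 else 0) =
          (\<lambda>e'. suscept S e' * (if e' = e then - 1 else 0))"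
        by (auto simp: price_flow_def)
      then have eq: "- vb e = (\<chi> i. outflow S (price_flow S (\<lambda>_. 0) (\<lambda>_. 0) (\<lambda>e'. if e' = e then 1 else 0)) i)"
        using one[OF e(1), of "- 1"] by (simp add: vb_def vec_eq_iff)
      show ?thesis unfolding C_def mem_Collect_eq
        by (rule exI[of _ "\<lambda>_. 0"], rule exI[of _ "\<lambda>_. 0"], rule exI[of _ "\<lambda>e'. if e' = e then 1 else 0"])
          (use e(2) eq in \<open>auto simp: complementary_def\<close>)
    qed
    ultimately show ?thesis by (auto simp: T_def)
  qed
  ultimately have "q \<in> C" using hull_minimal[of T C convex_cone] by blast
  then obtain \<pi> rp rm where qC: "q = (\<chi> i. outflow S (price_flow S \<pi> rp rm) i)"
      "complementary S \<theta> rp rm"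
    unfolding C_def by blast
  have "\<forall>i. outflow S (line_flow S (\<lambda>j. c' j (D j))) i = outflow S (price_flow S \<pi> rp rm) i"
    using qC(1) by (simp add: q_def vec_eq_iff)
  then show ?thesis
    using adm qC(2) unfolding adm_def D_def by blast
qed

section \<open>Demand and load frequency response\<close>

lemma increasing_bijection:
  fixes f :: "real \<Rightarrow> real"
  assumes cont: "continuous_on UNIV f" and "m > 0"
    and inc: "\<And>x y. x \<le> y \<Longrightarrow> m * (y - x) \<le> f y - f x"
  shows "bij f"
proof (rule bijI)
  show "inj f"
  proof (rule injI, rule ccontr)
    fix x y assume xy: "f x = f y" "x \<noteq> y"
    then consider "0 < m * (y - x)" "x \<le> y" | "0 < m * (x - y)" "y \<le> x"
      using \<open>m > 0\<close> by (cases "x < y") auto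
    then show False using inc[of x y] inc[of y x] xy(1) by cases linarith+
  qed
  show "surj f"
    unfolding surj_def
  proof
    fix y
    define r where "r = \<bar>y - f 0\<bar> / m"
    have r: "0 \<le> r" "m * r = \<bar>y - f 0\<bar>" using \<open>m > 0\<close> by (auto simp: r_def)
    have "f (- r) \<le> y" "y \<le> f r" using inc[of "- r" 0] inc[of 0 r] r by auto
    moreover have "- r \<le> r" using r by simp
    ultimately obtain x where "f x = y"
      using IVT'[of f "- r" y r] continuous_on_subset[OF cont] by (metis top_greatest)
    then show "\<exists>x. y = f x" by blast
  qed
qed

text \<open>
  The derivative of \<open>\<lambda>s. max\<^sub>v G s v\<close>. Keeping a maximiser fixed while the parameter changes
  bounds the increment of the maximum from both sides.
\<close>

lemma envelope_derivative:
  fixes G :: "real \<Rightarrow> real \<Rightarrow> real"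
  assumes max: "\<And>s v. G s v \<le> G s (m s)"
    and der: "\<And>s v. ((\<lambda>s. G s v) has_real_derivative g s v) (at s)"
    and lip: "\<And>s t v w. \<bar>g s v - g t w\<bar> \<le> A * \<bar>s - t\<bar> + B * \<bar>v - w\<bar>"
    and lip_m: "\<And>s t. \<bar>m s - m t\<bar> \<le> C * \<bar>s - t\<bar>"
    and "0 \<le> A" "0 \<le> B"
  shows "((\<lambda>s. G s (m s)) has_real_derivative g s0 (m s0)) (at s0)"
  unfolding has_field_derivative_iff
proof (rule LIM_zero_cancel, rule Lim_null_comparison)
  define K where "K = A + B * C"
  have mvt: "\<exists>\<xi>. \<bar>\<xi> - s0\<bar> \<le> \<bar>s - s0\<bar> \<and> G s v - G s0 v = (s - s0) * g \<xi> v" if "s \<noteq> s0" for s v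
  proof (cases "s0 < s")
    case True
    from MVT2[OF True, of "\<lambda>s. G s v" "\<lambda>s. g s v"] der obtain \<xi> where
      "s0 < \<xi>" "\<xi> < s" "G s v - G s0 v = (s - s0) * g \<xi> v" by auto
    then show ?thesis by (intro exI[of _ \<xi>]) auto
  next
    case False
    with that have "s < s0" by simp
    from MVT2[OF this, of "\<lambda>s. G s v" "\<lambda>s. g s v"] der obtain \<xi> where
      "s < \<xi>" "\<xi> < s0" "G s0 v - G s v = (s0 - s) * g \<xi> v" by auto
    then show ?thesis by (intro exI[of _ \<xi>]) (auto simp: algebra_simps)
  qed
  have quot: "\<bar>(G s (m s) - G s0 (m s0)) / (s - s0) - g s0 (m s0)\<bar> \<le> K * \<bar>s - s0\<bar>" if ne: "s \<noteq> s0" for s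
  proof -
    obtain \<xi> where \<xi>: "\<bar>\<xi> - s0\<bar> \<le> \<bar>s - s0\<bar>" "G s (m s) - G s0 (m s) = (s - s0) * g \<xi> (m s)"
      using mvt[OF ne] by blast
    obtain \<eta> where \<eta>: "\<bar>\<eta> - s0\<bar> \<le> \<bar>s - s0\<bar>" "G s (m s0) - G s0 (m s0) = (s - s0) * g \<eta> (m s0)"
      using mvt[OF ne] by blast
    have BC: "0 \<le> B * (C * \<bar>s - s0\<bar>)" 
      using order_trans[OF abs_ge_zero lip_m[of s s0]] \<open>0 \<le> B\<close> by simp
    have "\<bar>g \<xi> (m s) - g s0 (m s0)\<bar> \<le> A * \<bar>\<xi> - s0\<bar> + B * \<bar>m s - m s0\<bar>" by (rule lip)
    also have "\<dots> \<le> A * \<bar>s - s0\<bar> + B * (C * \<bar>s - s0\<bar>)"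
      using \<xi>(1) lip_m \<open>0 \<le> A\<close> \<open>0 \<le> B\<close> by (intro add_mono mult_left_mono)
    finally have 1: "\<bar>g \<xi> (m s) - g s0 (m s0)\<bar> \<le> K * \<bar>s - s0\<bar>" by (simp add: K_def algebra_simps)
    have "\<bar>g \<eta> (m s0) - g s0 (m s0)\<bar> \<le> A * \<bar>\<eta> - s0\<bar> + B * \<bar>m s0 - m s0\<bar>" by (rule lip)
    also have "\<dots> \<le> A * \<bar>s - s0\<bar> + B * (C * \<bar>s - s0\<bar>)"
      using mult_left_mono[OF \<eta>(1) \<open>0 \<le> A\<close>] BC by simp
    finally have 2: "\<bar>g \<eta> (m s0) - g s0 (m s0)\<bar> \<le> K * \<bar>s - s0\<bar>" by (simp add: K_def algebra_simps)
    define q where "q = (G s (m s) - G s0 (m s0)) / (s - s0)"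
    have eq: "G s (m s) - G s0 (m s0) = (s - s0) * q" using ne by (simp add: q_def)
    have up: "(s - s0) * q \<le> (s - s0) * g \<xi> (m s)" using max[of s0 "m s"] \<xi>(2) eq by linarith
    have lo: "(s - s0) * g \<eta> (m s0) \<le> (s - s0) * q" using max[of s "m s0"] \<eta>(2) eq by linarith
    have "\<bar>q - g s0 (m s0)\<bar> \<le> K * \<bar>s - s0\<bar>"
    proof (cases "s > s0")
      case True
      then have "q \<le> g \<xi> (m s)" "g \<eta> (m s0) \<le> q" using up lo by simp_all
      then show ?thesis using 1 2 by linarith
    next
      case False
      then have "s - s0 < 0" using ne by simp
      then have "g \<xi> (m s) \<le> q" "q \<le> g \<eta> (m s0)" using up lo by (simp_all add: mult_le_cancel_left_neg)
      then show ?thesis using 1 2 by linarith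
    qed
    then show ?thesis by (simp add: q_def)
  qed
  show "\<forall>\<^sub>F s in at s0. norm ((G s (m s) - G s0 (m s0)) / (s - s0) - g s0 (m s0)) \<le> K * \<bar>s - s0\<bar>"
    unfolding eventually_at_filter using quot by (auto intro!: always_eventually)
  have "((\<lambda>s. K * \<bar>s - s0\<bar>) \<longlongrightarrow> K * \<bar>s0 - s0\<bar>) (at s0)" by (intro tendsto_intros)
  then show "((\<lambda>s. K * \<bar>s - s0\<bar>) \<longlongrightarrow> 0) (at s0)" by simp
qed

lemma decreasing_derivative_maximum:
  fixes g :: "real \<Rightarrow> real"
  assumes der: "\<And>v. (g has_real_derivative g' v) (at v)"
    and dec: "\<And>v w. v < w \<Longrightarrow> g' w < g' v" and zero: "g' m = 0" and "v \<noteq> m"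
  shows "g v < g m"
proof (cases "v < m")
  case True
  show ?thesis
    by (rule DERIV_pos_imp_increasing_open[OF True])
      (use der dec zero in \<open>auto intro!: DERIV_isCont continuous_at_imp_continuous_on, metis\<close>)
next
  case False
  with \<open>v \<noteq> m\<close> have "m < v" by simp
  then show ?thesis
    by (rule DERIV_neg_imp_decreasing_open)
      (use der dec zero in \<open>auto intro!: DERIV_isCont continuous_at_imp_continuous_on, metis\<close>)
qed

locale olc_network =
  fixes S :: "('n::finite, 'k) network" and \<alpha> ell :: real
  assumes valid: "valid_network S"
    and convex_costs: "costs_strongly_convex S \<alpha>"
    and feasible_OLC: "strictly_feasible S"
    and lipschitz_costs: "marginal_costs_lipschitz S ell"
begin

lemma alpha_pos: "\<alpha> > 0"
  using convex_costs by (simp add: costs_strongly_convex_def)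

lemma ell_pos: "ell > 0"
  using lipschitz_costs by (simp add: marginal_costs_lipschitz_def)

text \<open>A Lipschitz derivative keeps the cost bounded near a finite end point of the load interval,
  where it would have to tend to infinity.\<close>

lemma load_interval_UNIV: "interior (load_set S i) = UNIV"
proof -
  let ?I = "interior (load_set S i)"
  obtain d where d: "d \<in> ?I" using feasible_OLC by (auto simp: strictly_feasible_def)
  have der: "(cost S i has_real_derivative deriv (cost S i) x) (at x)" if "x \<in> ?I" for x
    using convex_costs that by (auto simp: costs_strongly_convex_def DERIV_deriv_iff_field_differentiable)
  have lip: "\<bar>deriv (cost S i) x - deriv (cost S i) y\<bar> \<le> ell * \<bar>x - y\<bar>" if "x \<in> ?I" "y \<in> ?I" for x y
    using lipschitz_costs that
    by (auto simp: marginal_costs_lipschitz_def lipschitz_on_def dist_real_def)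
  have "d \<in> load_set S i" using d interior_subset by blast
  obtain e where e: "e > 0" "ball d e \<subseteq> load_set S i" using d by (meson mem_interior)
  have "d - e/2 \<in> load_set S i" "d + e/2 \<in> load_set S i"
    using e by (auto simp: dist_real_def intro!: subsetD[OF e(2)])
  then have "dlow S i \<le> ereal (d - e/2)" "ereal (d + e/2) \<le> dup S i" by (auto simp: load_set_def)
  moreover have "ereal (d - e/2) < ereal d" "ereal d < ereal (d + e/2)" using e(1) by auto
  ultimately have strict: "dlow S i < ereal d" "ereal d < dup S i"
    using le_less_trans less_le_trans by blast+
  have inI: "x \<in> ?I" if "dlow S i < ereal x" "ereal x < dup S i" for x
  proof -
    have "open {x. dlow S i < ereal x \<and> ereal x < dup S i}"
      by (intro open_Collect_conj open_Collect_less continuous_intros)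
    moreover have "{x. dlow S i < ereal x \<and> ereal x < dup S i} \<subseteq> load_set S i"
      by (auto simp: load_set_def)
    ultimately show ?thesis using that interior_maximal by blast
  qed
  have bound: "cost S i x \<le> cost S i d + (\<bar>deriv (cost S i) d\<bar> + ell * c) * c"
    if x: "dlow S i < ereal x" "ereal x < dup S i" and c: "\<bar>x - d\<bar> \<le> c" for x c
  proof (cases "x = d")
    case False
    have between: "y \<in> ?I" if "min x d \<le> y" "y \<le> max x d" for y
    proof (rule inI)
      have "dlow S i < ereal (min x d)" "ereal (max x d) < dup S i"
        using x strict by (simp_all add: min_def max_def)
      moreover have "ereal (min x d) \<le> ereal y" "ereal y \<le> ereal (max x d)"
        using that by (simp_all only: ereal_less_eq)
      ultimately show "dlow S i < ereal y" "ereal y < dup S i"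
        using less_le_trans le_less_trans by blast+
    qed
    have "min x d < max x d" using False by auto
    from MVT2[OF this, of "cost S i" "deriv (cost S i)"] der between obtain \<xi> where
      \<xi>: "min x d < \<xi>" "\<xi> < max x d"
      "cost S i (max x d) - cost S i (min x d) = (max x d - min x d) * deriv (cost S i) \<xi>" by auto
    have "\<bar>deriv (cost S i) \<xi> - deriv (cost S i) d\<bar> \<le> ell * \<bar>\<xi> - d\<bar>"
      using between[of \<xi>] \<xi> by (intro lip d) auto
    also have "\<dots> \<le> ell * c" using \<xi> c ell_pos by (intro mult_left_mono) auto
    finally have b: "\<bar>deriv (cost S i) \<xi>\<bar> \<le> \<bar>deriv (cost S i) d\<bar> + ell * c" by linarith
    have "\<bar>cost S i x - cost S i d\<bar> = \<bar>x - d\<bar> * \<bar>deriv (cost S i) \<xi>\<bar>"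
      using \<xi>(3) by (cases "x \<le> d") (auto simp: abs_mult abs_minus_commute min_def max_def)
    also have "\<dots> \<le> c * (\<bar>deriv (cost S i) d\<bar> + ell * c)"
      using b c by (intro mult_mono) auto
    finally show ?thesis by (simp add: mult.commute)
  next
    case True
    then show ?thesis using c ell_pos by simp
  qed
  have "dlow S i = - \<infinity>"
  proof (rule ccontr)
    assume "dlow S i \<noteq> - \<infinity>"
    then obtain r where r: "dlow S i = ereal r" using strict(1) by (cases "dlow S i") auto
    define B where "B = cost S i d + (\<bar>deriv (cost S i) d\<bar> + ell * \<bar>r - d\<bar>) * \<bar>r - d\<bar>"
    have "filterlim (\<lambda>d. cost S i (real_of_ereal d)) at_top (at_right (ereal r))"
      using convex_costs r unfolding costs_strongly_convex_def by metis
    then have "\<forall>\<^sub>F y in at_right (ereal r). B < cost S i (real_of_ereal y)"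
      by (simp add: filterlim_at_top_dense)
    then obtain b where b: "b > ereal r" "\<And>y. ereal r < y \<Longrightarrow> y < b \<Longrightarrow> B < cost S i (real_of_ereal y)"
      using eventually_at_right[of "ereal r" "ereal d"] strict(1) r by auto
    obtain x where x: "ereal r < ereal x" "ereal x < min b (ereal d)"
      using ereal_dense2[of "ereal r" "min b (ereal d)"] b(1) strict(1) r by auto
    then have "B < cost S i x" using b(2)[of "ereal x"] by simp
    moreover have "cost S i x \<le> B"
      unfolding B_def using x r less_trans[OF _ strict(2), of "ereal x"] by (intro bound) auto
    ultimately show False by simp
  qed
  moreover have "dup S i = \<infinity>"
  proof (rule ccontr)
    assume "dup S i \<noteq> \<infinity>"
    then obtain r where r: "dup S i = ereal r" using strict(2) by (cases "dup S i") auto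
    define B where "B = cost S i d + (\<bar>deriv (cost S i) d\<bar> + ell * \<bar>r - d\<bar>) * \<bar>r - d\<bar>"
    have "filterlim (\<lambda>d. cost S i (real_of_ereal d)) at_top (at_left (ereal r))"
      using convex_costs r unfolding costs_strongly_convex_def by metis
    then have "\<forall>\<^sub>F y in at_left (ereal r). B < cost S i (real_of_ereal y)"
      by (simp add: filterlim_at_top_dense)
    then obtain b where b: "b < ereal r" "\<And>y. b < y \<Longrightarrow> y < ereal r \<Longrightarrow> B < cost S i (real_of_ereal y)"
      using eventually_at_left[of "ereal d" "ereal r"] strict(2) r by auto
    obtain x where x: "max b (ereal d) < ereal x" "ereal x < ereal r"
      using ereal_dense2[of "max b (ereal d)" "ereal r"] b(1) strict(2) r by auto
    then have "B < cost S i x" using b(2)[of "ereal x"] by simp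
    moreover have "cost S i x \<le> B"
      unfolding B_def using x r less_trans[OF strict(1), of "ereal x"] by (intro bound) auto
    ultimately show False by simp
  qed
  ultimately have "load_set S i = UNIV" by (simp add: load_set_def)
  then show ?thesis by simp
qed

abbreviation marginal :: "'n \<Rightarrow> real \<Rightarrow> real" where
  "marginal i \<equiv> deriv (cost S i)"

lemma cost_derivative: "(cost S i has_real_derivative marginal i d) (at d)"
  using convex_costs load_interval_UNIV
  by (auto simp: costs_strongly_convex_def DERIV_deriv_iff_field_differentiable)

lemma marginal_derivative: "(marginal i has_real_derivative deriv (marginal i) d) (at d)"
  using convex_costs load_interval_UNIV
  by (auto simp: costs_strongly_convex_def DERIV_deriv_iff_field_differentiable)

lemma marginal_slope: "deriv (marginal i) d \<ge> \<alpha>"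
  using convex_costs load_interval_UNIV by (auto simp: costs_strongly_convex_def)

lemma marginal_continuous: "continuous_on UNIV (marginal i)"
  using marginal_derivative DERIV_isCont continuous_at_imp_continuous_on by blast

lemma marginal_increasing: "x \<le> y \<Longrightarrow> \<alpha> * (y - x) \<le> marginal i y - marginal i x"
proof (cases "x = y")
  case False
  assume "x \<le> y"
  with False have "x < y" by simp
  from MVT2[OF this, of "marginal i" "deriv (marginal i)"] marginal_derivative obtain \<xi> where
    "marginal i y - marginal i x = (y - x) * deriv (marginal i) \<xi>" by auto
  then show ?thesis using marginal_slope[of i \<xi>] \<open>x < y\<close> by (simp add: mult.commute)
qed simp

lemma marginal_lipschitz: "\<bar>marginal i x - marginal i y\<bar> \<le> ell * \<bar>x - y\<bar>"
  using lipschitz_costs load_interval_UNIV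
  by (auto simp: marginal_costs_lipschitz_def lipschitz_on_def dist_real_def)

lemma marginal_bij: "bij (marginal i)"
  by (rule increasing_bijection[OF marginal_continuous alpha_pos marginal_increasing])

lemma marginal_demand: "marginal i (demand S i s) = s"
  unfolding demand_def load_interval_UNIV
  using marginal_bij by (intro f_the_inv_into_f) (auto simp: bij_def)

lemma demand_marginal: "demand S i (marginal i d) = d"
  unfolding demand_def load_interval_UNIV
  using marginal_bij by (intro the_inv_into_f_f) (auto simp: bij_def)

lemma demand_slope:
  obtains r where "1 / ell \<le> r" "r \<le> 1 / \<alpha>" "demand S i s - demand S i t = r * (s - t)"
proof (cases "s = t")
  case True
  have "\<alpha> \<le> ell"
    using marginal_increasing[of 0 1 i] marginal_lipschitz[of i 1 0] by auto
  then show thesis using that[of "1 / \<alpha>"] True alpha_pos ell_pos by (simp add: frac_le)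
next
  case False
  have *: "\<exists>r\<ge>1 / ell. r \<le> 1 / \<alpha> \<and> demand S i b - demand S i a = r * (b - a)" if ab: "a < b" for a b
  proof -
    let ?x = "demand S i a" and ?y = "demand S i b"
    have xy: "?x \<le> ?y"
    proof (rule ccontr)
      assume "\<not> ?x \<le> ?y"
      then have "\<alpha> * (?x - ?y) \<le> a - b" "0 < \<alpha> * (?x - ?y)"
        using marginal_increasing[of ?y ?x i] alpha_pos by (simp_all add: marginal_demand)
      then show False using ab by simp
    qed
    have 1: "\<alpha> * (?y - ?x) \<le> b - a" using marginal_increasing[OF xy, of i] by (simp add: marginal_demand)
    have 2: "b - a \<le> ell * (?y - ?x)"
      using marginal_lipschitz[of i ?y ?x] xy ab by (simp add: marginal_demand)
    show ?thesis
      using 1 2 ab alpha_pos ell_pos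
      by (intro exI[of _ "(?y - ?x) / (b - a)"]) (auto simp: field_simps)
  qed
  show thesis
  proof (cases "t < s")
    case True
    then show thesis using *[of t s] that by blast
  next
    case nts: False
    then obtain r where "1 / ell \<le> r" "r \<le> 1 / \<alpha>" "demand S i t - demand S i s = r * (t - s)"
      using *[of s t] False by auto
    then show thesis by (intro that[of r]) (auto simp: algebra_simps)
  qed
qed

lemma demand_lipschitz: "\<bar>demand S i s - demand S i t\<bar> \<le> 1 / \<alpha> * \<bar>s - t\<bar>"
proof -
  obtain r where r: "1 / ell \<le> r" "r \<le> 1 / \<alpha>" "demand S i s - demand S i t = r * (s - t)"
    using demand_slope by metis
  have "0 \<le> r" using r(1) ell_pos by (meson order_trans zero_le_divide_1_iff less_imp_le)
  then show ?thesis using r(3) mult_right_mono[OF r(2), of "\<bar>s - t\<bar>"] by (simp add: abs_mult)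
qed

lemma demand_increasing: "s \<le> t \<Longrightarrow> demand S i s \<le> demand S i t"
proof -
  assume st: "s \<le> t"
  obtain r where r: "1 / ell \<le> r" "r \<le> 1 / \<alpha>" "demand S i t - demand S i s = r * (t - s)"
    using demand_slope by metis
  have "0 \<le> r" using r(1) ell_pos by (meson order_trans zero_le_divide_1_iff less_imp_le)
  then have "0 \<le> r * (t - s)" using st by simp
  then show ?thesis using r(3) by linarith
qed

lemma demand_continuous: "isCont (demand S i) s"
proof -
  have "(1 / \<alpha>)-lipschitz_on UNIV (demand S i)"
    using demand_lipschitz alpha_pos by (intro lipschitz_onI) (auto simp: dist_real_def)
  then show ?thesis
    using lipschitz_on_continuous_on by (metis continuous_on_eq_continuous_at open_UNIV UNIV_I)
qed

text \<open>The terms with the derivative of the demand cancel, because the marginal cost at the demand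
  is the price.\<close>

lemma conjugate_derivative:
  "((\<lambda>s. cost S i (demand S i s) - s * demand S i s) has_real_derivative - demand S i s) (at s)"
proof -
  let ?d = "deriv (marginal i) (demand S i s)"
  have nz: "?d \<noteq> 0" using marginal_slope[of i "demand S i s"] alpha_pos by linarith
  have "(demand S i has_real_derivative inverse ?d) (at s)"
    by (rule DERIV_inverse_function[of "marginal i" ?d "demand S i" s "s - 1" "s + 1"])
      (use marginal_derivative nz demand_continuous in \<open>auto simp: marginal_demand\<close>)
  then have "((\<lambda>s. cost S i (demand S i s) - s * demand S i s) has_real_derivative
      marginal i (demand S i s) * inverse ?d - (1 * demand S i s + inverse ?d * s)) (at s)"
    by (intro DERIV_diff DERIV_chain2[OF cost_derivative] DERIV_mult DERIV_ident)
  then show ?thesis by (simp add: marginal_demand algebra_simps)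
qed

lemma damp_pos: "damp S i > 0"
  using valid by (simp add: valid_network_def)

lemma Phi_derivative_lambda:
  "((\<lambda>l. Phi S i l v) has_real_derivative Pin S i - demand S i (l + v)) (at l)"
proof -
  have "((\<lambda>l. cost S i (demand S i (l + v)) - (l + v) * demand S i (l + v)) has_real_derivative
      - demand S i (l + v)) (at l)"
    using conjugate_derivative[of i "l + v"] by (simp add: DERIV_shift)
  then have "((\<lambda>l. (cost S i (demand S i (l + v)) - (l + v) * demand S i (l + v))
      - damp S i / 2 * v\<^sup>2 + (l + v) * Pin S i) has_real_derivative
      - demand S i (l + v) - 0 + (1 + 0) * Pin S i) (at l)"
    by (intro DERIV_add DERIV_diff DERIV_const DERIV_cmult_right DERIV_ident)
  then show ?thesis by (simp add: Phi_def[abs_def])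
qed

lemma Phi_derivative_nu:
  "((\<lambda>v. Phi S i l v) has_real_derivative Pin S i - demand S i (l + v) - damp S i * v) (at v)"
proof -
  have "((\<lambda>v. cost S i (demand S i (v + l)) - (v + l) * demand S i (v + l)) has_real_derivative
      - demand S i (v + l)) (at v)"
    using conjugate_derivative[of i "v + l"] by (simp add: DERIV_shift)
  then have "((\<lambda>v. cost S i (demand S i (l + v)) - (l + v) * demand S i (l + v)) has_real_derivative
      - demand S i (l + v)) (at v)"
    by (simp add: add.commute)
  moreover have "((\<lambda>v. damp S i / 2 * v\<^sup>2) has_real_derivative damp S i * v) (at v)"
    by (auto intro!: derivative_eq_intros)
  ultimately have "((\<lambda>v. (cost S i (demand S i (l + v)) - (l + v) * demand S i (l + v))
      - damp S i / 2 * v\<^sup>2 + (l + v) * Pin S i) has_real_derivative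
      - demand S i (l + v) - damp S i * v + (0 + 1) * Pin S i) (at v)"
    by (intro DERIV_add DERIV_diff DERIV_const DERIV_cmult_right DERIV_ident)
  then show ?thesis by (simp add: Phi_def[abs_def] algebra_simps)
qed

text \<open>The frequency at a load bus with price \<open>l\<close> and net outflow \<open>p\<close>.\<close>

definition load_freq :: "'n \<Rightarrow> real \<Rightarrow> real \<Rightarrow> real" where
  "load_freq i l p = the_inv (\<lambda>v. demand S i (l + v) + damp S i * v) (Pin S i - p)"

lemma load_freq_balance: "Pin S i - demand S i (l + load_freq i l p) - damp S i * load_freq i l p - p = 0"
proof -
  have "bij (\<lambda>v. demand S i (l + v) + damp S i * v)"
  proof (rule increasing_bijection[OF _ damp_pos])
    show "continuous_on UNIV (\<lambda>v. demand S i (l + v) + damp S i * v)"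
      by (intro continuous_at_imp_continuous_on ballI continuous_intros isCont_o2[OF _ demand_continuous])
    show "damp S i * (y - x) \<le> demand S i (l + y) + damp S i * y - (demand S i (l + x) + damp S i * x)"
      if "x \<le> y" for x y
      using demand_increasing[of "l + x" "l + y" i] that by (simp add: algebra_simps)
  qed
  then have "demand S i (l + load_freq i l p) + damp S i * load_freq i l p = Pin S i - p"
    unfolding load_freq_def using f_the_inv_into_f_bij_betw[of "\<lambda>v. demand S i (l + v) + damp S i * v" UNIV UNIV] by simp
  then show ?thesis by simp
qed

text \<open>The difference of the two balance equations is linear in the differences once the demand
  increment is written as slope times argument.\<close>

lemma load_freq_lipschitz:
  assumes "Pin S i - demand S i (l + v) - damp S i * v - p = 0"
    and "Pin S i - demand S i (l' + v') - damp S i * v' - p' = 0"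
  shows "\<bar>v - v'\<bar> \<le> \<bar>l - l'\<bar> + 1 / damp S i * \<bar>p - p'\<bar>"
proof -
  obtain r where r: "1 / ell \<le> r" "r \<le> 1 / \<alpha>"
    "demand S i (l + v) - demand S i (l' + v') = r * ((l + v) - (l' + v'))"
    using demand_slope by metis
  have r0: "0 \<le> r" using r(1) ell_pos by (meson order_trans zero_le_divide_1_iff less_imp_le)
  have D: "damp S i > 0" by (rule damp_pos)
  have "r * ((l + v) - (l' + v')) + damp S i * v - damp S i * v' + (p - p') = 0"
    using assms r(3) by linarith
  then have "(r + damp S i) * (v - v') = - (r * (l - l')) - (p - p')" by (simp add: algebra_simps)
  then have "(r + damp S i) * \<bar>v - v'\<bar> = \<bar>- (r * (l - l')) - (p - p')\<bar>"
    using r0 D by (metis abs_mult abs_of_pos add_nonneg_pos)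
  also have "\<dots> \<le> r * \<bar>l - l'\<bar> + \<bar>p - p'\<bar>"
  proof -
    have "\<bar>r * (l - l')\<bar> = r * \<bar>l - l'\<bar>" using r0 by (simp add: abs_mult)
    then show ?thesis by linarith
  qed
  also have "\<dots> \<le> (r + damp S i) * (\<bar>l - l'\<bar> + 1 / damp S i * \<bar>p - p'\<bar>)"
    using r0 D by (simp add: field_simps)
  finally show ?thesis using r0 D by (simp add: mult_le_cancel_left_pos add_nonneg_pos)
qed

lemma load_freq_unique:
  assumes "Pin S i - demand S i (l + v) - damp S i * v - p = 0"
  shows "load_freq i l p = v"
  using load_freq_lipschitz[OF load_freq_balance[of i l p] assms] by simp

lemma load_freq_maximum:
  assumes "v \<noteq> load_freq i l p"
  shows "Phi S i l v - v * p < Phi S i l (load_freq i l p) - load_freq i l p * p"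
proof (rule decreasing_derivative_maximum[where g = "\<lambda>v. Phi S i l v - v * p"])
  show "((\<lambda>v. Phi S i l v - v * p) has_real_derivative
      Pin S i - demand S i (l + v) - damp S i * v - p) (at v)" for v
    by (auto intro!: derivative_eq_intros Phi_derivative_nu)
  show "Pin S i - demand S i (l + w) - damp S i * w - p < Pin S i - demand S i (l + v) - damp S i * v - p"
    if "v < w" for v w
    using demand_increasing[of "l + v" "l + w" i] that mult_strict_left_mono[OF that damp_pos[of i]] by auto
qed (use load_freq_balance assms in auto)

definition load_value :: "'n \<Rightarrow> real \<Rightarrow> real \<Rightarrow> real" where
  "load_value i l p = Phi S i l (load_freq i l p) - load_freq i l p * p"

lemma load_value_derivative_lambda:
  "((\<lambda>l. load_value i l p) has_real_derivative Pin S i - demand S i (l + load_freq i l p)) (at l)"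
  unfolding load_value_def
proof (rule envelope_derivative[where G = "\<lambda>l v. Phi S i l v - v * p" and A = "1 / \<alpha>" and B = "1 / \<alpha>" and C = 1])
  show "Phi S i s v - v * p \<le> Phi S i s (load_freq i s p) - load_freq i s p * p" for s v
    using load_freq_maximum[of v i s p] by (cases "v = load_freq i s p") auto
  show "((\<lambda>s. Phi S i s v - v * p) has_real_derivative Pin S i - demand S i (s + v)) (at s)" for s v
    by (auto intro!: derivative_eq_intros Phi_derivative_lambda)
  show "\<bar>Pin S i - demand S i (s + v) - (Pin S i - demand S i (t + w))\<bar> \<le> 1 / \<alpha> * \<bar>s - t\<bar> + 1 / \<alpha> * \<bar>v - w\<bar>"
    for s t v w
  proof -
    have "\<bar>demand S i (t + w) - demand S i (s + v)\<bar> \<le> 1 / \<alpha> * \<bar>(t + w) - (s + v)\<bar>" by (rule demand_lipschitz)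
    also have "\<dots> \<le> 1 / \<alpha> * (\<bar>s - t\<bar> + \<bar>v - w\<bar>)" using alpha_pos by (intro mult_left_mono) auto
    finally show ?thesis by (simp add: algebra_simps)
  qed
  show "\<bar>load_freq i s p - load_freq i t p\<bar> \<le> 1 * \<bar>s - t\<bar>" for s t
    using load_freq_lipschitz[OF load_freq_balance load_freq_balance, of i s p t p] by simp
qed (use alpha_pos in auto)

lemma load_value_derivative_p:
  "((\<lambda>p. load_value i l p) has_real_derivative - load_freq i l p) (at p)"
  unfolding load_value_def
proof (rule envelope_derivative[where G = "\<lambda>p v. Phi S i l v - v * p" and A = 0 and B = 1 and C = "1 / damp S i"])
  show "Phi S i l v - v * p \<le> Phi S i l (load_freq i l p) - load_freq i l p * p" for p v
    using load_freq_maximum[of v i l p] by (cases "v = load_freq i l p") auto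
  show "((\<lambda>p. Phi S i l v - v * p) has_real_derivative - v) (at p)" for p v
    by (auto intro!: derivative_eq_intros)
  show "\<bar>load_freq i l s - load_freq i l t\<bar> \<le> 1 / damp S i * \<bar>s - t\<bar>" for s t
    using load_freq_lipschitz[OF load_freq_balance load_freq_balance, of i l s l t] by simp
qed auto

end

section \<open>The reduced Lagrangian\<close>

lemma angle_drop_update: "angle_drop (\<theta>(j := s)) e = angle_drop \<theta> e + inc j e * (s - \<theta> j)"
proof -
  have "angle_drop (\<theta>(j := s)) e = (\<Sum>i\<in>UNIV. inc i e * \<theta> i + (if i = j then inc j e * (s - \<theta> j) else 0))"
    unfolding angle_drop_def by (intro sum.cong) (auto simp: algebra_simps)
  then show ?thesis by (simp add: sum.distrib angle_drop_def)
qed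

lemma outflow_update:
  fixes S :: "('n::finite, 'k) network"
  assumes "e \<in> lines S"
  shows "outflow S (P(e := s)) i = outflow S P i + inc i e * (s - P e)"
proof -
  have "outflow S (P(e := s)) i = (\<Sum>e'\<in>lines S. inc i e' * P e' + (if e' = e then inc i e * (s - P e) else 0))"
    unfolding outflow_def by (intro sum.cong) (auto simp: algebra_simps)
  then show ?thesis using assms by (simp add: sum.distrib outflow_def)
qed

lemma sum_single_update:
  fixes c :: "'a \<Rightarrow> real"
  assumes "finite A" "a \<in> A"
  shows "(\<Sum>b\<in>A. (f(a := s)) b * c b) = (\<Sum>b\<in>A. f b * c b) + c a * (s - f a)"
proof -
  have "(\<Sum>b\<in>A. (f(a := s)) b * c b) = (\<Sum>b\<in>A. f b * c b + (if b = a then c a * (s - f a) else 0))"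
    by (intro sum.cong) (auto simp: algebra_simps)
  then show ?thesis using assms by (simp add: sum.distrib)
qed

lemma sum_perturbed:
  fixes A :: "'a \<Rightarrow> real"
  assumes "finite L" "e \<in> L"
  shows "(\<Sum>i\<in>L. (A i - (C i + (if i = e then d else 0))) * D i) = (\<Sum>i\<in>L. (A i - C i) * D i) - d * D e"
proof -
  have "(\<Sum>i\<in>L. (A i - (C i + (if i = e then d else 0))) * D i)
      = (\<Sum>i\<in>L. (A i - C i) * D i - (if i = e then d * D e else 0))"
    by (intro sum.cong) (auto simp: algebra_simps)
  then show ?thesis using assms by (simp add: sum_subtractf)
qed

lemma update_compose:
  "(x(XPhi i := s)) \<circ> XPhi = (x \<circ> XPhi)(i := s)" "(x(XPhi i := s)) \<circ> XP = x \<circ> XP"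
  "(x(XP e := s)) \<circ> XPhi = x \<circ> XPhi" "(x(XP e := s)) \<circ> XP = (x \<circ> XP)(e := s)"
  "(y(YLam i := s)) \<circ> YLam = (y \<circ> YLam)(i := s)" "(y(YLam i := s)) \<circ> YPi = y \<circ> YPi"
  "(y(YLam i := s)) \<circ> YRhoP = y \<circ> YRhoP" "(y(YLam i := s)) \<circ> YRhoM = y \<circ> YRhoM"
  "(y(YNu i := s)) \<circ> YLam = y \<circ> YLam" "(y(YNu i := s)) \<circ> YPi = y \<circ> YPi"
  "(y(YNu i := s)) \<circ> YRhoP = y \<circ> YRhoP" "(y(YNu i := s)) \<circ> YRhoM = y \<circ> YRhoM"
  "(y(YPi k := s)) \<circ> YLam = y \<circ> YLam" "(y(YPi k := s)) \<circ> YPi = (y \<circ> YPi)(k := s)"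
  "(y(YPi k := s)) \<circ> YRhoP = y \<circ> YRhoP" "(y(YPi k := s)) \<circ> YRhoM = y \<circ> YRhoM"
  "(y(YRhoP e := s)) \<circ> YLam = y \<circ> YLam" "(y(YRhoP e := s)) \<circ> YPi = y \<circ> YPi"
  "(y(YRhoP e := s)) \<circ> YRhoP = (y \<circ> YRhoP)(e := s)" "(y(YRhoP e := s)) \<circ> YRhoM = y \<circ> YRhoM"
  "(y(YRhoM e := s)) \<circ> YLam = y \<circ> YLam" "(y(YRhoM e := s)) \<circ> YPi = y \<circ> YPi"
  "(y(YRhoM e := s)) \<circ> YRhoP = y \<circ> YRhoP" "(y(YRhoM e := s)) \<circ> YRhoM = (y \<circ> YRhoM)(e := s)"
  by (auto simp: fun_eq_iff)

lemma partial_eq: "((\<lambda>s. f (z(p := s))) has_real_derivative D) (at (z p)) \<Longrightarrow> partial f p z = D"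
  unfolding partial_def by (rule DERIV_imp_deriv)

context olc_network
begin

definition frequency :: "'n xvec \<Rightarrow> ('n, 'k) yvec \<Rightarrow> 'n \<Rightarrow> real" where
  "frequency x y i =
     (if i \<in> gens S then y (YNu i) else load_freq i (y (YLam i)) (outflow S (x \<circ> XP) i))"

text \<open>
  The maximisation over load frequencies separates over the buses. The reduced Lagrangian is the
  sum of the values at the buses and of \<open>network_value\<close>, which contains no frequency.
\<close>

definition bus_value :: "'n xvec \<Rightarrow> ('n, 'k) yvec \<Rightarrow> 'n \<Rightarrow> real" where
  "bus_value x y i =
     (if i \<in> gens S then Phi S i (y (YLam i)) (y (YNu i)) - y (YNu i) * outflow S (x \<circ> XP) i
      else load_value i (y (YLam i)) (outflow S (x \<circ> XP) i))"

definition network_value :: "'n xvec \<Rightarrow> ('n, 'k) yvec \<Rightarrow> real" where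
  "network_value x y =
     - (\<Sum>k\<in>areas S. (y \<circ> YPi) k * Phat S k) - (\<Sum>e\<in>lines S. (y \<circ> YRhoP) e * Pmax S e)
     + (\<Sum>e\<in>lines S. (y \<circ> YRhoM) e * Pmin S e)
     - (\<Sum>e\<in>lines S. (line_flow S (y \<circ> YLam) e - price_flow S (y \<circ> YPi) (y \<circ> YRhoP) (y \<circ> YRhoM) e)
          * angle_drop (x \<circ> XPhi) e)"

lemma finite_areas: "finite (areas S)"
  using valid by (simp add: valid_network_def)

lemma lagrangian_at_eq:
  "lagrangian_at S x y \<nu> =
     (\<Sum>i\<in>UNIV. Phi S i (y (YLam i)) (\<nu> i) - \<nu> i * outflow S (x \<circ> XP) i) + network_value x y"
proof -
  let ?l = "y \<circ> YLam" and ?\<pi> = "y \<circ> YPi" and ?rp = "y \<circ> YRhoP" and ?rm = "y \<circ> YRhoM" and ?P = "x \<circ> XP"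
  have 1: "(\<Sum>e\<in>lines S. ?P e * (\<Sum>i\<in>UNIV. inc i e * \<nu> i)) = (\<Sum>i\<in>UNIV. \<nu> i * outflow S ?P i)"
    by (simp add: sum_outflow angle_drop_def)
  have 2: "(\<Sum>j\<in>UNIV. laplacian S i j * ?l j)
           - (\<Sum>e\<in>lines S. inc i e * suscept S e * (\<Sum>k\<in>areas S. area_inc S k e * ?\<pi> k))
           - (\<Sum>e\<in>lines S. inc i e * suscept S e * (?rp e - ?rm e))
      = outflow S (\<lambda>e. line_flow S ?l e - price_flow S ?\<pi> ?rp ?rm e) i" for i
    unfolding laplacian_outflow outflow_linear
    by (simp add: outflow_def price_flow_def o_def algebra_simps sum.distrib sum_subtractf)
  show ?thesis
    unfolding lagrangian_at_def lagrangian_def network_value_def prod.case 1 2 sum_outflow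
      sum_subtractf
    by (simp add: o_def)
qed

lemma frequency_extension: "frequency x y \<in> nu_extensions S y"
  by (simp add: frequency_def nu_extensions_def)

lemma lagrangian_at_frequency:
  "lagrangian_at S x y (frequency x y) = (\<Sum>i\<in>UNIV. bus_value x y i) + network_value x y"
  unfolding lagrangian_at_eq
  by (simp only: add_right_cancel, rule sum.cong) (auto simp: bus_value_def frequency_def load_value_def)

lemma lagrangian_at_less:
  assumes "\<nu> \<in> nu_extensions S y" "\<nu> \<noteq> frequency x y"
  shows "lagrangian_at S x y \<nu> < lagrangian_at S x y (frequency x y)"
  unfolding lagrangian_at_eq
proof (rule add_strict_right_mono, rule sum_strict_mono_ex1)
  have less: "Phi S i (y (YLam i)) (\<nu> i) - \<nu> i * outflow S (x \<circ> XP) i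
      < Phi S i (y (YLam i)) (frequency x y i) - frequency x y i * outflow S (x \<circ> XP) i"
    if "\<nu> i \<noteq> frequency x y i" for i
    using that assms(1) load_freq_maximum by (auto simp: frequency_def nu_extensions_def split: if_splits)
  show "\<forall>i\<in>UNIV. Phi S i (y (YLam i)) (\<nu> i) - \<nu> i * outflow S (x \<circ> XP) i
      \<le> Phi S i (y (YLam i)) (frequency x y i) - frequency x y i * outflow S (x \<circ> XP) i"
  proof
    fix i
    show "Phi S i (y (YLam i)) (\<nu> i) - \<nu> i * outflow S (x \<circ> XP) i
      \<le> Phi S i (y (YLam i)) (frequency x y i) - frequency x y i * outflow S (x \<circ> XP) i"
      using less[of i] by (cases "\<nu> i = frequency x y i") auto
  qed
  show "\<exists>i\<in>UNIV. Phi S i (y (YLam i)) (\<nu> i) - \<nu> i * outflow S (x \<circ> XP) i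
      < Phi S i (y (YLam i)) (frequency x y i) - frequency x y i * outflow S (x \<circ> XP) i"
    using assms(2) less by (auto simp: fun_eq_iff)
qed simp

lemma nu_star_frequency: "nu_star S x y = frequency x y"
proof -
  have "is_arg_max (lagrangian_at S x y) (\<lambda>\<nu>. \<nu> \<in> nu_extensions S y) \<nu> \<longleftrightarrow> \<nu> = frequency x y" for \<nu>
    using frequency_extension[of x y] lagrangian_at_less[of _ y x]
    unfolding is_arg_max_def by (metis less_asym)
  then have "is_arg_max (lagrangian_at S x y) (\<lambda>\<nu>. \<nu> \<in> nu_extensions S y) = (\<lambda>\<nu>. \<nu> = frequency x y)"
    by (simp add: fun_eq_iff)
  then show ?thesis unfolding nu_star_def arg_max_def by simp
qed

lemma reduced_lagrangian_eq:
  "reduced_lagrangian S x y = (\<Sum>i\<in>UNIV. bus_value x y i) + network_value x y"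
  unfolding reduced_lagrangian_def lagrangian_at_frequency[symmetric]
proof (rule cSup_eq_maximum)
  show "v \<le> lagrangian_at S x y (frequency x y)" if "v \<in> lagrangian_at S x y ` nu_extensions S y" for v
    using that lagrangian_at_less[of _ y x] by (auto intro: order.strict_implies_order)
qed (use frequency_extension in auto)

lemma sum_bus_derivative:
  fixes bus :: "'n \<Rightarrow> real \<Rightarrow> real"
  assumes "\<And>i. i \<noteq> j \<Longrightarrow> bus i = (\<lambda>s. c i)" and "(bus j has_real_derivative D) (at s)"
  shows "((\<lambda>s. \<Sum>i\<in>UNIV. bus i s) has_real_derivative D) (at s)"
proof -
  have "(bus i has_real_derivative (if i = j then D else 0)) (at s)" for i
    using assms by (cases "i = j") auto
  then have "((\<lambda>s. \<Sum>i\<in>UNIV. bus i s) has_real_derivative (\<Sum>i\<in>UNIV. if i = j then D else 0)) (at s)"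
    by (intro DERIV_sum)
  then show ?thesis by simp
qed

lemma dL_dx_phi:
  "dL_dx S x y (XPhi j) =
     - outflow S (\<lambda>e. line_flow S (y \<circ> YLam) e - price_flow S (y \<circ> YPi) (y \<circ> YRhoP) (y \<circ> YRhoM) e) j"
  unfolding dL_dx_def reduced_lagrangian_eq
proof (rule partial_eq)
  let ?Q = "\<lambda>e. line_flow S (y \<circ> YLam) e - price_flow S (y \<circ> YPi) (y \<circ> YRhoP) (y \<circ> YRhoM) e"
  have bus: "bus_value (x(XPhi j := s)) y i = bus_value x y i" for s i
    by (simp add: bus_value_def update_compose)
  have net: "network_value (x(XPhi j := s)) y = network_value x y - (s - x (XPhi j)) * outflow S ?Q j" for s
    unfolding network_value_def update_compose angle_drop_update distrib_left sum.distrib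
      outflow_def sum_distrib_left
    by (simp add: mult_ac)
  show "((\<lambda>s. (\<Sum>i\<in>UNIV. bus_value (x(XPhi j := s)) y i) + network_value (x(XPhi j := s)) y)
      has_real_derivative - outflow S ?Q j) (at (x (XPhi j)))"
    unfolding bus net by (auto intro!: derivative_eq_intros)
qed

lemma dL_dx_P:
  assumes "e \<in> lines S"
  shows "dL_dx S x y (XP e) = - angle_drop (frequency x y) e"
  unfolding dL_dx_def reduced_lagrangian_eq
proof (rule partial_eq)
  let ?p = "\<lambda>i. outflow S (x \<circ> XP) i"
  have net: "network_value (x(XP e := s)) y = network_value x y" for s
    by (simp add: network_value_def update_compose)
  have p: "outflow S ((x(XP e := s)) \<circ> XP) i = ?p i + inc i e * (s - x (XP e))" for s i
    by (simp add: update_compose outflow_update[OF assms])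
  have p_der: "((\<lambda>s. ?p i + inc i e * (s - x (XP e))) has_real_derivative inc i e) (at (x (XP e)))" for i
    by (auto intro!: derivative_eq_intros)
  have "((\<lambda>s. bus_value (x(XP e := s)) y i) has_real_derivative - frequency x y i * inc i e) (at (x (XP e)))" for i
  proof (cases "i \<in> gens S")
    case True
    then show ?thesis
      unfolding bus_value_def p by (auto intro!: derivative_eq_intros simp: frequency_def)
  next
    case False
    have "((\<lambda>s. load_value i (y (YLam i)) (?p i + inc i e * (s - x (XP e)))) has_real_derivative
        - load_freq i (y (YLam i)) (?p i + inc i e * (x (XP e) - x (XP e))) * inc i e) (at (x (XP e)))"
      by (rule DERIV_chain2[OF load_value_derivative_p p_der])
    then show ?thesis using False unfolding bus_value_def p by (simp add: frequency_def)
  qed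
  then have "((\<lambda>s. \<Sum>i\<in>UNIV. bus_value (x(XP e := s)) y i) has_real_derivative
      (\<Sum>i\<in>UNIV. - frequency x y i * inc i e)) (at (x (XP e)))"
    by (rule DERIV_sum)
  then have "((\<lambda>s. \<Sum>i\<in>UNIV. bus_value (x(XP e := s)) y i) has_real_derivative
      - angle_drop (frequency x y) e) (at (x (XP e)))"
    by (simp add: angle_drop_def sum_negf mult.commute)
  from DERIV_add[OF this DERIV_const]
  show "((\<lambda>s. (\<Sum>i\<in>UNIV. bus_value (x(XP e := s)) y i) + network_value (x(XP e := s)) y)
      has_real_derivative - angle_drop (frequency x y) e) (at (x (XP e)))"
    unfolding net by simp
qed

lemma dL_dy_lambda:
  "dL_dy S x y (YLam j) =
     Pin S j - demand S j (y (YLam j) + frequency x y j) - outflow S (line_flow S (x \<circ> XPhi)) j"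
  unfolding dL_dy_def reduced_lagrangian_eq
proof (rule partial_eq)
  let ?y = "\<lambda>s. y(YLam j := s)"
  have net: "network_value x (?y s) = network_value x y
      - (s - y (YLam j)) * outflow S (line_flow S (x \<circ> XPhi)) j" for s
    by (simp add: network_value_def update_compose line_flow_eq angle_drop_update outflow_def
        algebra_simps sum.distrib sum_subtractf sum_distrib_left)
  have net_der: "((\<lambda>s. network_value x (?y s)) has_real_derivative
      - outflow S (line_flow S (x \<circ> XPhi)) j) (at (y (YLam j)))"
    unfolding net by (auto intro!: derivative_eq_intros)
  have "((\<lambda>s. \<Sum>i\<in>UNIV. bus_value x (?y s) i) has_real_derivative
      Pin S j - demand S j (y (YLam j) + frequency x y j)) (at (y (YLam j)))"
  proof (rule sum_bus_derivative[where bus = "\<lambda>i s. bus_value x (?y s) i"])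
    show "(\<lambda>s. bus_value x (?y s) i) = (\<lambda>s. bus_value x y i)" if "i \<noteq> j" for i
      using that by (auto simp: bus_value_def)
    show "((\<lambda>s. bus_value x (?y s) j) has_real_derivative
        Pin S j - demand S j (y (YLam j) + frequency x y j)) (at (y (YLam j)))"
      using load_value_derivative_lambda[of j "outflow S (x \<circ> XP) j" "y (YLam j)"]
        DERIV_diff[OF Phi_derivative_lambda[of j "y (YNu j)" "y (YLam j)"] DERIV_const[of "y (YNu j) * outflow S (x \<circ> XP) j"]]
      by (auto simp: bus_value_def frequency_def)
  qed
  from DERIV_add[OF this net_der]
  show "((\<lambda>s. (\<Sum>i\<in>UNIV. bus_value x (?y s) i) + network_value x (?y s)) has_real_derivative
      Pin S j - demand S j (y (YLam j) + frequency x y j) - outflow S (line_flow S (x \<circ> XPhi)) j) (at (y (YLam j)))"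
    by simp
qed

lemma dL_dy_nu:
  assumes "j \<in> gens S"
  shows "dL_dy S x y (YNu j) =
     Pin S j - demand S j (y (YLam j) + frequency x y j) - damp S j * frequency x y j - outflow S (x \<circ> XP) j"
  unfolding dL_dy_def reduced_lagrangian_eq
proof (rule partial_eq)
  let ?y = "\<lambda>s. y(YNu j := s)"
  have net: "network_value x (?y s) = network_value x y" for s
    by (simp add: network_value_def update_compose)
  have "((\<lambda>s. \<Sum>i\<in>UNIV. bus_value x (?y s) i) has_real_derivative
      Pin S j - demand S j (y (YLam j) + y (YNu j)) - damp S j * y (YNu j) - outflow S (x \<circ> XP) j) (at (y (YNu j)))"
  proof (rule sum_bus_derivative[where bus = "\<lambda>i s. bus_value x (?y s) i"])
    show "(\<lambda>s. bus_value x (?y s) i) = (\<lambda>s. bus_value x y i)" if "i \<noteq> j" for i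
      using that by (auto simp: bus_value_def)
    show "((\<lambda>s. bus_value x (?y s) j) has_real_derivative
        Pin S j - demand S j (y (YLam j) + y (YNu j)) - damp S j * y (YNu j) - outflow S (x \<circ> XP) j) (at (y (YNu j)))"
      using assms DERIV_diff[OF Phi_derivative_nu[of j "y (YLam j)" "y (YNu j)"]
          DERIV_cmult_right[OF DERIV_ident, of "outflow S (x \<circ> XP) j"]]
      by (simp add: bus_value_def)
  qed
  from DERIV_add[OF this DERIV_const]
  show "((\<lambda>s. (\<Sum>i\<in>UNIV. bus_value x (?y s) i) + network_value x (?y s)) has_real_derivative
      Pin S j - demand S j (y (YLam j) + frequency x y j) - damp S j * frequency x y j - outflow S (x \<circ> XP) j) (at (y (YNu j)))"
    unfolding net using assms by (simp add: frequency_def)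
qed

lemma dL_dy_pi:
  assumes "k \<in> areas S"
  shows "dL_dy S x y (YPi k) = area_export S (line_flow S (x \<circ> XPhi)) k - Phat S k"
  unfolding dL_dy_def reduced_lagrangian_eq
proof (rule partial_eq)
  let ?y = "\<lambda>s. y(YPi k := s)"
  have bus: "bus_value x (?y s) i = bus_value x y i" for s i by (simp add: bus_value_def)
  have pf: "price_flow S ((y \<circ> YPi)(k := s)) rp rm e
      = price_flow S (y \<circ> YPi) rp rm e + suscept S e * area_inc S k e * (s - y (YPi k))" for s rp rm e
    unfolding price_flow_def mult.commute[of "area_inc S _ e"] sum_single_update[OF finite_areas assms]
    by (simp add: algebra_simps)
  have net: "network_value x (?y s) = network_value x y
      + (s - y (YPi k)) * (area_export S (line_flow S (x \<circ> XPhi)) k - Phat S k)" for s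
    unfolding network_value_def update_compose pf sum_single_update[OF finite_areas assms]
    by (simp add: area_export_def line_flow_eq algebra_simps sum.distrib sum_subtractf sum_distrib_left)
  show "((\<lambda>s. (\<Sum>i\<in>UNIV. bus_value x (?y s) i) + network_value x (?y s)) has_real_derivative
      area_export S (line_flow S (x \<circ> XPhi)) k - Phat S k) (at (y (YPi k)))"
    unfolding bus net by (auto intro!: derivative_eq_intros)
qed

lemma dL_dy_rhop:
  assumes "e \<in> lines S"
  shows "dL_dy S x y (YRhoP e) = line_flow S (x \<circ> XPhi) e - Pmax S e"
  unfolding dL_dy_def reduced_lagrangian_eq
proof (rule partial_eq)
  let ?y = "\<lambda>s. y(YRhoP e := s)"
  have bus: "bus_value x (?y s) i = bus_value x y i" for s i by (simp add: bus_value_def)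
  have pf: "price_flow S \<pi> ((y \<circ> YRhoP)(e := s)) rm e'
      = price_flow S \<pi> (y \<circ> YRhoP) rm e' + (if e' = e then suscept S e * (s - y (YRhoP e)) else 0)" for s \<pi> rm e'
    by (simp add: price_flow_def algebra_simps)
  have net: "network_value x (?y s) = network_value x y
      + (s - y (YRhoP e)) * (line_flow S (x \<circ> XPhi) e - Pmax S e)" for s
    unfolding network_value_def update_compose pf sum_single_update[OF finite_lines assms]
      sum_perturbed[OF finite_lines assms]
    by (simp add: line_flow_eq algebra_simps)
  show "((\<lambda>s. (\<Sum>i\<in>UNIV. bus_value x (?y s) i) + network_value x (?y s)) has_real_derivative
      line_flow S (x \<circ> XPhi) e - Pmax S e) (at (y (YRhoP e)))"
    unfolding bus net by (auto intro!: derivative_eq_intros)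
qed

lemma dL_dy_rhom:
  assumes "e \<in> lines S"
  shows "dL_dy S x y (YRhoM e) = Pmin S e - line_flow S (x \<circ> XPhi) e"
  unfolding dL_dy_def reduced_lagrangian_eq
proof (rule partial_eq)
  let ?y = "\<lambda>s. y(YRhoM e := s)"
  have bus: "bus_value x (?y s) i = bus_value x y i" for s i by (simp add: bus_value_def)
  have pf: "price_flow S \<pi> rp ((y \<circ> YRhoM)(e := s)) e'
      = price_flow S \<pi> rp (y \<circ> YRhoM) e' + (if e' = e then - (suscept S e * (s - y (YRhoM e))) else 0)" for s \<pi> rp e'
    by (simp add: price_flow_def algebra_simps)
  have net: "network_value x (?y s) = network_value x y
      + (s - y (YRhoM e)) * (Pmin S e - line_flow S (x \<circ> XPhi) e)" for s
    unfolding network_value_def update_compose pf sum_single_update[OF finite_lines assms]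
      sum_perturbed[OF finite_lines assms]
    by (simp add: line_flow_eq algebra_simps)
  show "((\<lambda>s. (\<Sum>i\<in>UNIV. bus_value x (?y s) i) + network_value x (?y s)) has_real_derivative
      Pmin S e - line_flow S (x \<circ> XPhi) e) (at (y (YRhoM e)))"
    unfolding bus net by (auto intro!: derivative_eq_intros)
qed

end

section \<open>The controlled network as a projected flow\<close>

type_synonym ('n, 'k) pos = "'n xpos + ('n, 'k) ypos"

definition state_index :: "('n, 'k) network \<Rightarrow> ('n, 'k) pos set" where
  "state_index S = Inl ` x_index S \<union> Inr ` y_index S"

text \<open>The positions on which the projection acts.\<close>

definition limit_index :: "('n, 'k) pos set" where
  "limit_index = Inr ` (range YRhoP \<union> range YRhoM)"

lemma sum_x_index: "(\<Sum>p\<in>x_index S. f p) = (\<Sum>i\<in>UNIV. f (XPhi i)) + (\<Sum>e\<in>lines S. f (XP e))"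
  for S :: "('n::finite, 'k) network"
proof -
  have "(\<Sum>p\<in>x_index S. f p) = (\<Sum>p\<in>range XPhi. f p) + (\<Sum>p\<in>XP ` lines S. f p)"
    unfolding x_index_def by (rule sum.union_disjoint) auto
  then show ?thesis by (simp add: sum.reindex inj_on_def)
qed

lemma sum_y_index:
  fixes S :: "('n::finite, 'k) network"
  assumes "finite (areas S)"
  shows "(\<Sum>q\<in>y_index S. f q) = (\<Sum>i\<in>UNIV. f (YLam i)) + (\<Sum>i\<in>gens S. f (YNu i))
     + (\<Sum>k\<in>areas S. f (YPi k)) + (\<Sum>e\<in>lines S. f (YRhoP e)) + (\<Sum>e\<in>lines S. f (YRhoM e))"
proof -
  let ?L = "range YLam :: ('n, 'k) ypos set" and ?N = "YNu ` gens S" and ?P = "YPi ` areas S"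
    and ?R = "YRhoP ` lines S" and ?M = "YRhoM ` lines S"
  have "sum f (?L \<union> ?N \<union> ?P \<union> ?R \<union> ?M) = sum f (?L \<union> ?N \<union> ?P \<union> ?R) + sum f ?M"
    by (rule sum.union_disjoint) (use assms in auto)
  moreover have "sum f (?L \<union> ?N \<union> ?P \<union> ?R) = sum f (?L \<union> ?N \<union> ?P) + sum f ?R"
    by (rule sum.union_disjoint) (use assms in auto)
  moreover have "sum f (?L \<union> ?N \<union> ?P) = sum f (?L \<union> ?N) + sum f ?P"
    by (rule sum.union_disjoint) (use assms in auto)
  moreover have "sum f (?L \<union> ?N) = sum f ?L + sum f ?N"
    by (rule sum.union_disjoint) auto
  ultimately have "(\<Sum>q\<in>y_index S. f q) = sum f ?L + sum f ?N + sum f ?P + sum f ?R + sum f ?M"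
    unfolding y_index_def by simp
  then show ?thesis by (simp add: sum.reindex inj_on_def)
qed

lemma sum_state_index:
  fixes S :: "('n::finite, 'k) network"
  assumes "finite (areas S)"
  shows "(\<Sum>j\<in>state_index S. f j) = (\<Sum>p\<in>x_index S. f (Inl p)) + (\<Sum>q\<in>y_index S. f (Inr q))"
proof -
  have "finite (x_index S)" "finite (y_index S)" using assms by (auto simp: x_index_def y_index_def)
  then have "(\<Sum>j\<in>state_index S. f j) = (\<Sum>j\<in>Inl ` x_index S. f j) + (\<Sum>j\<in>Inr ` y_index S. f j)"
    unfolding state_index_def by (intro sum.union_disjoint) auto
  then show ?thesis by (simp add: sum.reindex)
qed

definition sum_lipschitz :: "'a set \<Rightarrow> (('a \<Rightarrow> real) \<Rightarrow> real) \<Rightarrow> bool" where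
  "sum_lipschitz J f \<longleftrightarrow> (\<exists>K\<ge>0. \<forall>z z'. \<bar>f z - f z'\<bar> \<le> K * (\<Sum>i\<in>J. \<bar>z i - z' i\<bar>))"

lemma sum_lipschitz_const: "sum_lipschitz J (\<lambda>z. c)"
  unfolding sum_lipschitz_def by (rule exI[of _ 0]) simp

lemma sum_lipschitz_component: "finite J \<Longrightarrow> i \<in> J \<Longrightarrow> sum_lipschitz J (\<lambda>z. z i)"
  unfolding sum_lipschitz_def
  by (rule exI[of _ 1]) (auto intro!: member_le_sum[of i J "\<lambda>i. \<bar>_ i - _ i\<bar>"])

lemma sum_lipschitz_bound:
  assumes "sum_lipschitz J f" "sum_lipschitz J g" "0 \<le> a" "0 \<le> b"
    and h: "\<And>z z'. \<bar>h z - h z'\<bar> \<le> a * \<bar>f z - f z'\<bar> + b * \<bar>g z - g z'\<bar>"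
  shows "sum_lipschitz J h"
proof -
  obtain A where A: "0 \<le> A" "\<And>z z'. \<bar>f z - f z'\<bar> \<le> A * (\<Sum>i\<in>J. \<bar>z i - z' i\<bar>)"
    using assms(1) unfolding sum_lipschitz_def by blast
  obtain B where B: "0 \<le> B" "\<And>z z'. \<bar>g z - g z'\<bar> \<le> B * (\<Sum>i\<in>J. \<bar>z i - z' i\<bar>)"
    using assms(2) unfolding sum_lipschitz_def by blast
  have "\<bar>h z - h z'\<bar> \<le> (a * A + b * B) * (\<Sum>i\<in>J. \<bar>z i - z' i\<bar>)" for z z'
    using h[of z z'] mult_left_mono[OF A(2)[of z z'] \<open>0 \<le> a\<close>] mult_left_mono[OF B(2)[of z z'] \<open>0 \<le> b\<close>]
    by (simp add: algebra_simps)
  then show ?thesis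
    unfolding sum_lipschitz_def using A(1) B(1) assms(3,4) by (intro exI[of _ "a * A + b * B"]) auto
qed

lemma sum_lipschitz_add:
  "sum_lipschitz J f \<Longrightarrow> sum_lipschitz J g \<Longrightarrow> sum_lipschitz J (\<lambda>z. f z + g z)"
  by (rule sum_lipschitz_bound[of J f g 1 1]) auto

lemma sum_lipschitz_diff:
  "sum_lipschitz J f \<Longrightarrow> sum_lipschitz J g \<Longrightarrow> sum_lipschitz J (\<lambda>z. f z - g z)"
  by (rule sum_lipschitz_bound[of J f g 1 1]) auto

lemma sum_lipschitz_cmult: "sum_lipschitz J f \<Longrightarrow> sum_lipschitz J (\<lambda>z. c * f z)"
  by (rule sum_lipschitz_bound[of J f f "\<bar>c\<bar>" 0]) (auto simp: abs_mult simp flip: right_diff_distrib)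

lemma sum_lipschitz_minus: "sum_lipschitz J f \<Longrightarrow> sum_lipschitz J (\<lambda>z. - f z)"
  by (rule sum_lipschitz_bound[of J f f 1 0]) auto

lemma sum_lipschitz_sum:
  "(\<And>a. a \<in> A \<Longrightarrow> sum_lipschitz J (f a)) \<Longrightarrow> sum_lipschitz J (\<lambda>z. \<Sum>a\<in>A. f a z)"
  by (induction A rule: infinite_finite_induct) (auto intro: sum_lipschitz_const sum_lipschitz_add)

lemmas sum_lipschitz_intros =
  sum_lipschitz_sum sum_lipschitz_add sum_lipschitz_diff sum_lipschitz_minus sum_lipschitz_cmult

locale olc_control = olc_network S \<alpha> ell
  for S :: "('n::finite, 'k) network" and \<alpha> ell :: real +
  fixes \<delta>a :: "'n \<Rightarrow> real" and X :: "'n xvec" and Y :: "('n, 'k) yvec"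
  assumes X_pos: "\<And>p. p \<in> x_index S \<Longrightarrow> X p > 0" and Y_pos: "\<And>q. q \<in> y_index S \<Longrightarrow> Y q > 0"
    and damping: "\<And>i. (\<delta>a i)\<^sup>2 < 4 / ell * (damp S i + \<delta>a i)"
begin

text \<open>The right-hand side before gains and projection are applied.\<close>

definition field :: "(('n, 'k) pos \<Rightarrow> real) \<Rightarrow> ('n, 'k) pos \<Rightarrow> real" where
  "field z j = (case j of
      Inl p \<Rightarrow> - dL_dx S (z \<circ> Inl) (z \<circ> Inr) p
    | Inr q \<Rightarrow> dL_dy S (z \<circ> Inl) (z \<circ> Inr) q + perturbation S \<delta>a (z \<circ> Inl) (z \<circ> Inr) q)"

abbreviation freq :: "(('n, 'k) pos \<Rightarrow> real) \<Rightarrow> 'n \<Rightarrow> real" where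
  "freq z \<equiv> frequency (z \<circ> Inl) (z \<circ> Inr)"

definition phi where "phi z i = z (Inl (XPhi i))" for z :: "('n, 'k) pos \<Rightarrow> real"
definition flow where "flow z e = z (Inl (XP e))" for z :: "('n, 'k) pos \<Rightarrow> real"
definition lam where "lam z i = z (Inr (YLam i))" for z :: "('n, 'k) pos \<Rightarrow> real"
definition prices where
  "prices z = price_flow S (\<lambda>k. z (Inr (YPi k))) (\<lambda>e. z (Inr (YRhoP e))) (\<lambda>e. z (Inr (YRhoM e)))"
  for z :: "('n, 'k) pos \<Rightarrow> real"

lemma state_components:
  "(z \<circ> Inl) \<circ> XPhi = phi z" "(z \<circ> Inl) \<circ> XP = flow z" "(z \<circ> Inr) \<circ> YLam = lam z"
  "price_flow S ((z \<circ> Inr) \<circ> YPi) ((z \<circ> Inr) \<circ> YRhoP) ((z \<circ> Inr) \<circ> YRhoM) = prices z"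
  "(z \<circ> Inr) (YLam i) = lam z i"
  by (simp_all add: fun_eq_iff phi_def flow_def lam_def prices_def o_def)

lemma freq_eq:
  "freq z i = (if i \<in> gens S then z (Inr (YNu i)) else load_freq i (lam z i) (outflow S (flow z) i))"
  by (simp add: frequency_def state_components) (simp add: lam_def)

lemma field_phi: "field z (Inl (XPhi i)) = outflow S (\<lambda>e. line_flow S (lam z) e - prices z e) i"
  by (simp add: field_def dL_dx_phi state_components)

lemma field_flow: "e \<in> lines S \<Longrightarrow> field z (Inl (XP e)) = angle_drop (freq z) e"
  by (simp add: field_def dL_dx_P)

lemma field_lam: "field z (Inr (YLam i)) =
    Pin S i - demand S i (lam z i + freq z i) - outflow S (line_flow S (phi z)) i + \<delta>a i * freq z i"
  by (simp add: field_def dL_dy_lambda state_components perturbation_def nu_star_frequency)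
    (simp add: frequency_def lam_def)

lemma field_nu: "i \<in> gens S \<Longrightarrow> field z (Inr (YNu i)) =
    Pin S i - demand S i (lam z i + freq z i) - damp S i * freq z i - outflow S (flow z) i"
  by (simp add: field_def dL_dy_nu state_components perturbation_def) (simp add: lam_def)

lemma load_balance: "i \<notin> gens S \<Longrightarrow>
    Pin S i - demand S i (lam z i + freq z i) - damp S i * freq z i - outflow S (flow z) i = 0"
  using load_freq_balance[of i "lam z i" "outflow S (flow z) i"] by (simp add: freq_eq)

lemma field_pi: "k \<in> areas S \<Longrightarrow> field z (Inr (YPi k)) = area_export S (line_flow S (phi z)) k - Phat S k"
  by (simp add: field_def dL_dy_pi state_components perturbation_def)

lemma field_rhop: "e \<in> lines S \<Longrightarrow> field z (Inr (YRhoP e)) = line_flow S (phi z) e - Pmax S e"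
  by (simp add: field_def dL_dy_rhop state_components perturbation_def)

lemma field_rhom: "e \<in> lines S \<Longrightarrow> field z (Inr (YRhoM e)) = Pmin S e - line_flow S (phi z) e"
  by (simp add: field_def dL_dy_rhom state_components perturbation_def)

lemma finite_state: "finite (state_index S)"
  using finite_areas by (auto simp: state_index_def x_index_def y_index_def)

lemma state_index_cases:
  assumes "j \<in> state_index S"
  obtains i where "j = Inl (XPhi i)" | e where "e \<in> lines S" "j = Inl (XP e)" | i where "j = Inr (YLam i)"
    | i where "i \<in> gens S" "j = Inr (YNu i)" | k where "k \<in> areas S" "j = Inr (YPi k)"
    | e where "e \<in> lines S" "j = Inr (YRhoP e)" | e where "e \<in> lines S" "j = Inr (YRhoM e)"
  using assms by (auto simp: state_index_def x_index_def y_index_def)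

lemma in_state_index:
  "Inl (XPhi i) \<in> state_index S" "e \<in> lines S \<Longrightarrow> Inl (XP e) \<in> state_index S"
  "Inr (YLam i) \<in> state_index S" "i \<in> gens S \<Longrightarrow> Inr (YNu i) \<in> state_index S"
  "k \<in> areas S \<Longrightarrow> Inr (YPi k) \<in> state_index S"
  "e \<in> lines S \<Longrightarrow> Inr (YRhoP e) \<in> state_index S" "e \<in> lines S \<Longrightarrow> Inr (YRhoM e) \<in> state_index S"
  by (auto simp: state_index_def x_index_def y_index_def)

lemma field_lipschitz_component:
  assumes j: "j \<in> state_index S"
  shows "sum_lipschitz (state_index S) (\<lambda>z. field z j)"
proof -
  let ?L = "sum_lipschitz (state_index S)"
  note comp = sum_lipschitz_component[OF finite_state]
  have out: "?L (\<lambda>z. outflow S (flow z) i)" for i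
    unfolding outflow_def flow_def by (intro sum_lipschitz_intros comp in_state_index)
  have lf: "?L (\<lambda>z. line_flow S (phi z) e)" "?L (\<lambda>z. line_flow S (lam z) e)" for e
    unfolding line_flow_def phi_def lam_def by (intro sum_lipschitz_intros comp in_state_index)+
  have pr: "?L (\<lambda>z. prices z e)" if "e \<in> lines S" for e
    unfolding prices_def price_flow_def by (intro sum_lipschitz_intros comp in_state_index that)
  have lam: "?L (\<lambda>z. lam z i)" for i
    unfolding lam_def by (intro comp in_state_index)
  have fr: "?L (\<lambda>z. freq z i)" for i
  proof (cases "i \<in> gens S")
    case True
    then show ?thesis by (simp add: freq_eq) (intro comp in_state_index)
  next
    case False
    have "?L (\<lambda>z. load_freq i (lam z i) (outflow S (flow z) i))"
      by (rule sum_lipschitz_bound[OF lam[of i] out[of i], of 1 "1 / damp S i"])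
        (use damp_pos[of i] load_freq_lipschitz[OF load_freq_balance load_freq_balance] in auto)
    then show ?thesis using False by (simp add: freq_eq)
  qed
  have de: "?L (\<lambda>z. demand S i (lam z i + freq z i))" for i
    by (rule sum_lipschitz_bound[OF sum_lipschitz_add[OF lam[of i] fr[of i]] sum_lipschitz_const, of "1 / \<alpha>" 0])
      (use alpha_pos demand_lipschitz in auto)
  from j show ?thesis
  proof (cases rule: state_index_cases)
    case (1 i)
    then show ?thesis
      by (simp add: field_phi) (unfold outflow_def, intro sum_lipschitz_intros lf pr)
  next
    case (2 e)
    then show ?thesis
      by (simp add: field_flow) (unfold angle_drop_def, intro sum_lipschitz_intros fr)
  next
    case (3 i)
    then show ?thesis
      by (simp add: field_lam)
        (unfold outflow_def, intro sum_lipschitz_intros sum_lipschitz_const fr de lf)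
  next
    case (4 i)
    then show ?thesis
      by (simp add: field_nu) (intro sum_lipschitz_intros sum_lipschitz_const fr de out)
  next
    case (5 k)
    then show ?thesis
      by (simp add: field_pi) (unfold area_export_def, intro sum_lipschitz_intros sum_lipschitz_const lf)
  next
    case (6 e)
    then show ?thesis
      by (simp add: field_rhop) (intro sum_lipschitz_intros sum_lipschitz_const lf)
  next
    case (7 e)
    then show ?thesis
      by (simp add: field_rhom) (intro sum_lipschitz_intros sum_lipschitz_const lf)
  qed
qed

lemma field_lipschitz:
  "\<exists>K>0. \<forall>j\<in>state_index S. \<forall>z z'. \<bar>field z j - field z' j\<bar> \<le> K * (\<Sum>i\<in>state_index S. \<bar>z i - z' i\<bar>)"
proof -
  let ?d = "\<lambda>z z'. \<Sum>i\<in>state_index S. \<bar>z i - z' i\<bar>"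
  have "\<forall>j. \<exists>K. j \<in> state_index S \<longrightarrow> 0 \<le> K \<and> (\<forall>z z'. \<bar>field z j - field z' j\<bar> \<le> K * ?d z z')"
    using field_lipschitz_component unfolding sum_lipschitz_def by blast
  then obtain K where K: "\<And>j. j \<in> state_index S \<Longrightarrow> 0 \<le> K j"
    "\<And>j z z'. j \<in> state_index S \<Longrightarrow> \<bar>field z j - field z' j\<bar> \<le> K j * ?d z z'"
    by metis
  have "\<bar>field z j - field z' j\<bar> \<le> (sum K (state_index S) + 1) * ?d z z'" if j: "j \<in> state_index S" for j z z'
  proof -
    have "K j \<le> sum K (state_index S) + 1"
      using member_le_sum[of j "state_index S" K] j K(1) finite_state by force
    then have "K j * ?d z z' \<le> (sum K (state_index S) + 1) * ?d z z'"
      by (intro mult_right_mono sum_nonneg) auto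
    then show ?thesis using K(2)[OF j, of z z'] by linarith
  qed
  moreover have "sum K (state_index S) + 1 > 0" using K(1) by (intro add_nonneg_pos sum_nonneg) auto
  ultimately show ?thesis by blast
qed

text \<open>
  The saddle structure makes every term that couples buses cancel, and each bus contributes a
  quadratic form in its price and frequency.
\<close>

lemma field_dissipation:
  fixes z z' :: "('n, 'k) pos \<Rightarrow> real"
  defines "n \<equiv> \<lambda>i. freq z i - freq z' i"
    and "dd \<equiv> \<lambda>i. demand S i (lam z i + freq z i) - demand S i (lam z' i + freq z' i)"
  shows "(\<Sum>j\<in>state_index S. (z j - z' j) * (field z j - field z' j)) =
    (\<Sum>i\<in>UNIV. - ((lam z i - lam z' i + n i) * dd i) - damp S i * (n i)\<^sup>2
       + \<delta>a i * (lam z i - lam z' i) * n i)"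
proof -
  define f where "f i = phi z i - phi z' i" for i
  define l where "l i = lam z i - lam z' i" for i
  define P where "P e = flow z e - flow z' e" for e
  define Q where "Q e = prices z e - prices z' e" for e
  have lf: "line_flow S (phi z) e - line_flow S (phi z') e = line_flow S f e"
    "line_flow S (lam z) e - line_flow S (lam z') e = line_flow S l e" for e
    by (simp_all add: line_flow_eq f_def[abs_def] l_def[abs_def] angle_drop_linear algebra_simps)
  have out: "outflow S (line_flow S (phi z)) i - outflow S (line_flow S (phi z')) i = outflow S (line_flow S f) i"
    "outflow S (flow z) i - outflow S (flow z') i = outflow S P i" for i
    by (simp_all add: outflow_linear(2)[symmetric] lf P_def[abs_def])
  have 1: "(\<Sum>i\<in>UNIV. (z (Inl (XPhi i)) - z' (Inl (XPhi i))) * (field z (Inl (XPhi i)) - field z' (Inl (XPhi i))))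
      = (\<Sum>e\<in>lines S. line_flow S l e * angle_drop f e) - (\<Sum>e\<in>lines S. Q e * angle_drop f e)"
  proof -
    have "field z (Inl (XPhi i)) - field z' (Inl (XPhi i)) = outflow S (\<lambda>e. line_flow S l e - Q e) i" for i
      by (simp add: field_phi outflow_linear(2)[symmetric]) (simp add: lf(2)[symmetric] Q_def algebra_simps)
    then show ?thesis
      using sum_outflow[of f S "\<lambda>e. line_flow S l e - Q e"]
      by (simp add: f_def phi_def left_diff_distrib sum_subtractf)
  qed
  have 2: "(\<Sum>e\<in>lines S. (z (Inl (XP e)) - z' (Inl (XP e))) * (field z (Inl (XP e)) - field z' (Inl (XP e))))
      = (\<Sum>i\<in>UNIV. n i * outflow S P i)"
    unfolding sum_outflow
    by (intro sum.cong) (simp_all add: field_flow n_def angle_drop_linear P_def flow_def)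
  have 3: "(\<Sum>i\<in>UNIV. (z (Inr (YLam i)) - z' (Inr (YLam i))) * (field z (Inr (YLam i)) - field z' (Inr (YLam i))))
      = (\<Sum>i\<in>UNIV. l i * (\<delta>a i * n i - dd i)) - (\<Sum>e\<in>lines S. line_flow S l e * angle_drop f e)"
  proof -
    have "field z (Inr (YLam i)) - field z' (Inr (YLam i)) = \<delta>a i * n i - dd i - outflow S (line_flow S f) i" for i
      by (simp add: field_lam n_def dd_def out(1)[symmetric] algebra_simps)
    then have "(\<Sum>i\<in>UNIV. (z (Inr (YLam i)) - z' (Inr (YLam i))) * (field z (Inr (YLam i)) - field z' (Inr (YLam i))))
      = (\<Sum>i\<in>UNIV. l i * (\<delta>a i * n i - dd i)) - (\<Sum>i\<in>UNIV. l i * outflow S (line_flow S f) i)"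
      by (simp add: l_def lam_def sum_subtractf[symmetric] right_diff_distrib[symmetric])
    also have "(\<Sum>i\<in>UNIV. l i * outflow S (line_flow S f) i) = (\<Sum>e\<in>lines S. line_flow S l e * angle_drop f e)"
      unfolding sum_outflow by (intro sum.cong) (simp_all add: line_flow_eq mult_ac)
    finally show ?thesis .
  qed
  have 4: "(\<Sum>i\<in>gens S. (z (Inr (YNu i)) - z' (Inr (YNu i))) * (field z (Inr (YNu i)) - field z' (Inr (YNu i))))
      = (\<Sum>i\<in>UNIV. n i * (- dd i - damp S i * n i)) - (\<Sum>i\<in>UNIV. n i * outflow S P i)"
  proof -
    have bal: "- dd i - damp S i * n i - outflow S P i = 0" if "i \<notin> gens S" for i
      using load_balance[OF that, of z] load_balance[OF that, of z'] out(2)[of i]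
      by (simp add: n_def dd_def algebra_simps)
    have gen: "(z (Inr (YNu i)) - z' (Inr (YNu i))) * (field z (Inr (YNu i)) - field z' (Inr (YNu i)))
        = n i * (- dd i - damp S i * n i - outflow S P i)" if "i \<in> gens S" for i
    proof -
      have "z (Inr (YNu i)) - z' (Inr (YNu i)) = n i" using that by (simp add: n_def freq_eq)
      moreover have "field z (Inr (YNu i)) - field z' (Inr (YNu i)) = - dd i - damp S i * n i - outflow S P i"
        using that by (simp add: field_nu n_def dd_def out(2)[symmetric] algebra_simps)
      ultimately show ?thesis by simp
    qed
    have "(\<Sum>i\<in>gens S. (z (Inr (YNu i)) - z' (Inr (YNu i))) * (field z (Inr (YNu i)) - field z' (Inr (YNu i))))
        = (\<Sum>i\<in>gens S. n i * (- dd i - damp S i * n i - outflow S P i))"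
      by (intro sum.cong gen) auto
    also have "\<dots> = (\<Sum>i\<in>UNIV. n i * (- dd i - damp S i * n i - outflow S P i))"
      by (intro sum.mono_neutral_left) (use bal in auto)
    finally show ?thesis by (simp add: right_diff_distrib sum_subtractf)
  qed
  have 5: "(\<Sum>k\<in>areas S. (z (Inr (YPi k)) - z' (Inr (YPi k))) * (field z (Inr (YPi k)) - field z' (Inr (YPi k))))
      + (\<Sum>e\<in>lines S. (z (Inr (YRhoP e)) - z' (Inr (YRhoP e))) * (field z (Inr (YRhoP e)) - field z' (Inr (YRhoP e))))
      + (\<Sum>e\<in>lines S. (z (Inr (YRhoM e)) - z' (Inr (YRhoM e))) * (field z (Inr (YRhoM e)) - field z' (Inr (YRhoM e))))
      = (\<Sum>e\<in>lines S. Q e * angle_drop f e)"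
  proof -
    let ?p = "\<lambda>k. z (Inr (YPi k)) - z' (Inr (YPi k))"
    let ?rp = "\<lambda>e. z (Inr (YRhoP e)) - z' (Inr (YRhoP e))"
    let ?rm = "\<lambda>e. z (Inr (YRhoM e)) - z' (Inr (YRhoM e))"
    have Q: "Q e = suscept S e * ((\<Sum>k\<in>areas S. area_inc S k e * ?p k) + (?rp e - ?rm e))" for e
      by (simp add: Q_def prices_def price_flow_def right_diff_distrib sum_subtractf algebra_simps)
    have pi: "field z (Inr (YPi k)) - field z' (Inr (YPi k)) = (\<Sum>e\<in>lines S. area_inc S k e * line_flow S f e)"
      if "k \<in> areas S" for k
      using that by (simp add: field_pi area_export_def lf(1)[symmetric] right_diff_distrib sum_subtractf)
    have rp: "field z (Inr (YRhoP e)) - field z' (Inr (YRhoP e)) = line_flow S f e" if "e \<in> lines S" for e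
      using that by (simp add: field_rhop lf(1)[symmetric])
    have rm: "field z (Inr (YRhoM e)) - field z' (Inr (YRhoM e)) = - line_flow S f e" if "e \<in> lines S" for e
      using that by (simp add: field_rhom lf(1)[symmetric])
    have "(\<Sum>k\<in>areas S. ?p k * (field z (Inr (YPi k)) - field z' (Inr (YPi k))))
        = (\<Sum>k\<in>areas S. \<Sum>e\<in>lines S. area_inc S k e * ?p k * line_flow S f e)"
      by (intro sum.cong) (simp_all add: pi sum_distrib_left mult_ac)
    also have "\<dots> = (\<Sum>e\<in>lines S. (\<Sum>k\<in>areas S. area_inc S k e * ?p k) * line_flow S f e)"
      by (subst sum.swap) (simp add: sum_distrib_right)
    finally show ?thesis
      by (simp add: rp rm Q line_flow_eq sum.distrib[symmetric] algebra_simps)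
  qed
  have "(\<Sum>j\<in>state_index S. (z j - z' j) * (field z j - field z' j))
      = (\<Sum>i\<in>UNIV. l i * (\<delta>a i * n i - dd i)) + (\<Sum>i\<in>UNIV. n i * (- dd i - damp S i * n i))"
    unfolding sum_state_index[OF finite_areas] sum_x_index sum_y_index[OF finite_areas] 1 2 3 4
    using 5 by simp
  also have "\<dots> = (\<Sum>i\<in>UNIV. - ((l i + n i) * dd i) - damp S i * (n i)\<^sup>2 + \<delta>a i * l i * n i)"
    unfolding sum.distrib[symmetric] by (intro sum.cong) (simp_all add: algebra_simps power2_eq_square)
  finally show ?thesis by (simp add: l_def)
qed

text \<open>
  With \<open>u = l + n\<close> and demand slope \<open>r \<ge> 1 / ell\<close> the form is
  \<open>- r * u\<^sup>2 + \<delta>a * u * n - (damp + \<delta>a) * n\<^sup>2\<close>, and the condition on \<open>\<delta>a\<close> is the negativity of its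
  discriminant in the worst case \<open>r = 1 / ell\<close>.
\<close>

lemma bus_dissipation:
  fixes i :: 'n and l n r :: real
  assumes r: "1 / ell \<le> r"
  defines "q \<equiv> - ((l + n) * (r * (l + n))) - damp S i * n\<^sup>2 + \<delta>a i * l * n"
  shows "q \<le> 0" "q = 0 \<Longrightarrow> l = 0 \<and> n = 0"
proof -
  let ?u = "l + n" and ?D = "damp S i + \<delta>a i"
  have q: "q = - (r * ?u\<^sup>2) + \<delta>a i * ?u * n - ?D * n\<^sup>2"
    by (simp add: q_def power2_eq_square algebra_simps)
  (* Complete the square in 2 / ell * u after scaling by 4 / ell. *)
  have "1 / ell * ?u\<^sup>2 \<le> r * ?u\<^sup>2" using r by (rule mult_right_mono) simp
  then have "4 / ell * q \<le> 4 / ell * (- (1 / ell * ?u\<^sup>2) + \<delta>a i * ?u * n - ?D * n\<^sup>2)"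
    unfolding q using ell_pos by (intro mult_left_mono) auto
  also have "\<dots> = - (2 / ell * ?u - \<delta>a i * n)\<^sup>2 - (4 / ell * ?D - (\<delta>a i)\<^sup>2) * n\<^sup>2"
    using ell_pos by (simp add: power2_eq_square field_simps)
  finally have le: "4 / ell * q \<le> - (2 / ell * ?u - \<delta>a i * n)\<^sup>2 - (4 / ell * ?D - (\<delta>a i)\<^sup>2) * n\<^sup>2" .
  have pos: "4 / ell * ?D - (\<delta>a i)\<^sup>2 > 0" using damping[of i] by simp
  then have nn: "0 \<le> (4 / ell * ?D - (\<delta>a i)\<^sup>2) * n\<^sup>2" by simp
  have "4 / ell * q \<le> 0" using le nn zero_le_power2[of "2 / ell * ?u - \<delta>a i * n"] by linarith
  then show "q \<le> 0" using ell_pos by (simp add: mult_le_0_iff divide_le_0_iff)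
  assume "q = 0"
  then have "(2 / ell * ?u - \<delta>a i * n)\<^sup>2 + (4 / ell * ?D - (\<delta>a i)\<^sup>2) * n\<^sup>2 \<le> 0" using le by simp
  then have "(2 / ell * ?u - \<delta>a i * n)\<^sup>2 = 0" "(4 / ell * ?D - (\<delta>a i)\<^sup>2) * n\<^sup>2 = 0"
    using nn zero_le_power2[of "2 / ell * ?u - \<delta>a i * n"] by linarith+
  then show "l = 0 \<and> n = 0" using pos ell_pos by auto
qed

lemma bus_term:
  defines "t \<equiv> \<lambda>z z' i. - ((lam z i - lam z' i + (freq z i - freq z' i)) *
        (demand S i (lam z i + freq z i) - demand S i (lam z' i + freq z' i)))
      - damp S i * (freq z i - freq z' i)\<^sup>2 + \<delta>a i * (lam z i - lam z' i) * (freq z i - freq z' i)"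
  shows "t z z' i \<le> 0" "t z z' i = 0 \<Longrightarrow> lam z i = lam z' i \<and> freq z i = freq z' i"
proof -
  obtain r where r: "1 / ell \<le> r" "demand S i (lam z i + freq z i) - demand S i (lam z' i + freq z' i)
      = r * ((lam z i + freq z i) - (lam z' i + freq z' i))"
    using demand_slope by metis
  have e: "(lam z i + freq z i) - (lam z' i + freq z' i) = lam z i - lam z' i + (freq z i - freq z' i)" by simp
  show "t z z' i \<le> 0"
    unfolding t_def r(2) e by (rule bus_dissipation(1)[OF r(1)])
  assume "t z z' i = 0"
  then have "lam z i - lam z' i = 0 \<and> freq z i - freq z' i = 0"
    unfolding t_def r(2) e by (rule bus_dissipation(2)[OF r(1)])
  then show "lam z i = lam z' i \<and> freq z i = freq z' i" by simp
qed

lemma field_monotone: "(\<Sum>j\<in>state_index S. (z j - z' j) * (field z j - field z' j)) \<le> 0"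
  unfolding field_dissipation by (intro sum_nonpos bus_term(1))

lemma field_monotone_strict:
  assumes "(\<Sum>j\<in>state_index S. (z j - z' j) * (field z j - field z' j)) = 0"
  shows "lam z i = lam z' i" "freq z i = freq z' i"
proof -
  let ?t = "\<lambda>i. - ((lam z i - lam z' i + (freq z i - freq z' i)) *
        (demand S i (lam z i + freq z i) - demand S i (lam z' i + freq z' i)))
      - damp S i * (freq z i - freq z' i)\<^sup>2 + \<delta>a i * (lam z i - lam z' i) * (freq z i - freq z' i)"
  have nonneg: "0 \<le> - ?t i" if "i \<in> UNIV" for i using bus_term(1)[of z i z'] by (simp only: neg_0_le_iff_le)
  have "(\<Sum>i\<in>UNIV. - ?t i) = 0"
    using assms unfolding field_dissipation sum_negf by (simp only: neg_equal_0_iff_equal)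
  then have "- ?t i = 0"
    using sum_nonneg_eq_0_iff[of UNIV "\<lambda>i. - ?t i", OF finite nonneg] by blast
  then have "?t i = 0" by (simp only: neg_equal_0_iff_equal)
  from bus_term(2)[OF this] show "lam z i = lam z' i" "freq z i = freq z' i" by auto
qed

definition lip_const :: real where
  "lip_const = (SOME K. K > 0 \<and> (\<forall>j\<in>state_index S. \<forall>z z'.
     \<bar>field z j - field z' j\<bar> \<le> K * (\<Sum>i\<in>state_index S. \<bar>z i - z' i\<bar>)))"

lemma lip_const:
  "lip_const > 0"
  "j \<in> state_index S \<Longrightarrow> \<bar>field z j - field z' j\<bar> \<le> lip_const * (\<Sum>i\<in>state_index S. \<bar>z i - z' i\<bar>)"
  using someI_ex[OF field_lipschitz, folded lip_const_def] by blast+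

sublocale F: projected_flow "state_index S" limit_index field "case_sum X Y" lip_const
proof
  show "0 < case_sum X Y j" if "j \<in> state_index S" for j
    using that X_pos Y_pos by (auto simp: state_index_def)
qed (use finite_state lip_const field_monotone in auto)

end

section \<open>Equilibria and convergence\<close>

context olc_control
begin

lemma velocity_simps:
  "F.velocity z (Inl p) = field z (Inl p)"
  "F.velocity z (Inr (YLam i)) = field z (Inr (YLam i))"
  "F.velocity z (Inr (YNu i)) = field z (Inr (YNu i))"
  "F.velocity z (Inr (YPi k)) = field z (Inr (YPi k))"
  "F.velocity z (Inr (YRhoP e)) = clip (z (Inr (YRhoP e))) (field z (Inr (YRhoP e)))"
  "F.velocity z (Inr (YRhoM e)) = clip (z (Inr (YRhoM e))) (field z (Inr (YRhoM e)))"
  unfolding F.velocity_def by (auto simp: limit_index_def)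

lemma velocity_proj_rho:
  "F.velocity z (Inr q) = proj_rho (z \<circ> Inr) (\<lambda>r. field z (Inr r)) q"
  by (cases q) (simp_all add: velocity_simps proj_rho_def clip_def)

lemma feasible_rho_nonneg: "F.feasible z \<longleftrightarrow> rho_nonneg S (z \<circ> Inr)"
  unfolding F.feasible_def rho_nonneg_def
  by (auto simp: state_index_def limit_index_def y_index_def)

lemma solution_caratheodory:
  "F.solution z \<longleftrightarrow> caratheodory_solution S \<delta>a X Y (\<lambda>t. z t \<circ> Inl) (\<lambda>t. z t \<circ> Inr)"
proof -
  have y: "proj_rho (z t \<circ> Inr) (\<lambda>r. field (z t) (Inr r)) q = F.velocity (z t) (Inr q)" for t q
    by (simp add: velocity_proj_rho)
  have fy: "field (z t) (Inr r) = dL_dy S (z t \<circ> Inl) (z t \<circ> Inr) r + perturbation S \<delta>a (z t \<circ> Inl) (z t \<circ> Inr) r"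
    for t r by (simp add: field_def)
  have fx: "- (X p * dL_dx S (z t \<circ> Inl) (z t \<circ> Inr) p) = X p * F.velocity (z t) (Inl p)" for t p
    by (simp add: velocity_simps field_def)
  show ?thesis
    unfolding F.solution_def caratheodory_solution_def
    by (simp add: state_index_def ball_Un fy[symmetric] y fx)
qed

lemma bus_balance:
  assumes "F.equilibrium z"
  shows "Pin S i - demand S i (lam z i + freq z i) - damp S i * freq z i - outflow S (flow z) i = 0"
proof (cases "i \<in> gens S")
  case True
  then have "F.velocity z (Inr (YNu i)) = 0"
    using assms in_state_index by (auto simp: F.equilibrium_def)
  then show ?thesis using True by (simp add: velocity_simps field_nu)
next
  case False
  then show ?thesis by (rule load_balance)
qed

text \<open>At rest all frequencies agree. The difference of the two balance equations, summed over all
  buses, says that a positive multiple of the common frequency is zero.\<close>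

lemma equilibrium_frequency:
  assumes eq: "F.equilibrium z"
  shows "freq z i = 0"
proof -
  have vel: "F.velocity z j = 0" if "j \<in> state_index S" for j
    using eq that by (simp add: F.equilibrium_def)
  have "angle_drop (freq z) e = 0" if "e \<in> lines S" for e
    using vel[OF in_state_index(2)[OF that]] that by (simp add: velocity_simps field_flow)
  then have const: "freq z j = freq z i" for j
    using connected_constant[OF valid] by blast
  have "(damp S j + \<delta>a j) * freq z i = outflow S (line_flow S (phi z)) j - outflow S (flow z) j" for j
    using vel[OF in_state_index(3)[of j]] bus_balance[OF eq, of j] const[of j]
    by (simp add: velocity_simps field_lam algebra_simps)
  then have "(\<Sum>j\<in>UNIV. (damp S j + \<delta>a j) * freq z i)
      = (\<Sum>j\<in>UNIV. outflow S (line_flow S (phi z)) j) - (\<Sum>j\<in>UNIV. outflow S (flow z) j)"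
    by (simp add: sum_subtractf)
  then have "(\<Sum>j\<in>UNIV. damp S j + \<delta>a j) * freq z i = 0"
    by (simp add: sum_outflow_zero[OF valid] sum_distrib_right)
  moreover have "damp S j + \<delta>a j > 0" for j
  proof -
    have "0 < 4 / ell * (damp S j + \<delta>a j)" using damping[of j] zero_le_power2 by (rule le_less_trans[rotated])
    then show ?thesis using ell_pos by (simp add: zero_less_mult_iff zero_less_divide_iff)
  qed
  then have "(\<Sum>j\<in>UNIV. damp S j + \<delta>a j) > 0" by (intro sum_pos) auto
  ultimately show ?thesis by simp
qed

text \<open>The perturbation is proportional to the frequencies, which vanish at an equilibrium.\<close>

lemma equilibrium_optimal:
  assumes eq: "F.equilibrium z"
  shows "(z \<circ> Inl, z \<circ> Inr) \<in> optimal_set S"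
proof -
  have "perturbation S \<delta>a (z \<circ> Inl) (z \<circ> Inr) q = 0" for q
  proof (cases q)
    case (YLam i)
    then show ?thesis
      using equilibrium_frequency[OF eq, of i]
      by (auto simp: perturbation_def nu_star_frequency) (simp add: frequency_def)
  qed (simp_all add: perturbation_def)
  then have "field z (Inr q) = dL_dy S (z \<circ> Inl) (z \<circ> Inr) q" for q by (simp add: field_def)
  then have y: "proj_rho (z \<circ> Inr) (dL_dy S (z \<circ> Inl) (z \<circ> Inr)) q = F.velocity z (Inr q)" for q
    by (simp add: velocity_proj_rho)
  have x: "dL_dx S (z \<circ> Inl) (z \<circ> Inr) p = - F.velocity z (Inl p)" for p
    by (simp add: velocity_simps field_def)
  show ?thesis
    using eq unfolding optimal_set_def F.equilibrium_def feasible_rho_nonneg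
    by (auto simp: x y state_index_def)
qed

text \<open>An optimal dispatch supplies the state: prices are marginal costs, frequencies are zero, and
  the optimal angles serve as \<open>\<phi>\<close> while their line flows serve as \<open>P\<close>.\<close>

lemma equilibrium_exists: "\<exists>z. F.equilibrium z"
proof -
  obtain d0 \<omega>0 \<theta>0 where "OLC_feasible S d0 \<omega>0 \<theta>0"
    using feasible_OLC by (auto simp: strictly_feasible_def)
  from optimal_multipliers[OF valid this cost_derivative] obtain \<theta> \<pi> rp rm where
    area: "\<And>k. k \<in> areas S \<Longrightarrow> area_export S (line_flow S \<theta>) k = Phat S k" and
    limit: "\<And>e. e \<in> lines S \<Longrightarrow> Pmin S e \<le> line_flow S \<theta> e \<and> line_flow S \<theta> e \<le> Pmax S e" and
    rho: "\<And>e. e \<in> lines S \<Longrightarrow> 0 \<le> rp e \<and> 0 \<le> rm e \<and> rp e * (line_flow S \<theta> e - Pmax S e) = 0 \<and>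
        rm e * (Pmin S e - line_flow S \<theta> e) = 0" and
    price: "\<And>i. outflow S (line_flow S (\<lambda>j. marginal j (Pin S j - outflow S (line_flow S \<theta>) j))) i
        = outflow S (price_flow S \<pi> rp rm) i"
    unfolding complementary_def by blast
  define l where "l i = marginal i (Pin S i - outflow S (line_flow S \<theta>) i)" for i
  define z :: "('n, 'k) pos \<Rightarrow> real" where
    "z = case_sum (case_xpos \<theta> (line_flow S \<theta>)) (case_ypos l (\<lambda>i. 0) \<pi> rp rm)"
  have comps: "phi z = \<theta>" "flow z = line_flow S \<theta>" "lam z = l" "prices z = price_flow S \<pi> rp rm"
    by (simp_all add: fun_eq_iff phi_def flow_def lam_def prices_def z_def)
  have rhos: "z (Inr (YRhoP e)) = rp e" "z (Inr (YRhoM e)) = rm e" for e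
    by (simp_all add: z_def)
  have fr: "freq z i = 0" for i
  proof (cases "i \<in> gens S")
    case True
    then show ?thesis by (simp add: freq_eq z_def)
  next
    case False
    have "load_freq i (l i) (outflow S (line_flow S \<theta>) i) = 0"
      by (rule load_freq_unique) (simp add: l_def demand_marginal)
    then show ?thesis using False by (simp add: freq_eq comps)
  qed
  then have fr0: "freq z = (\<lambda>i. 0)" by (simp add: fun_eq_iff)
  have "F.velocity z j = 0" if "j \<in> state_index S" for j
    using that
  proof (cases rule: state_index_cases)
    case (1 i)
    then show ?thesis using price[of i] by (simp add: velocity_simps field_phi comps outflow_linear l_def[abs_def])
  next
    case (2 e)
    then show ?thesis using angle_drop_const[OF valid 2(1)] by (simp add: velocity_simps field_flow fr0)
  next
    case (3 i)
    then show ?thesis by (simp add: velocity_simps field_lam comps fr l_def demand_marginal)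
  next
    case (4 i)
    then show ?thesis by (simp add: velocity_simps field_nu comps fr l_def demand_marginal)
  next
    case (5 k)
    then show ?thesis by (simp add: velocity_simps field_pi comps area)
  next
    case (6 e)
    then show ?thesis using limit[of e] rho[of e]
      by (auto simp: velocity_simps field_rhop comps clip_def rhos)
  next
    case (7 e)
    then show ?thesis using limit[of e] rho[of e]
      by (auto simp: velocity_simps field_rhom comps clip_def rhos)
  qed
  moreover have "F.feasible z"
    using rho by (simp add: feasible_rho_nonneg rho_nonneg_def z_def)
  ultimately show ?thesis by (auto simp: F.equilibrium_def)
qed

text \<open>The projection and the field each dissipate a nonnegative amount. If the total is zero, the field
  dissipates nothing at any bus, and the projection nothing in any component.\<close>

lemma zero_dissipation:
  assumes z: "F.feasible z" and zs: "F.equilibrium zs"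
    and zero: "(\<Sum>j\<in>state_index S. (z j - zs j) * F.velocity z j) = 0"
  shows "lam z i = lam zs i" "freq z i = 0"
    "j \<in> state_index S \<Longrightarrow> (z j - zs j) * F.velocity z j = (z j - zs j) * (field z j - field zs j)"
proof -
  let ?v = "\<lambda>j. (z j - zs j) * F.velocity z j" and ?f = "\<lambda>j. (z j - zs j) * (field z j - field zs j)"
  have vs: "F.velocity zs j = 0" if "j \<in> state_index S" for j
    using zs that by (simp add: F.equilibrium_def)
  have le: "?v j \<le> ?f j" if j: "j \<in> state_index S" for j
  proof (cases "j \<in> limit_index")
    case True
    then have "0 \<le> z j" "0 \<le> zs j" using z zs j by (auto simp: F.feasible_def F.equilibrium_def)
    from clip_monotone[OF this, of "field z j" "field zs j"] vs[OF j] show ?thesis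
      using True by (simp add: F.velocity_def)
  next
    case False
    then show ?thesis using vs[OF j] by (simp add: F.velocity_def)
  qed
  have "(\<Sum>j\<in>state_index S. ?v j) \<le> (\<Sum>j\<in>state_index S. ?f j)" by (rule sum_mono) (rule le)
  with zero field_monotone[of z zs] have f0: "(\<Sum>j\<in>state_index S. ?f j) = 0" by simp
  show "lam z i = lam zs i" "freq z i = 0"
    using field_monotone_strict[OF f0] equilibrium_frequency[OF zs] by simp_all
  have "(\<Sum>j\<in>state_index S. ?f j - ?v j) = 0" using f0 zero by (simp add: sum_subtractf)
  then have "\<forall>j\<in>state_index S. ?f j - ?v j = 0"
    using le finite_state by (subst (asm) sum_nonneg_eq_0_iff) auto
  then show "?v j = ?f j" if "j \<in> state_index S" using that by force
qed

text \<open>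
  Along a solution at constant distance from an equilibrium the dissipation vanishes, so prices
  stay at their equilibrium values and frequencies at zero. The balance equation then fixes the
  angle differences, and with them the forces on \<open>\<pi>\<close> and \<open>\<rho>\<close>. A positive \<open>\<rho>\<close> on a line with slack would
  dissipate, so the projected force on \<open>\<rho>\<close> is zero. The angles can only drift in common, and this
  drift is zero because the outflows sum to zero. All velocities vanish.
\<close>

lemma constant_energy_equilibrium:
  assumes v: "F.solution v" "F.feasible (v 0)" and zs: "F.equilibrium zs"
    and const: "\<And>t. 0 \<le> t \<Longrightarrow> F.energy (v t) zs = F.energy (v 0) zs"
  shows "F.equilibrium (v 0)"
proof -
  have feas: "F.feasible (v t)" if "0 \<le> t" for t
    using F.solution_feasible[OF v that] .
  have vs: "F.velocity zs j = 0" if "j \<in> state_index S" for j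
    using zs that by (simp add: F.equilibrium_def)
  have zero: "AE t in lebesgue. t > 0 \<longrightarrow> (\<Sum>j\<in>state_index S. (v t j - zs j) * F.velocity (v t) j) = 0"
    by (rule F.constant_energy[OF v(1) zs const])
  have cont: "continuous_on {0..} (\<lambda>t. v t j)" if "j \<in> state_index S" for j
    by (rule F.solution_continuous[OF v(1) that])
  have lam: "v t (Inr (YLam i)) = zs (Inr (YLam i))" if t: "0 \<le> t" for t i
  proof -
    have "AE t in lebesgue. t > 0 \<longrightarrow> v t (Inr (YLam i)) - zs (Inr (YLam i)) = 0"
      using zero by eventually_elim (use zero_dissipation(1)[OF feas zs] in \<open>auto simp: lam_def\<close>)
    moreover have "continuous_on {0..} (\<lambda>t. v t (Inr (YLam i)) - zs (Inr (YLam i)))"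
      by (intro continuous_intros cont in_state_index)
    ultimately have "v t (Inr (YLam i)) - zs (Inr (YLam i)) = 0"
      using t by (rule AE_lebesgue_continuous_zero)
    then show ?thesis by simp
  qed
  have nu: "v t (Inr (YNu i)) = 0" if t: "0 \<le> t" and i: "i \<in> gens S" for t i
  proof (rule AE_lebesgue_continuous_zero[OF _ cont t])
    show "AE t in lebesgue. t > 0 \<longrightarrow> v t (Inr (YNu i)) = 0"
      using zero
    proof eventually_elim
      case (elim t)
      then show ?case using zero_dissipation(2)[OF feas zs, of t i] i by (auto simp: freq_eq)
    qed
  qed (use i in \<open>auto intro: in_state_index\<close>)
  have vel_lam: "AE t in lebesgue. \<forall>i\<in>UNIV. t > 0 \<longrightarrow> F.velocity (v t) (Inr (YLam i)) = 0"
    by (intro AE_finite_allI F.constant_component[OF v(1) in_state_index(3) lam]) auto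
  have vel_nu: "AE t in lebesgue. \<forall>i\<in>gens S. t > 0 \<longrightarrow> F.velocity (v t) (Inr (YNu i)) = 0"
    by (intro AE_finite_allI F.constant_component[OF v(1) in_state_index(4) nu]) auto
  have drop_AE: "AE t in lebesgue. t > 0 \<longrightarrow>
      (\<forall>e\<in>lines S. angle_drop (phi (v t)) e - angle_drop (phi zs) e = 0)"
    using zero vel_lam
  proof eventually_elim
    case (elim t)
    show ?case
    proof (intro impI ballI)
      fix e assume t: "t > 0" and e: "e \<in> lines S"
      have z0: "(\<Sum>j\<in>state_index S. (v t j - zs j) * F.velocity (v t) j) = 0" using elim t by simp
      note zd = zero_dissipation(1,2)[OF feas zs z0] t
      have out: "outflow S (line_flow S (\<lambda>i. phi (v t) i - phi zs i)) i = 0" for i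
      proof -
        have "field (v t) (Inr (YLam i)) = 0" "field zs (Inr (YLam i)) = 0"
          using elim t vs[OF in_state_index(3)] by (auto simp: velocity_simps)
        then have "outflow S (line_flow S (phi (v t))) i - outflow S (line_flow S (phi zs)) i = 0"
          using zd equilibrium_frequency[OF zs, of i] by (simp add: field_lam)
        then have "outflow S (\<lambda>e. line_flow S (phi (v t)) e - line_flow S (phi zs) e) i = 0"
          by (simp add: outflow_linear)
        then show ?thesis by (simp add: line_flow_eq[abs_def] angle_drop_linear right_diff_distrib)
      qed
      show "angle_drop (phi (v t)) e - angle_drop (phi zs) e = 0"
        using outflow_zero_imp_drop_zero[OF valid out e] by (simp add: angle_drop_linear)
    qed
  qed
  have drop_eq: "angle_drop (phi (v t)) e = angle_drop (phi zs) e" if t: "0 \<le> t" and e: "e \<in> lines S" for t e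
  proof -
    have "AE t in lebesgue. t > 0 \<longrightarrow> angle_drop (phi (v t)) e - angle_drop (phi zs) e = 0"
      using drop_AE by eventually_elim (use e in blast)
    moreover have "continuous_on {0..} (\<lambda>t. angle_drop (phi (v t)) e - angle_drop (phi zs) e)"
      unfolding angle_drop_def phi_def by (intro continuous_intros cont in_state_index)
    ultimately have "angle_drop (phi (v t)) e - angle_drop (phi zs) e = 0"
      using t by (rule AE_lebesgue_continuous_zero)
    then show ?thesis by simp
  qed
  have flow_eq: "line_flow S (phi (v t)) e = line_flow S (phi zs) e" if "0 \<le> t" "e \<in> lines S" for t e
    using drop_eq[OF that] by (simp add: line_flow_eq)
  obtain i0 :: 'n where True by simp
  have diff: "v t (Inl (XPhi i)) - v t (Inl (XPhi i0)) = phi zs i - phi zs i0" if t: "0 \<le> t" for t i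
  proof -
    have "phi (v t) i - phi zs i = phi (v t) i0 - phi zs i0"
      by (rule connected_constant[OF valid, of "\<lambda>i. phi (v t) i - phi zs i"])
        (use drop_eq[OF t] in \<open>simp add: angle_drop_linear\<close>)
    then show ?thesis by (simp add: phi_def)
  qed
  have "AE t in lebesgue. \<forall>i\<in>UNIV. t > 0 \<longrightarrow>
      X (XPhi i) * F.velocity (v t) (Inl (XPhi i)) = X (XPhi i0) * F.velocity (v t) (Inl (XPhi i0))"
    using F.constant_difference[OF v(1) in_state_index(1) in_state_index(1) diff]
    by (intro AE_finite_allI) auto
  then have vel_phi: "AE t in lebesgue. \<forall>i\<in>UNIV. t > 0 \<longrightarrow> F.velocity (v t) (Inl (XPhi i)) = 0"
  proof eventually_elim
    case (elim t)
    show ?case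
    proof (intro ballI impI)
      fix i assume t: "t > 0"
      define c where "c = X (XPhi i0) * F.velocity (v t) (Inl (XPhi i0))"
      have Xp: "X (XPhi j) > 0" for j by (rule X_pos) (simp add: x_index_def)
      have vel: "F.velocity (v t) (Inl (XPhi j)) = c / X (XPhi j)" for j
      proof -
        have "X (XPhi j) * F.velocity (v t) (Inl (XPhi j)) = c" using elim t by (simp add: c_def)
        then show ?thesis using Xp[of j] by (simp add: field_simps)
      qed
      have "(\<Sum>j\<in>UNIV. F.velocity (v t) (Inl (XPhi j))) = 0"
        by (simp add: velocity_simps field_phi sum_outflow_zero[OF valid])
      then have "c * (\<Sum>j\<in>UNIV. 1 / X (XPhi j)) = 0" by (simp add: vel sum_distrib_left)
      moreover have "(\<Sum>j\<in>UNIV. 1 / X (XPhi j)) > 0" using Xp by (intro sum_pos) auto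
      ultimately have "c = 0" by simp
      then show "F.velocity (v t) (Inl (XPhi i)) = 0" by (simp add: vel)
    qed
  qed
  show ?thesis
  proof (rule F.stationary_equilibrium[OF v])
    show "AE t in lebesgue. t > 0 \<longrightarrow> (\<forall>j\<in>state_index S. F.velocity (v t) j = 0)"
      using zero vel_lam vel_nu vel_phi
    proof eventually_elim
      case (elim t)
      show ?case
      proof (intro impI ballI)
        fix j assume t: "t > 0" and j: "j \<in> state_index S"
        have z0: "(\<Sum>j\<in>state_index S. (v t j - zs j) * F.velocity (v t) j) = 0" using elim t by simp
        have ft: "F.feasible (v t)" using feas t by simp
        note zd = zero_dissipation[OF ft zs z0]
        have rho: "F.velocity (v t) j = 0" if J: "j \<in> limit_index" and eq: "field (v t) j = field zs j"
        proof -
          have "0 \<le> v t j" "0 \<le> zs j" using ft zs j J by (auto simp: F.feasible_def F.equilibrium_def)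
          moreover have "clip (zs j) (field zs j) = 0" using vs[OF j] J by (simp add: F.velocity_def)
          moreover have "(v t j - zs j) * clip (v t j) (field zs j) = 0"
            using zd(3)[OF j] eq J by (simp add: F.velocity_def)
          ultimately have "clip (v t j) (field zs j) = 0" by (rule clip_stationary)
          then show ?thesis using J eq by (simp add: F.velocity_def)
        qed
        from j show "F.velocity (v t) j = 0"
        proof (cases rule: state_index_cases)
          case (1 i)
          then show ?thesis using elim t by simp
        next
          case (2 e)
          have "freq (v t) = (\<lambda>i. 0)" using zd(2) by (simp add: fun_eq_iff)
          then show ?thesis using angle_drop_const[OF valid 2(1)] 2
            by (simp add: velocity_simps field_flow)
        next
          case (3 i)
          then show ?thesis using elim t by simp
        next
          case (4 i)
          then show ?thesis using elim t by simp
        next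
          case (5 k)
          have "area_export S (line_flow S (phi (v t))) k = area_export S (line_flow S (phi zs)) k"
            using flow_eq[of t] t by (simp add: area_export_def)
          then show ?thesis using vs[OF j] 5 by (simp add: velocity_simps field_pi)
        next
          case (6 e)
          then show ?thesis using flow_eq[of t e] t by (intro rho) (auto simp: limit_index_def field_rhop)
        next
          case (7 e)
          then show ?thesis using flow_eq[of t e] t by (intro rho) (auto simp: limit_index_def field_rhom)
        qed
      qed
    qed
  qed
qed

theorem solution_exists_and_converges:
  assumes "rho_nonneg S y\<^sub>0"
  shows "\<exists>x y. caratheodory_solution S \<delta>a X Y x y \<and> x 0 = x\<^sub>0 \<and> y 0 = y\<^sub>0"
    and "\<lbrakk>caratheodory_solution S \<delta>a X Y x y; x 0 = x\<^sub>0; y 0 = y\<^sub>0\<rbrakk> \<Longrightarrow>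
      converges_into S (optimal_set S) x y"
proof -
  have "F.feasible (case_sum x\<^sub>0 y\<^sub>0)" using assms by (simp add: feasible_rho_nonneg case_sum_o_inj)
  then obtain z where z: "F.solution z" "z 0 = case_sum x\<^sub>0 y\<^sub>0" by (rule F.solution_exists)
  show "\<exists>x y. caratheodory_solution S \<delta>a X Y x y \<and> x 0 = x\<^sub>0 \<and> y 0 = y\<^sub>0"
    using z unfolding solution_caratheodory
    by (intro exI[of _ "\<lambda>t. z t \<circ> Inl"] exI[of _ "\<lambda>t. z t \<circ> Inr"]) (simp add: case_sum_o_inj)
  assume xy: "caratheodory_solution S \<delta>a X Y x y" "x 0 = x\<^sub>0" "y 0 = y\<^sub>0"
  define v where "v t = case_sum (x t) (y t)" for t
  have v: "F.solution v" "F.feasible (v 0)"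
    using xy assms by (simp_all add: solution_caratheodory feasible_rho_nonneg v_def case_sum_o_inj)
  obtain zs where zs: "F.equilibrium zs" using equilibrium_exists by blast
  have "\<exists>l. F.equilibrium l \<and> (\<forall>j\<in>state_index S. ((\<lambda>t. v t j) \<longlongrightarrow> l j) at_top)"
  proof (rule F.convergence[OF zs _ v])
    fix u assume "F.solution u" "F.feasible (u 0)" "\<And>t. 0 \<le> t \<Longrightarrow> F.energy (u t) zs = F.energy (u 0) zs"
    from this(1,2) zs this(3) show "F.equilibrium (u 0)" by (rule constant_energy_equilibrium)
  qed blast
  then obtain l where l: "F.equilibrium l" "\<And>j. j \<in> state_index S \<Longrightarrow> ((\<lambda>t. v t j) \<longlongrightarrow> l j) at_top"
    by blast
  have "((\<lambda>t. x t p) \<longlongrightarrow> (l \<circ> Inl) p) at_top" if "p \<in> x_index S" for p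
    using l(2)[of "Inl p"] that by (simp add: v_def state_index_def)
  moreover have "((\<lambda>t. y t q) \<longlongrightarrow> (l \<circ> Inr) q) at_top" if "q \<in> y_index S" for q
    using l(2)[of "Inr q"] that by (simp add: v_def state_index_def)
  ultimately show "converges_into S (optimal_set S) x y"
    unfolding converges_into_def using equilibrium_optimal[OF l(1)] by blast
qed

end

theorem theorem14:
  fixes S :: "('n::finite, 'k) network"
    and \<alpha> ell d' Dmin :: real
    and a \<delta>a :: "'n \<Rightarrow> real"
    and X :: "'n xvec" and Y :: "('n, 'k) yvec"
  assumes "valid_network S"
    and "costs_strongly_convex S \<alpha>"
    and "strictly_feasible S"
    and "marginal_costs_lipschitz S ell"
    and "d' = 1 / ell"
    and "Dmin = Min (range (damp S))"
    and "\<forall>i. \<delta>a i = a i - damp S i"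
    and "\<forall>p\<in>x_index S. X p > 0"
    and "\<forall>q\<in>y_index S. Y q > 0"
    and "\<forall>i. 2 * (d' - sqrt (d'\<^sup>2 + d' * Dmin)) < \<delta>a i \<and>
             \<delta>a i < 2 * (d' + sqrt (d'\<^sup>2 + d' * Dmin))"
  shows "\<forall>x\<^sub>0 y\<^sub>0. rho_nonneg S y\<^sub>0 \<longrightarrow>
     (\<exists>x y. caratheodory_solution S \<delta>a X Y x y \<and> x 0 = x\<^sub>0 \<and> y 0 = y\<^sub>0) \<and>
     (\<forall>x y. caratheodory_solution S \<delta>a X Y x y \<and> x 0 = x\<^sub>0 \<and> y 0 = y\<^sub>0 \<longrightarrow>
        converges_into S (optimal_set S) x y)"
proof -
  have ell: "ell > 0" using assms(4) by (simp add: marginal_costs_lipschitz_def)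
  have damping: "(\<delta>a i)\<^sup>2 < 4 / ell * (damp S i + \<delta>a i)" for i
  proof -
    let ?s = "sqrt (d'\<^sup>2 + d' * Dmin)"
    have d': "d' > 0" using ell assms(5) by simp
    have D: "Dmin \<le> damp S i" unfolding assms(6) by (intro Min_le) auto
    have "Dmin \<in> range (damp S)" unfolding assms(6) by (intro Min_in) auto
    then have "Dmin > 0" using assms(1) by (auto simp: valid_network_def)
    then have s: "?s\<^sup>2 = d'\<^sup>2 + d' * Dmin" using d' by simp
    (* The hypothesis on \<delta>a, read as a distance from the midpoint and squared. *)
    have "\<bar>\<delta>a i - 2 * d'\<bar> < 2 * ?s" using assms(10)[rule_format, of i] by (simp add: abs_less_iff)
    then have "(\<delta>a i - 2 * d')\<^sup>2 < (2 * ?s)\<^sup>2"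
      using power_strict_mono[of "\<bar>\<delta>a i - 2 * d'\<bar>" "2 * ?s" 2] by simp
    also have "\<dots> = 4 * (d'\<^sup>2 + d' * Dmin)" using s by (simp add: power_mult_distrib)
    also have "\<dots> \<le> 4 * (d'\<^sup>2 + d' * damp S i)" using D d' by simp
    finally have "(\<delta>a i)\<^sup>2 < 4 * d' * (damp S i + \<delta>a i)"
      by (simp add: power2_diff power_mult_distrib algebra_simps)
    then show ?thesis by (simp add: assms(5))
  qed
  interpret olc_control S \<alpha> ell \<delta>a X Y
  proof
    show "X p > 0" if "p \<in> x_index S" for p using assms(8) that by blast
    show "Y q > 0" if "q \<in> y_index S" for q using assms(9) that by blast
  qed (fact assms(1-4) damping)+
  show ?thesis
    by (intro allI impI conjI solution_exists_and_converges(1)) (auto intro: solution_exists_and_converges(2))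
qed

end
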